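(* The irreducible CFC-finite Coxeter groups are exactly $A_n$ ($n\geq 1$), $B_n$ ($n\geq 2$), $D_n$ ($n\geq 4$), $E_n$ ($n\geq 6$), $F_n$ ($n\geq 4$), $H_n$ ($n\geq 3$), and $I_2(m)$ ($5\leq m<\infty$). Thus, a Coxeter group is CFC-finite if and only if it is FC-finite.
   Context: Coxeter groups come with a Coxeter system $(W,S)$ of finite rank: $W=\langle S\mid (st)^{m(s,t)}=1\rangle$, where $m(s,t)=m(t,s)\in\{1,2,\dots,\infty\}$, $m(s,t)=1$ iff $s=t$, and $m(s,t)=\infty$ means no relation. The Coxeter graph has vertex set $S$ and an edge $\{s,t\}$ labeled $m(s,t)$ whenever $m(s,t)\ge 3$ (label $3$ omitted); $W$ is irreducible if this graph is connected. An expression for $w$ is a word in $S$ representing $w$; it is reduced if it has minimal length. Two words are commutation equivalent if they differ by a sequence of moves $st\leftrightarrow ts$ with $m(s,t)=2$. An element is fully commutative (FC) if all its reduced expressions are commutation equivalent. A cyclic shift of a word is any word obtained by repeatedly moving the first letter to the end. $w$ is cyclically fully commutative (CFC) if every cyclic shift of every reduced expression for $w$ is a reduced expression for an FC element. $W$ is FC-finite (resp. CFC-finite) if it has only finitely many FC (resp. CFC) elements. The Coxeter graphs, on $n$ vertices, are: $A_n$: a path with all labels $3$. $B_n$: a path whose first edge is labeled $4$, all other edges $3$. $D_n$: a path $v_1,\dots,v_{n-1}$ with one extra vertex joined to $v_2$, all labels $3$. $E_n$: a path $v_1,\dots,v_{n-1}$ with one extra vertex joined to $v_3$, all labels $3$.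 $F_n$: a path $v_1,\dots,v_n$ whose second edge $\{v_2,v_3\}$ is labeled $4$, all other edges $3$. $H_n$: a path whose first edge is labeled $5$, all other edges $3$. $I_2(m)$: two vertices joined by an edge labeled $m$. *)

theory Defs
  imports "HOL-Algebra.Group" "HOL-Library.Extended_Nat"
begin

text \<open>A word is a list of signed letters: \<open>(s, True)\<close> stands for the generator \<open>s\<close> and
  \<open>(s, False)\<close> for its formal inverse.  A relator \<open>r\<close> stands for the relation \<open>r = 1\<close>.\<close>

inductive pres_eq ::
  "'a set \<Rightarrow> ('a \<times> bool) list set \<Rightarrow> ('a \<times> bool) list \<Rightarrow> ('a \<times> bool) list \<Rightarrow> bool"
  for S :: "'a set" and R :: "('a \<times> bool) list set"
where
  pres_refl: "u \<in> lists (S \<times> UNIV) \<Longrightarrow> pres_eq S R u u"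
| pres_sym: "pres_eq S R u v \<Longrightarrow> pres_eq S R v u"
| pres_trans: "pres_eq S R u v \<Longrightarrow> pres_eq S R v w \<Longrightarrow> pres_eq S R u w"
| pres_cancel: "u \<in> lists (S \<times> UNIV) \<Longrightarrow> v \<in> lists (S \<times> UNIV) \<Longrightarrow> s \<in> S \<Longrightarrow>
    pres_eq S R (u @ [(s, b), (s, \<not> b)] @ v) (u @ v)"
| pres_relator: "u \<in> lists (S \<times> UNIV) \<Longrightarrow> v \<in> lists (S \<times> UNIV) \<Longrightarrow>
    r \<in> R \<Longrightarrow> r \<in> lists (S \<times> UNIV) \<Longrightarrow> pres_eq S R (u @ r @ v) (u @ v)"

definition pres_rel ::
  "'a set \<Rightarrow> ('a \<times> bool) list set \<Rightarrow> (('a \<times> bool) list \<times> ('a \<times> bool) list) set" where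
  "pres_rel S R = {(u, v). pres_eq S R u v}"

definition presented_group ::
  "'a set \<Rightarrow> ('a \<times> bool) list set \<Rightarrow> ('a \<times> bool) list set monoid" where
  "presented_group S R =
    \<lparr>carrier = lists (S \<times> UNIV) // pres_rel S R,
     monoid.mult = (\<lambda>A B. \<Union>u\<in>A. \<Union>v\<in>B. pres_rel S R `` {u @ v}),
     one = pres_rel S R `` {[]}\<rparr>"

lemma pres_eq_lists:
  assumes "pres_eq S R u v"
  shows "u \<in> lists (S \<times> UNIV) \<and> v \<in> lists (S \<times> UNIV)"
  using assms by induction auto

lemma pres_eq_append_left:
  assumes "pres_eq S R u v" "w \<in> lists (S \<times> UNIV)"
  shows "pres_eq S R (w @ u) (w @ v)"
  using assms
proof induction
  case (pres_refl u)
  then show ?case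
    using pres_eq.pres_refl[of "w @ u" S R] by simp
next
  case (pres_cancel u v s b)
  then show ?case
    using pres_eq.pres_cancel[of "w @ u" S v s R b] by simp
next
  case (pres_relator u v r)
  then show ?case
    using pres_eq.pres_relator[of "w @ u" S v r R] by simp
next
  case (pres_sym u v)
  then show ?case
    by (simp only: pres_eq.pres_sym)
next
  case (pres_trans u v x)
  show ?case
    by (rule pres_eq.pres_trans[OF pres_trans.IH(1)[OF assms(2)] pres_trans.IH(2)[OF assms(2)]])
qed

lemma pres_eq_append_right:
  assumes "pres_eq S R u v" "w \<in> lists (S \<times> UNIV)"
  shows "pres_eq S R (u @ w) (v @ w)"
  using assms
proof induction
  case (pres_refl u)
  then show ?case
    using pres_eq.pres_refl[of "u @ w" S R] by simp
next
  case (pres_cancel u v s b)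
  then show ?case
    using pres_eq.pres_cancel[of u S "v @ w" s R b] by simp
next
  case (pres_relator u v r)
  then show ?case
    using pres_eq.pres_relator[of u S "v @ w" r R] by simp
next
  case (pres_sym u v)
  then show ?case
    by (simp only: pres_eq.pres_sym)
next
  case (pres_trans u v x)
  show ?case
    by (rule pres_eq.pres_trans[OF pres_trans.IH(1)[OF assms(2)] pres_trans.IH(2)[OF assms(2)]])
qed

lemma pres_eq_append:
  assumes "pres_eq S R u u'" "pres_eq S R v v'"
  shows "pres_eq S R (u @ v) (u' @ v')"
proof (rule pres_trans)
  show "pres_eq S R (u @ v) (u' @ v)"
    using pres_eq_lists[OF assms(2)] by (simp add: pres_eq_append_right[OF assms(1)])
  show "pres_eq S R (u' @ v) (u' @ v')"
    using pres_eq_lists[OF assms(1)] by (simp add: pres_eq_append_left[OF assms(2)])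
qed

lemma equiv_pres_rel: "equiv (lists (S \<times> UNIV)) (pres_rel S R)"
proof (rule equivI)
  show "pres_rel S R \<subseteq> lists (S \<times> UNIV) \<times> lists (S \<times> UNIV)"
    by (rule subrelI) (use pres_eq_lists[of S R] in \<open>simp add: pres_rel_def\<close>)
  show "refl_on (lists (S \<times> UNIV)) (pres_rel S R)"
    by (rule refl_onI) (simp only: pres_rel_def mem_Collect_eq case_prod_conv pres_refl)
  show "sym (pres_rel S R)"
    by (rule symI) (simp only: pres_rel_def mem_Collect_eq case_prod_conv pres_sym)
  show "trans (pres_rel S R)"
    unfolding pres_rel_def by (rule transI, simp, rule pres_trans)
qed

lemma pres_class_eq:
  assumes "pres_eq S R u v"
  shows "pres_rel S R `` {u} = pres_rel S R `` {v}"
  by (rule equiv_class_eq[OF equiv_pres_rel]) (simp add: pres_rel_def assms)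

lemma presented_group_mult_class:
  assumes "u \<in> lists (S \<times> UNIV)" "v \<in> lists (S \<times> UNIV)"
  shows "pres_rel S R `` {u} \<otimes>\<^bsub>presented_group S R\<^esub> pres_rel S R `` {v} = pres_rel S R `` {u @ v}"
proof -
  have "pres_rel S R `` {u' @ v'} = pres_rel S R `` {u @ v}"
    if "u' \<in> pres_rel S R `` {u}" "v' \<in> pres_rel S R `` {v}" for u' v'
  proof -
    have "pres_eq S R u u'" "pres_eq S R v v'"
      using that by (simp_all add: pres_rel_def)
    then show ?thesis
      by (rule pres_class_eq[OF pres_eq_append, symmetric])
  qed
  moreover have "u \<in> pres_rel S R `` {u}" "v \<in> pres_rel S R `` {v}"
    using pres_refl[OF assms(1)] pres_refl[OF assms(2)] by (simp_all add: pres_rel_def)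
  ultimately have "(\<Union>u'\<in>pres_rel S R `` {u}. \<Union>v'\<in>pres_rel S R `` {v}. pres_rel S R `` {u' @ v'})
      = pres_rel S R `` {u @ v}"
    by blast
  then show ?thesis
    by (simp add: presented_group_def)
qed

lemma pres_inverse:
  assumes "u \<in> lists (S \<times> UNIV)"
  shows "pres_eq S R (rev (map (\<lambda>(s, b). (s, \<not> b)) u) @ u) []"
  using assms
proof (induction u)
  case Nil
  show ?case using pres_refl[of "[]" S R] by simp
next
  case (Cons a u)
  obtain s b where a: "a = (s, b)" by fastforce
  let ?v = "rev (map (\<lambda>(s, b). (s, \<not> b)) u)"
  have "?v \<in> lists (S \<times> UNIV)"
    using Cons by auto
  then have "pres_eq S R (?v @ [(s, \<not> b), (s, \<not> \<not> b)] @ u) (?v @ u)"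
    using Cons a by (intro pres_cancel) auto
  moreover have "pres_eq S R (?v @ u) []"
    using Cons by auto
  ultimately have "pres_eq S R (?v @ [(s, \<not> b), (s, \<not> \<not> b)] @ u) []"
    by (rule pres_trans)
  then show ?case
    by (simp add: a)
qed

lemma group_presented_group: "group (presented_group S R)"
proof (rule groupI)
  let ?G = "presented_group S R"
  have car: "x \<in> carrier ?G \<longleftrightarrow> (\<exists>u \<in> lists (S \<times> UNIV). x = pres_rel S R `` {u})" for x
    by (simp only: presented_group_def quotient_def partial_object.simps) blast
  have one: "\<one>\<^bsub>?G\<^esub> = pres_rel S R `` {[]}"
    by (simp add: presented_group_def)
  note mult = presented_group_mult_class[of _ S _ R]
  show "x \<otimes>\<^bsub>?G\<^esub> y \<in> carrier ?G" if xy: "x \<in> carrier ?G" "y \<in> carrier ?G" for x y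
  proof -
    obtain u v where "u \<in> lists (S \<times> UNIV)" "v \<in> lists (S \<times> UNIV)"
      "x = pres_rel S R `` {u}" "y = pres_rel S R `` {v}"
      using xy unfolding car by blast
    then show ?thesis
      unfolding car using mult[of u v] by (intro bexI[of _ "u @ v"]) simp_all
  qed
  show "\<one>\<^bsub>?G\<^esub> \<in> carrier ?G"
    unfolding car one using lists.Nil by blast
  show "(x \<otimes>\<^bsub>?G\<^esub> y) \<otimes>\<^bsub>?G\<^esub> z = x \<otimes>\<^bsub>?G\<^esub> (y \<otimes>\<^bsub>?G\<^esub> z)"
    if xyz: "x \<in> carrier ?G" "y \<in> carrier ?G" "z \<in> carrier ?G" for x y z
  proof -
    obtain u v w where "u \<in> lists (S \<times> UNIV)" "v \<in> lists (S \<times> UNIV)" "w \<in> lists (S \<times> UNIV)"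
      "x = pres_rel S R `` {u}" "y = pres_rel S R `` {v}" "z = pres_rel S R `` {w}"
      using xyz unfolding car by blast
    then show ?thesis
      using mult[of u v] mult[of v w] mult[of "u @ v" w] mult[of u "v @ w"] by simp
  qed
  show "\<one>\<^bsub>?G\<^esub> \<otimes>\<^bsub>?G\<^esub> x = x" if x: "x \<in> carrier ?G" for x
  proof -
    obtain u where "u \<in> lists (S \<times> UNIV)" "x = pres_rel S R `` {u}"
      using x unfolding car by blast
    then show ?thesis
      using mult[of "[]" u] one by simp
  qed
  show "\<exists>y\<in>carrier ?G. y \<otimes>\<^bsub>?G\<^esub> x = \<one>\<^bsub>?G\<^esub>" if x: "x \<in> carrier ?G" for x
  proof -
    obtain u where u: "u \<in> lists (S \<times> UNIV)" "x = pres_rel S R `` {u}"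
      using x unfolding car by blast
    let ?v = "rev (map (\<lambda>(s, b). (s, \<not> b)) u)"
    have v: "?v \<in> lists (S \<times> UNIV)"
      using u by auto
    have "pres_rel S R `` {?v @ u} = pres_rel S R `` {[]}"
      by (rule pres_class_eq[OF pres_inverse[OF u(1)]])
    then have "pres_rel S R `` {?v} \<otimes>\<^bsub>?G\<^esub> x = \<one>\<^bsub>?G\<^esub>"
      using mult[OF v u(1)] u(2) one by simp
    moreover have "pres_rel S R `` {?v} \<in> carrier ?G"
      unfolding car using v by blast
    ultimately show ?thesis
      by (rule bexI)
  qed
qed

definition coxeter_matrix :: "'a set \<Rightarrow> ('a \<Rightarrow> 'a \<Rightarrow> enat) \<Rightarrow> bool" where
  "coxeter_matrix S m \<longleftrightarrow> finite S \<and>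
    (\<forall>s\<in>S. \<forall>t\<in>S. 1 \<le> m s t \<and> m s t = m t s \<and> (m s t = 1 \<longleftrightarrow> s = t))"

text \<open>Pairs with \<open>m s t = \<infinity>\<close> contribute no relator.\<close>

definition coxeter_relators :: "'a set \<Rightarrow> ('a \<Rightarrow> 'a \<Rightarrow> enat) \<Rightarrow> ('a \<times> bool) list set" where
  "coxeter_relators S m =
    {concat (replicate k [(s, True), (t, True)]) | s t k. s \<in> S \<and> t \<in> S \<and> m s t = enat k}"

definition coxeter_group ::
  "'a set \<Rightarrow> ('a \<Rightarrow> 'a \<Rightarrow> enat) \<Rightarrow> ('a \<times> bool) list set monoid" where
  "coxeter_group S m = presented_group S (coxeter_relators S m)"

definition coxeter_gen ::
  "'a set \<Rightarrow> ('a \<Rightarrow> 'a \<Rightarrow> enat) \<Rightarrow> 'a \<Rightarrow> ('a \<times> bool) list set" where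
  "coxeter_gen S m s = pres_rel S (coxeter_relators S m) `` {[(s, True)]}"

text \<open>Expressions use only the generators, not their formal inverses; this loses nothing because the
  relator for \<open>m s s = 1\<close> is \<open>s\<^sup>2\<close>.\<close>

definition word_value ::
  "'a set \<Rightarrow> ('a \<Rightarrow> 'a \<Rightarrow> enat) \<Rightarrow> 'a list \<Rightarrow> ('a \<times> bool) list set" where
  "word_value S m u =
    foldr (\<lambda>s x. coxeter_gen S m s \<otimes>\<^bsub>coxeter_group S m\<^esub> x) u \<one>\<^bsub>coxeter_group S m\<^esub>"

definition expression ::
  "'a set \<Rightarrow> ('a \<Rightarrow> 'a \<Rightarrow> enat) \<Rightarrow> ('a \<times> bool) list set \<Rightarrow> 'a list \<Rightarrow> bool" where
  "expression S m w u \<longleftrightarrow> u \<in> lists S \<and> word_value S m u = w"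

definition reduced_expression ::
  "'a set \<Rightarrow> ('a \<Rightarrow> 'a \<Rightarrow> enat) \<Rightarrow> ('a \<times> bool) list set \<Rightarrow> 'a list \<Rightarrow> bool" where
  "reduced_expression S m w u \<longleftrightarrow>
    expression S m w u \<and> (\<forall>v. expression S m w v \<longrightarrow> length u \<le> length v)"

definition commutation_move ::
  "'a set \<Rightarrow> ('a \<Rightarrow> 'a \<Rightarrow> enat) \<Rightarrow> 'a list \<Rightarrow> 'a list \<Rightarrow> bool" where
  "commutation_move S m u v \<longleftrightarrow>
    (\<exists>x y s t. s \<in> S \<and> t \<in> S \<and> m s t = 2 \<and> u = x @ [s, t] @ y \<and> v = x @ [t, s] @ y)"

definition commutation_equivalent ::
  "'a set \<Rightarrow> ('a \<Rightarrow> 'a \<Rightarrow> enat) \<Rightarrow> 'a list \<Rightarrow> 'a list \<Rightarrow> bool" where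
  "commutation_equivalent S m = (commutation_move S m)\<^sup>*\<^sup>*"

definition fully_commutative ::
  "'a set \<Rightarrow> ('a \<Rightarrow> 'a \<Rightarrow> enat) \<Rightarrow> ('a \<times> bool) list set \<Rightarrow> bool" where
  "fully_commutative S m w \<longleftrightarrow>
    (\<forall>u v. reduced_expression S m w u \<longrightarrow> reduced_expression S m w v \<longrightarrow>
      commutation_equivalent S m u v)"

definition cyclically_fully_commutative ::
  "'a set \<Rightarrow> ('a \<Rightarrow> 'a \<Rightarrow> enat) \<Rightarrow> ('a \<times> bool) list set \<Rightarrow> bool" where
  "cyclically_fully_commutative S m w \<longleftrightarrow>
    (\<forall>u k. reduced_expression S m w u \<longrightarrow>
      (\<exists>w' \<in> carrier (coxeter_group S m).
        reduced_expression S m w' (rotate k u) \<and> fully_commutative S m w'))"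

definition FC_finite :: "'a set \<Rightarrow> ('a \<Rightarrow> 'a \<Rightarrow> enat) \<Rightarrow> bool" where
  "FC_finite S m \<longleftrightarrow> finite {w \<in> carrier (coxeter_group S m). fully_commutative S m w}"

definition CFC_finite :: "'a set \<Rightarrow> ('a \<Rightarrow> 'a \<Rightarrow> enat) \<Rightarrow> bool" where
  "CFC_finite S m \<longleftrightarrow>
    finite {w \<in> carrier (coxeter_group S m). cyclically_fully_commutative S m w}"

lemma group_coxeter_group: "group (coxeter_group S m)"
  unfolding coxeter_group_def by (rule group_presented_group)

text \<open>A labelled graph is a vertex set together with a set of pairs (edge, label), where an edge
  is a set of two vertices.  The label \<open>3\<close>, omitted in drawings, is recorded explicitly.\<close>

type_synonym 'a labelled_graph = "'a set \<times> ('a set \<times> enat) set"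

definition coxeter_graph :: "'a set \<Rightarrow> ('a \<Rightarrow> 'a \<Rightarrow> enat) \<Rightarrow> 'a labelled_graph" where
  "coxeter_graph S m = (S, {({s, t}, m s t) | s t. s \<in> S \<and> t \<in> S \<and> 3 \<le> m s t})"

text \<open>The empty graph does not count as connected, so the trivial group (rank 0) is not
  irreducible.\<close>

definition connected_graph :: "'a labelled_graph \<Rightarrow> bool" where
  "connected_graph G \<longleftrightarrow> fst G \<noteq> {} \<and>
    (\<forall>s\<in>fst G. \<forall>t\<in>fst G. (s, t) \<in> {(x, y). \<exists>l. ({x, y}, l) \<in> snd G}\<^sup>*)"

definition irreducible_coxeter :: "'a set \<Rightarrow> ('a \<Rightarrow> 'a \<Rightarrow> enat) \<Rightarrow> bool" where
  "irreducible_coxeter S m \<longleftrightarrow> connected_graph (coxeter_graph S m)"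

definition graph_isomorphic :: "'a labelled_graph \<Rightarrow> 'b labelled_graph \<Rightarrow> bool" where
  "graph_isomorphic G H \<longleftrightarrow>
    (\<exists>f. bij_betw f (fst G) (fst H) \<and> snd H = (\<lambda>(e, l). (f ` e, l)) ` snd G)"

text \<open>The edges of the path \<open>1, \<dots>, k\<close>, with label \<open>l i\<close> on \<open>{i, i + 1}\<close>.\<close>

definition path_edges :: "nat \<Rightarrow> (nat \<Rightarrow> enat) \<Rightarrow> (nat set \<times> enat) set" where
  "path_edges k l = {({i, i + 1}, l i) | i. 1 \<le> i \<and> i + 1 \<le> k}"

definition A_graph :: "nat \<Rightarrow> nat labelled_graph" where
  "A_graph n = ({1..n}, path_edges n (\<lambda>i. 3))"

definition B_graph :: "nat \<Rightarrow> nat labelled_graph" where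
  "B_graph n = ({1..n}, path_edges n (\<lambda>i. if i = 1 then 4 else 3))"

text \<open>In types \<open>D\<close> and \<open>E\<close> the vertex \<open>n\<close> is the extra vertex off the path.\<close>

definition D_graph :: "nat \<Rightarrow> nat labelled_graph" where
  "D_graph n = ({1..n}, insert ({2, n}, 3) (path_edges (n - 1) (\<lambda>i. 3)))"

definition E_graph :: "nat \<Rightarrow> nat labelled_graph" where
  "E_graph n = ({1..n}, insert ({3, n}, 3) (path_edges (n - 1) (\<lambda>i. 3)))"

definition F_graph :: "nat \<Rightarrow> nat labelled_graph" where
  "F_graph n = ({1..n}, path_edges n (\<lambda>i. if i = 2 then 4 else 3))"

definition H_graph :: "nat \<Rightarrow> nat labelled_graph" where
  "H_graph n = ({1..n}, path_edges n (\<lambda>i. if i = 1 then 5 else 3))"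

definition I2_graph :: "nat \<Rightarrow> nat labelled_graph" where
  "I2_graph k = ({1, 2}, {({1, 2}, enat k)})"

end

theory Submission
  imports Defs Complex_Main
begin

text \<open>A word none of whose commutation-equivalent words contains a square or a long braid is reduced,
  and its value is an FC element (Matsumoto); so everything is a question about such words.

  CFC-infinite graphs: if in the periodic word \<open>c c c \<dots>\<close> any two consecutive occurrences of a
  letter \<open>s\<close> have enough neighbours of \<open>s\<close> between them, then all powers of \<open>c\<close> are CFC.  These gap
  conditions do not change under commutation and cyclic shift, which is expressed by partial automata
  in which commuting letters act by commuting maps and \<open>c\<close> is a loop.  Such a \<open>c\<close> exists if the
  graph contains a cycle, an edge labelled \<open>\<infinity>\<close>, a path with a fork or a label at least 4 at both ends,
  a spider with legs 2, 2, 2 or 1, 3, 3, or a path with labels 3, 3, 4, 3, 3 or 3, 5, 3 or 3, 6 (or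
  larger middle labels).  The connected graphs with none of these are the listed ones.

  FC-finite graphs: each listed graph with at least 3 vertices has a centre \<open>c\<close> such that all gaps of \<open>c\<close> in an FC word meet a
  fixed arm of the graph, except for at most two gaps, which contain the first or the last occurrence
  of another neighbour \<open>b\<close> of \<open>c\<close>.  If all gaps of \<open>c\<close> meet the arm, the number of occurrences drops by
  at most one from each vertex of the arm to the next one, and the last vertex occurs at most once.\<close>

section \<open>Coxeter groups: inversions and the exchange condition\<close>

text \<open>The reducible case shapes the finiteness argument: bounds are proved letter by letter
  (\<open>bounded_letter\<close>), from the component containing the letter alone. CFC-finite thus
  implies that every component is listed, hence that every letter is bounded, hence FC-finite, which
  implies CFC-finite; the irreducible classification is read off the same circle. The forbidden
  graphs are not simply the affine ones, because \<open>E_n\<close>, \<open>F_n\<close> and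
  \<open>H_n\<close> stay on the list where the groups are infinite (\<open>E_9\<close>,
  \<open>F_5\<close>, \<open>H_5\<close>). Legs 2, 2, 2 and 1, 3, 3 are affine \<open>E_6\<close>
  and \<open>E_7\<close>, and 3, 6 is affine \<open>G_2\<close>; but affine \<open>E_8\<close>,
  which is \<open>E_9\<close>, is allowed, and an inner label 4 or 5 becomes bad only when enough
  vertices lie on both sides of it. The group is known only through its presentation, so telling
  elements apart takes invariants: the parity of inversions yields the exchange condition, and a
  linear representation shows that a product of two generators has its full order.\<close>

fun alt :: "'a \<Rightarrow> 'a \<Rightarrow> nat \<Rightarrow> 'a list" where
  "alt s t 0 = []"
| "alt s t (Suc n) = s # alt t s n"

lemma length_alt [simp]: "length (alt s t n) = n"
  by (induction n arbitrary: s t) auto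

lemma set_alt: "set (alt s t n) \<subseteq> {s, t}"
  by (induction n arbitrary: s t) auto

lemma set_alt_subset [simp]: "s \<in> S \<Longrightarrow> t \<in> S \<Longrightarrow> set (alt s t n) \<subseteq> S"
  using set_alt[of s t n] by auto

lemma alt_snoc: "alt s t (Suc n) = alt s t n @ [if even n then s else t]"
proof (induction n arbitrary: s t)
  case 0
  then show ?case by simp
next
  case (Suc n)
  have "alt s t (Suc (Suc n)) = s # alt t s (Suc n)"
    by simp
  also have "\<dots> = s # (alt t s n @ [if even n then t else s])"
    by (subst Suc.IH) (rule refl)
  finally show ?case by simp
qed

lemma alt_even: "concat (replicate k [s, t]) = alt s t (2 * k)"
  by (induction k) auto

lemma alt_add: "alt s t (2 * k + n) = alt s t (2 * k) @ alt s t n"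
  by (induction k) auto

lemma rev_alt: "rev (alt s t n) = (if even n then alt t s n else alt s t n)"
proof (induction n arbitrary: s t)
  case (Suc n)
  have "rev (alt s t (Suc n)) = rev (alt t s n) @ [s]" by simp
  also have "\<dots> = (if even n then alt s t n else alt t s n) @ [s]"
    using Suc.IH by simp
  also have "\<dots> = (if even (Suc n) then alt t s (Suc n) else alt s t (Suc n))"
    using alt_snoc[of s t n] alt_snoc[of t s n] by auto
  finally show ?case .
qed simp

lemma card_less_Suc_shift:
  "card {i. i < Suc n \<and> P i} = (if P 0 then 1 else 0) + card {i. i < n \<and> P (Suc i)}"
proof -
  have 2: "{i. i < Suc n \<and> P i} = (if P 0 then {0} else {}) \<union> Suc ` {i. i < n \<and> P (Suc i)}"
    by (auto simp: image_iff gr0_conv_Suc less_Suc_eq_0_disj)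
  show ?thesis
    unfolding 2 by (subst card_Un_disjoint) (auto simp: card_image)
qed

text \<open>The indices \<open>i\<close> and \<open>k + i\<close> form pairs inside the
  range.\<close>

lemma even_card_periodic:
  assumes "\<And>i. P (k + i) = P i"
  shows "even (card {i. i < 2 * k \<and> P (i :: nat)})"
proof -
  let ?A = "{i. i < k \<and> P i}"
  have "{i. i < 2 * k \<and> P i} = ?A \<union> (\<lambda>i. k + i) ` ?A"
  proof (intro equalityI subsetI)
    fix i assume i: "i \<in> {i. i < 2 * k \<and> P i}"
    show "i \<in> ?A \<union> (\<lambda>i. k + i) ` ?A"
    proof (cases "i < k")
      case False
      then obtain j where j: "i = k + j" by (metis le_add_diff_inverse not_less)
      then have "P j" "j < k" using i assms[of j] by simp_all
      then show ?thesis using j by blast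
    qed (use i in auto)
  qed (use assms in auto)
  moreover have "card (?A \<union> (\<lambda>i. k + i) ` ?A) = card ?A + card ?A"
    by (subst card_Un_disjoint) (auto simp: card_image)
  ultimately show ?thesis by simp
qed

text \<open>Meant for an alternating word that has lost one letter: either it still alternates or
  two equal letters have met.\<close>

lemma alternating_or_double:
  assumes "set q \<subseteq> {s, t}" "q \<noteq> []" "hd q = s" "s \<noteq> t"
  shows "q = alt s t (length q) \<or> (\<exists>x a y. q = x @ [a, a] @ y)"
  using assms
proof (induction q arbitrary: s t)
  case (Cons a q)
  show ?case
  proof (cases q)
    case (Cons b r)
    show ?thesis
    proof (cases "b = a")
      case True
      then have "a # q = [] @ [a, a] @ r" using Cons by simp
      then show ?thesis by blast
    next
      case False
      then have "b = t" using Cons Cons.prems by auto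
      then have "q = alt t s (length q) \<or> (\<exists>x a y. q = x @ [a, a] @ y)"
        using Cons Cons.prems by (intro Cons.IH) auto
      then show ?thesis
      proof
        assume "q = alt t s (length q)"
        then show ?thesis using Cons.prems by simp
      next
        assume "\<exists>x a y. q = x @ [a, a] @ y"
        then obtain x b' y where "q = x @ [b', b'] @ y" by blast
        then have "a # q = (a # x) @ [b', b'] @ y" by simp
        then show ?thesis by blast
      qed
    qed
  qed (use Cons.prems in auto)
qed simp

locale coxeter =
  fixes S :: "'a set" and m :: "'a \<Rightarrow> 'a \<Rightarrow> enat"
  assumes matrix: "coxeter_matrix S m"
begin

abbreviation "R \<equiv> coxeter_relators S m"
abbreviation "val \<equiv> word_value S m"

lemma finite_S: "finite S"
  using matrix by (simp add: coxeter_matrix_def)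

lemma m_ge_1: "s \<in> S \<Longrightarrow> t \<in> S \<Longrightarrow> 1 \<le> m s t"
  and m_sym: "s \<in> S \<Longrightarrow> t \<in> S \<Longrightarrow> m s t = m t s"
  and m_eq_1: "s \<in> S \<Longrightarrow> t \<in> S \<Longrightarrow> m s t = 1 \<longleftrightarrow> s = t"
  using matrix by (auto simp: coxeter_matrix_def)

lemma m_self: "s \<in> S \<Longrightarrow> m s s = 1"
  using m_eq_1 by blast

section \<open>Positive words and their values\<close>

definition pos :: "'a list \<Rightarrow> ('a \<times> bool) list" where
  "pos u = map (\<lambda>s. (s, True)) u"

lemma pos_append [simp]: "pos (u @ v) = pos u @ pos v"
  by (simp add: pos_def)

lemma pos_Nil [simp]: "pos [] = []"
  by (simp add: pos_def)

lemma map_fst_pos [simp]: "map fst (pos u) = u"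
  by (simp add: pos_def comp_def)

lemma pos_lists [simp]: "pos u \<in> lists (S \<times> UNIV) \<longleftrightarrow> set u \<subseteq> S"
  by (auto simp: pos_def lists_eq_set)

lemma val_class: "set u \<subseteq> S \<Longrightarrow> val u = pres_rel S R `` {pos u}"
proof (induction u)
  case Nil
  show ?case
    by (simp add: word_value_def coxeter_group_def presented_group_def)
next
  case (Cons s u)
  have "val (s # u) = coxeter_gen S m s \<otimes>\<^bsub>coxeter_group S m\<^esub> val u"
    by (simp add: word_value_def)
  also have "\<dots> = pres_rel S R `` {[(s, True)] @ pos u}"
    using Cons unfolding coxeter_gen_def coxeter_group_def
    by (simp add: presented_group_mult_class)
  finally show ?case by (simp add: pos_def)
qed

lemma val_eq_iff:
  assumes "set u \<subseteq> S" "set v \<subseteq> S"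
  shows "val u = val v \<longleftrightarrow> pres_eq S R (pos u) (pos v)"
  using assms
  by (simp add: val_class eq_equiv_class_iff[OF equiv_pres_rel]) (simp add: pres_rel_def)

lemma val_append_cong:
  assumes "val u = val u'" "val v = val v'" "set u \<subseteq> S" "set u' \<subseteq> S" "set v \<subseteq> S" "set v' \<subseteq> S"
  shows "val (u @ v) = val (u' @ v')"
  using assms by (auto simp: val_eq_iff intro: pres_eq_append)

lemma val_context:
  assumes "val u = val v" "set u \<subseteq> S" "set v \<subseteq> S" "set x \<subseteq> S" "set y \<subseteq> S"
  shows "val (x @ u @ y) = val (x @ v @ y)"
  using assms by (intro val_append_cong) auto

lemma val_relator:
  assumes "s \<in> S" "t \<in> S" "m s t = enat k"
  shows "val (alt s t (2 * k)) = val []"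
proof -
  let ?r = "concat (replicate k [(s, True), (t, True)])"
  have r: "?r = pos (alt s t (2 * k))"
    by (simp add: alt_even[symmetric] pos_def map_concat)
  have "?r \<in> R" using assms unfolding coxeter_relators_def by blast
  moreover have "?r \<in> lists (S \<times> UNIV)" unfolding r using assms by (simp only: pos_lists set_alt_subset)
  ultimately have "pres_eq S R ([] @ ?r @ []) ([] @ [])"
    by (intro pres_relator) auto
  then show ?thesis using assms r by (subst val_eq_iff) auto
qed

lemma val_double: "s \<in> S \<Longrightarrow> val [s, s] = val []"
  using val_relator[of s s 1] m_self[of s] by (simp add: one_enat_def numeral_2_eq_2)

lemma val_cancel_double:
  assumes "s \<in> S" "set x \<subseteq> S" "set y \<subseteq> S"
  shows "val (x @ [s, s] @ y) = val (x @ y)"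
  using val_context[OF val_double[OF assms(1)], of x y] assms by simp

lemma val_double_Cons [simp]: "s \<in> S \<Longrightarrow> set y \<subseteq> S \<Longrightarrow> val (s # s # y) = val y"
  using val_cancel_double[of s "[]" y] by simp

lemma val_cong_Cons:
  assumes "val u = val v" "set u \<subseteq> S" "set v \<subseteq> S" "s \<in> S"
  shows "val (s # u) = val (s # v)"
  using val_context[of u v "[s]" "[]"] assms by simp

lemma val_move_Cons:
  assumes "val (s # u) = val v" "set u \<subseteq> S" "set v \<subseteq> S" "s \<in> S"
  shows "val u = val (s # v)"
  using val_cong_Cons[OF assms(1), of s] assms(2-4) by simp

lemma val_cancel_rev:
  assumes "set u \<subseteq> S"
  shows "val (rev u @ u) = val []"
  using assms
proof (induction u)
  case (Cons s u)
  then have "val (rev u @ [s, s] @ u) = val (rev u @ u)"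
    by (intro val_cancel_double) auto
  with Cons show ?case by simp
qed simp

lemma val_cancel_right:
  assumes "val (x @ u) = val (y @ u)" "set u \<subseteq> S" "set x \<subseteq> S" "set y \<subseteq> S"
  shows "val x = val y"
proof -
  have c: "val (z @ u @ rev u) = val z" if "set z \<subseteq> S" for z
    using val_context[OF val_cancel_rev[of "rev u"], of z "[]"] that assms(2) by simp
  have "val (x @ u @ rev u) = val (y @ u @ rev u)"
    using val_append_cong[OF assms(1), of "rev u" "rev u"] assms by simp
  then show ?thesis using c assms by simp
qed

text \<open>Because \<open>s s\<close> is a relator, a formal inverse equals its generator, so signs
  can be erased. Hence every group element is the value of a positive word
  (\<open>carrier_val\<close>).\<close>

lemma pres_eq_positive:
  assumes "x \<in> lists (S \<times> UNIV)"
  shows "pres_eq S R x (pos (map fst x))"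
  using assms
proof (induction x)
  case Nil
  then show ?case by (simp add: pres_refl)
next
  case (Cons a x)
  obtain s b where a: "a = (s, b)" by fastforce
  have s: "s \<in> S" using Cons a by auto
  have "pres_eq S R [(s, False)] [(s, True)]"
  proof -
    have "pres_eq S R (pos [s, s]) (pos [])"
      using val_double[OF s] s by (subst (asm) val_eq_iff) auto
    then have "pres_eq S R ([(s, False)] @ pos [s, s]) [(s, False)]"
      using pres_eq_append_left[of S R "pos [s, s]" "pos []" "[(s, False)]"] s by simp
    moreover have "pres_eq S R ([] @ [(s, False), (s, \<not> False)] @ [(s, True)]) ([] @ [(s, True)])"
      using s by (intro pres_cancel) auto
    ultimately show ?thesis
      by (simp add: pos_def) (blast intro: pres_sym pres_trans)
  qed
  moreover have "pres_eq S R [(s, True)] [(s, True)]" using s by (intro pres_refl) auto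
  ultimately have "pres_eq S R [a] (pos [s])" using a by (cases b) (auto simp: pos_def)
  then have "pres_eq S R ([a] @ x) (pos [s] @ pos (map fst x))"
    using Cons by (intro pres_eq_append) auto
  then show ?case by (simp add: a pos_def)
qed

lemma carrier_val:
  assumes "w \<in> carrier (coxeter_group S m)"
  shows "\<exists>u. set u \<subseteq> S \<and> w = val u"
proof -
  obtain x where x: "x \<in> lists (S \<times> UNIV)" "w = pres_rel S R `` {x}"
    using assms unfolding coxeter_group_def presented_group_def quotient_def by auto
  have u: "set (map fst x) \<subseteq> S" using x by (auto simp: lists_eq_set)
  then have "w = val (map fst x)"
    using pres_class_eq[OF pres_eq_positive[OF x(1)]] x(2) by (simp add: val_class)
  with u show ?thesis by blast
qed

lemma val_carrier: "set u \<subseteq> S \<Longrightarrow> val u \<in> carrier (coxeter_group S m)"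
  unfolding coxeter_group_def presented_group_def
  by (simp only: val_class partial_object.simps, rule quotientI) simp

lemma set_map_fst: "x \<in> lists (S \<times> UNIV) \<Longrightarrow> set (map fst x) \<subseteq> S"
  by (auto simp: lists_eq_set)

text \<open>Erasing signs turns a free cancellation into a double letter, so two kinds of insertion
  have to be checked. Both invariants below, inversion parity and the linear action, enter through
  this principle.\<close>

lemma pres_eq_invariant:
  assumes "pres_eq S R u v"
    and "\<And>x y s. set x \<subseteq> S \<Longrightarrow> set y \<subseteq> S \<Longrightarrow> s \<in> S \<Longrightarrow> F (x @ [s, s] @ y) = F (x @ y)"
    and "\<And>x y s t k. set x \<subseteq> S \<Longrightarrow> set y \<subseteq> S \<Longrightarrow> s \<in> S \<Longrightarrow> t \<in> S \<Longrightarrow> m s t = enat k \<Longrightarrow>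
      F (x @ alt s t (2 * k) @ y) = F (x @ y)"
  shows "F (map fst u) = F (map fst v)"
  using assms(1)
proof induction
  case (pres_cancel u v s b)
  then show ?case using assms(2)[of "map fst u" "map fst v" s]
      set_map_fst[OF pres_cancel(1)] set_map_fst[OF pres_cancel(2)] by simp
next
  case (pres_relator u v r)
  then obtain s t k where r: "s \<in> S" "t \<in> S" "m s t = enat k" "r = concat (replicate k [(s, True), (t, True)])"
    unfolding coxeter_relators_def by blast
  then have "map fst r = alt s t (2 * k)" by (simp add: map_concat alt_even[symmetric])
  then show ?case using assms(3)[of "map fst u" "map fst v" s t k] r
      set_map_fst[OF pres_relator(1)] set_map_fst[OF pres_relator(2)] by simp
qed auto

lemma val_invariant:
  assumes "val u = val v" "set u \<subseteq> S" "set v \<subseteq> S"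
    and "\<And>x y s. set x \<subseteq> S \<Longrightarrow> set y \<subseteq> S \<Longrightarrow> s \<in> S \<Longrightarrow> F (x @ [s, s] @ y) = F (x @ y)"
    and "\<And>x y s t k. set x \<subseteq> S \<Longrightarrow> set y \<subseteq> S \<Longrightarrow> s \<in> S \<Longrightarrow> t \<in> S \<Longrightarrow> m s t = enat k \<Longrightarrow>
      F (x @ alt s t (2 * k) @ y) = F (x @ y)"
  shows "F u = F v"
  using pres_eq_invariant[of "pos u" "pos v" F] assms by (simp add: val_eq_iff)

text \<open>\<open>par u w\<close> is the parity of the number of prefixes \<open>x a\<close> of \<open>u\<close> with \<open>x a x\<^sup>-\<^sup>1 = w\<close>
  in the group; for a reflection \<open>w\<close> it tells whether \<open>w\<close> is an inversion of \<open>u\<close>.\<close>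

fun par :: "'a list \<Rightarrow> 'a list \<Rightarrow> bool" where
  "par [] w = False"
| "par (s # u) w = ((val [s] = val w) \<noteq> par u (s # w @ [s]))"

lemma par_append: "par (x @ y) w = (par x w \<noteq> par y (rev x @ w @ x))"
  by (induction x arbitrary: w) auto

lemma par_cong:
  assumes "val w = val w'" "set w \<subseteq> S" "set w' \<subseteq> S" "set u \<subseteq> S"
  shows "par u w = par u w'"
  using assms
proof (induction u arbitrary: w w')
  case (Cons s u)
  have "val ([s] @ w @ [s]) = val ([s] @ w' @ [s])"
    using Cons.prems by (intro val_context) auto
  then have "par u (s # w @ [s]) = par u (s # w' @ [s])"
    using Cons.prems by (intro Cons.IH) auto
  then show ?case using Cons.prems by simp
qed simp

lemma val_conj_eq_iff:
  assumes "s \<in> S" "set u \<subseteq> S" "set w \<subseteq> S"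
  shows "val u = val (s # w @ [s]) \<longleftrightarrow> val (s # u @ [s]) = val w"
proof -
  have a: "val ([s] @ (s # z @ [s]) @ [s]) = val z" if "set z \<subseteq> S" for z
    using val_cancel_double[of s "z" "[]"] that assms by simp
  have "val ([s] @ u @ [s]) = val ([s] @ (s # w @ [s]) @ [s])" if "val u = val (s # w @ [s])"
    by (intro val_context that) (use assms in auto)
  moreover have "val ([s] @ (s # u @ [s]) @ [s]) = val ([s] @ w @ [s])" if "val (s # u @ [s]) = val w"
    by (intro val_context that) (use assms in auto)
  ultimately show ?thesis using a[of w] a[of u] assms by auto
qed

text \<open>The reflections \<open>x a x^-1\<close> of an alternating word are the alternating words
  of odd length, so counting prefixes becomes counting indices.\<close>

lemma par_alt:
  assumes "s \<in> S" "t \<in> S" "set w \<subseteq> S"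
  shows "par (alt s t n) w = odd (card {i. i < n \<and> val (alt s t (2 * i + 1)) = val w})"
  using assms
proof (induction n arbitrary: s t w)
  case (Suc n)
  let ?P = "\<lambda>i. val (alt s t (2 * i + 1)) = val w"
  have shift: "val (alt t s (2 * i + 1)) = val (s # w @ [s]) \<longleftrightarrow> ?P (Suc i)" for i
  proof -
    have "s # alt t s (2 * i + 1) @ [s] = alt s t (2 * Suc i + 1)"
      using alt_snoc[of t s "2 * i + 1"] by simp
    then show ?thesis
      using val_conj_eq_iff[of s "alt t s (2 * i + 1)" w] Suc.prems set_alt[of t s "2*i+1"]
      by auto
  qed
  have "par (alt t s n) (s # w @ [s])
      = odd (card {i. i < n \<and> val (alt t s (2 * i + 1)) = val (s # w @ [s])})"
    using Suc.prems by (intro Suc.IH) auto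
  also have "{i. i < n \<and> val (alt t s (2 * i + 1)) = val (s # w @ [s])} = {i. i < n \<and> ?P (Suc i)}"
    by (simp only: shift)
  finally have 1: "par (alt t s n) (s # w @ [s]) = odd (card {i. i < n \<and> ?P (Suc i)})" .
  show ?case using 1 card_less_Suc_shift[of n ?P] by simp
qed simp

text \<open>Since \<open>(s t)^k\<close> is trivial, the reflections at the indices \<open>i\<close>
  and \<open>k + i\<close> agree, and each is met an even number of times.\<close>

lemma par_relator:
  assumes "s \<in> S" "t \<in> S" "set w \<subseteq> S" "m s t = enat k"
  shows "\<not> par (alt s t (2 * k)) w"
proof -
  let ?P = "\<lambda>i. val (alt s t (2 * i + 1)) = val w"
  have per: "?P (k + i) = ?P i" for i
  proof -
    have "val ([] @ alt s t (2 * k) @ alt s t (2 * i + 1)) = val ([] @ [] @ alt s t (2 * i + 1))"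
      using assms by (intro val_context val_relator) simp_all
    then show ?thesis
      using alt_add[of s t k "2 * i + 1"] by (simp add: add_mult_distrib2 add.assoc)
  qed
  show ?thesis
    using par_alt[OF assms(1-3), of "2 * k"] even_card_periodic[of ?P k, OF per] by simp
qed

text \<open>Behind \<open>r\<close> the test word is conjugated by the value of \<open>r\<close>,
  which is trivial, so \<open>y\<close> is tested against the same reflection as before.\<close>

lemma par_delete:
  assumes "\<And>w. set w \<subseteq> S \<Longrightarrow> \<not> par r w" "val r = val []" "set r \<subseteq> S"
    "set x \<subseteq> S" "set y \<subseteq> S" "set w \<subseteq> S"
  shows "par (x @ r @ y) w = par (x @ y) w"
proof -
  let ?w = "rev x @ w @ x"
  have rr: "val (rev r) = val []"
    using val_cancel_rev[of r] val_append_cong[of "rev r" "rev r" r "[]"] assms by simp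
  have "val ([] @ rev r @ ?w @ r) = val ([] @ [] @ ?w @ r)"
    by (intro val_context rr) (use assms in auto)
  also have "\<dots> = val (?w @ [])"
    by (simp only: append_Nil, intro val_append_cong) (use assms in auto)
  finally have "par y (rev r @ ?w @ r) = par y ?w"
    by (intro par_cong) (use assms in auto)
  then show ?thesis using assms by (simp add: par_append)
qed

lemma par_val:
  assumes "val u = val v" "set u \<subseteq> S" "set v \<subseteq> S" "set w \<subseteq> S"
  shows "par u w = par v w"
proof (rule val_invariant[OF assms(1-3), where F = "\<lambda>u. par u w"])
  fix x y s
  assume h: "set x \<subseteq> S" "set y \<subseteq> S" "s \<in> S"
  have "m s s = enat 1" using m_self[OF h(3)] by (simp add: one_enat_def)
  note rel = par_relator[OF h(3,3) _ this, unfolded mult_1_right numeral_2_eq_2 alt.simps]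
  show "par (x @ [s, s] @ y) w = par (x @ y) w"
    by (rule par_delete[OF rel val_double[OF h(3)]]) (use h assms(4) in simp_all)
next
  fix x y s t k
  assume h: "set x \<subseteq> S" "set y \<subseteq> S" "s \<in> S" "t \<in> S" "m s t = enat k"
  show "par (x @ alt s t (2 * k) @ y) w = par (x @ y) w"
    by (rule par_delete[OF par_relator[OF h(3,4) _ h(5)] val_relator[OF h(3-5)]])
      (use h assms(4) in simp_all)
qed

text \<open>An odd count provides a prefix \<open>x a\<close> with \<open>w = x a x^-1\<close>, and
  multiplication by this \<open>w\<close> removes that \<open>a\<close>.\<close>

lemma par_exchange:
  assumes "par u w" "set u \<subseteq> S" "set w \<subseteq> S"
  shows "\<exists>x a y. u = x @ [a] @ y \<and> val (w @ u) = val (x @ y)"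
  using assms
proof (induction u arbitrary: w)
  case (Cons s u)
  show ?case
  proof (cases "val [s] = val w")
    case True
    then have "val (w @ s # u) = val ([s] @ s # u)"
      using Cons.prems by (intro val_append_cong) auto
    then have "val (w @ s # u) = val ([] @ u)" using Cons.prems by simp
    then show ?thesis by (intro exI[of _ "[]"] exI[of _ s] exI[of _ u]) simp
  next
    case False
    then have "par u (s # w @ [s])" using Cons.prems by simp
    then obtain x a y where 1: "u = x @ [a] @ y" and 2: "val ((s # w @ [s]) @ u) = val (x @ y)"
      using Cons.IH[of "s # w @ [s]"] Cons.prems by auto
    have "val (w @ s # u) = val (s # x @ y)"
      using val_move_Cons[of s "w @ s # u" "x @ y"] 1 2 Cons.prems by simp
    then show ?thesis using 1 by (intro exI[of _ "s # x"] exI[of _ a] exI[of _ y]) simp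
  qed
qed simp

section \<open>Reduced words and exchange\<close>

definition red :: "'a list \<Rightarrow> bool" where
  "red u \<longleftrightarrow> set u \<subseteq> S \<and> (\<forall>v. set v \<subseteq> S \<longrightarrow> val v = val u \<longrightarrow> length u \<le> length v)"

lemma red_set: "red u \<Longrightarrow> set u \<subseteq> S"
  by (simp add: red_def)

lemma red_le: "red u \<Longrightarrow> set v \<subseteq> S \<Longrightarrow> val v = val u \<Longrightarrow> length u \<le> length v"
  by (simp add: red_def)

lemma reduced_expression_iff: "reduced_expression S m w u \<longleftrightarrow> red u \<and> w = val u"
  unfolding reduced_expression_def expression_def red_def lists_eq_set by blast

lemma red_cong: "red u \<Longrightarrow> val v = val u \<Longrightarrow> set v \<subseteq> S \<Longrightarrow> length v \<le> length u \<Longrightarrow> red v"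
  unfolding red_def using order_trans by auto

lemma red_exists:
  assumes "set u \<subseteq> S"
  shows "\<exists>v. red v \<and> val v = val u \<and> length v \<le> length u"
proof -
  define P where "P v \<longleftrightarrow> set v \<subseteq> S \<and> val v = val u" for v
  have "P u" using assms by (simp add: P_def)
  then obtain v where "P v" "\<And>v'. P v' \<Longrightarrow> length v \<le> length v'"
    using ex_has_least_nat[of P u length] by blast
  then show ?thesis using \<open>P u\<close> unfolding P_def red_def by (intro exI[of _ v]) simp
qed

lemma red_suffix: "red (x @ y) \<Longrightarrow> red y"
proof -
  assume r: "red (x @ y)"
  have "length y \<le> length v" if "set v \<subseteq> S" "val v = val y" for v
  proof -
    have "val (x @ v) = val (x @ y)"
      using that r by (intro val_append_cong) (auto simp: red_def)
    then have "length (x @ y) \<le> length (x @ v)"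
      using that r by (intro red_le) (auto simp: red_def)
    then show ?thesis by simp
  qed
  then show ?thesis using r by (auto simp: red_def)
qed

lemma not_red_double: "\<not> red (x @ [a, a] @ y)"
proof
  assume r: "red (x @ [a, a] @ y)"
  have "val (x @ y) = val (x @ [a, a] @ y)"
    using red_set[OF r] by (subst val_cancel_double) simp_all
  moreover have "set (x @ y) \<subseteq> S" using red_set[OF r] by simp
  ultimately have "length (x @ [a, a] @ y) \<le> length (x @ y)" using r red_le by blast
  then show False by simp
qed

text \<open>Let \<open>v\<close> be a reduced word for \<open>s u\<close>; it is at most as long as
  \<open>u\<close>. If \<open>s\<close> were an inversion of \<open>v\<close>, deleting a letter of
  \<open>v\<close> would give a word for \<open>s v = u\<close> shorter than \<open>u\<close>. So
  \<open>s\<close> is not an inversion of \<open>v\<close>, hence it is one of \<open>s v\<close>,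
  and by invariance of the parity one of \<open>u\<close>.\<close>

lemma exchange:
  assumes "red u" "s \<in> S" "\<not> red (s # u)"
  shows "\<exists>x a y. u = x @ [a] @ y \<and> val u = val (s # x @ y)"
proof -
  have uS: "set u \<subseteq> S" using assms red_set by auto
  obtain v where v: "red v" "val v = val (s # u)" "length v \<le> length (s # u)"
    using red_exists[of "s # u"] uS assms(2) by auto
  have vS: "set v \<subseteq> S" using v red_set by auto
  have len: "length v \<le> length u"
  proof (rule ccontr)
    assume "\<not> length v \<le> length u"
    then have "red (s # u)" using v uS assms(2) by (intro red_cong[OF v(1)]) auto
    then show False using assms by simp
  qed
  have vu: "val (s # v) = val u"
    using val_cong_Cons[OF v(2)] vS uS assms(2) by simp
  have "\<not> par v [s]"
  proof
    assume "par v [s]"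
    then obtain x a y where "v = x @ [a] @ y" "val ([s] @ v) = val (x @ y)"
      using par_exchange[of v "[s]"] vS assms(2) by auto
    then have "length u \<le> length (x @ y)"
      using assms(1) vu vS \<open>v = x @ [a] @ y\<close> by (intro red_le) auto
    then show False using \<open>v = x @ [a] @ y\<close> len by simp
  qed
  \<comment> \<open>Conjugating \<open>s\<close> by itself gives \<open>s\<close>, so the new first
    letter of \<open>s # v\<close> flips the parity.\<close>
  moreover have "val [s] = val ([s] @ [s, s])"
    using val_cancel_double[of s "[s]" "[]"] assms(2) by simp
  then have "par v (s # [s] @ [s]) = par v [s]"
    using vS assms(2) by (intro par_cong) auto
  ultimately have "par (s # v) [s]" by simp
  then have "par u [s]" using par_val[OF vu, of "[s]"] vS uS assms(2) by simp
  then obtain x a y where u: "u = x @ [a] @ y" "val ([s] @ u) = val (x @ y)"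
    using par_exchange[of u "[s]"] uS assms(2) by auto
  then have "val u = val (s # x @ y)"
    using val_move_Cons[of s u "x @ y"] uS assms(2) by auto
  with u show ?thesis by blast
qed

end

section \<open>Orders of products of two generators\<close>

text \<open>The Chebyshev polynomial of the second kind \<open>U_(n-1)\<close> at
  \<open>c / 2\<close>: for \<open>c = 2 cos \<theta>\<close> the value is
  \<open>sin (n \<theta>) / sin \<theta>\<close>.\<close>

fun cheb :: "real \<Rightarrow> nat \<Rightarrow> real" where
  "cheb c 0 = 0"
| "cheb c (Suc 0) = 1"
| "cheb c (Suc (Suc n)) = c * cheb c (Suc n) - cheb c n"

lemma cheb_cos: "sin \<theta> * cheb (2 * cos \<theta>) n = sin (real n * \<theta>)"
proof (induction "2 * cos \<theta>" n rule: cheb.induct)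
  case (3 n)
  have "sin \<theta> * cheb (2 * cos \<theta>) (Suc (Suc n)) = 2 * cos \<theta> * sin (real (Suc n) * \<theta>) - sin (real n * \<theta>)"
    using 3 by (simp add: algebra_simps)
  also have "\<dots> = sin (real (Suc (Suc n)) * \<theta>)"
  proof -
    have "real (Suc (Suc n)) * \<theta> = real (Suc n) * \<theta> + \<theta>" "real n * \<theta> = real (Suc n) * \<theta> - \<theta>"
      by (simp_all add: algebra_simps)
    then show ?thesis by (simp only: sin_add sin_diff) (simp add: algebra_simps)
  qed
  finally show ?case .
qed simp_all

text \<open>The limit of angle 0, which serves the label \<infinity>.\<close>

lemma cheb_2: "cheb 2 n = real n"
  by (induction "2 :: real" n rule: cheb.induct) simp_all

context coxeter
begin

text \<open>The contragredient of the geometric representation: \<open>f\<close> gives the coordinates of a linear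
  form on the simple roots.\<close>

definition coef :: "'a \<Rightarrow> 'a \<Rightarrow> real" where
  "coef s r = (case m s r of enat k \<Rightarrow> 2 * cos (pi / real k) | \<infinity> \<Rightarrow> 2)"

definition act :: "'a \<Rightarrow> ('a \<Rightarrow> real) \<Rightarrow> 'a \<Rightarrow> real" where
  "act s f = (\<lambda>r. f r + coef s r * f s)"

text \<open>\<open>coef\<close> is \<open>-2 B\<close> for the canonical form
  \<open>B(s, r) = - cos (pi / m s r)\<close>. The diagonal label 1 gives
  \<open>B(s, s) = 1\<close>, which makes \<open>act s\<close> an involution.\<close>

lemma coef_self: "s \<in> S \<Longrightarrow> coef s s = -2"
  by (simp add: coef_def m_self one_enat_def)

lemma coef_sym: "s \<in> S \<Longrightarrow> t \<in> S \<Longrightarrow> coef s t = coef t s"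
  by (simp add: coef_def m_sym)

lemma act_act: "s \<in> S \<Longrightarrow> act s (act s f) = f"
  by (simp add: act_def coef_self)

text \<open>Applying two reflections in turn obeys the Chebyshev recurrence on the coordinates at
  \<open>s\<close> and \<open>t\<close>; \<open>a\<close> is the letter due next and
  \<open>b\<close> the one just used. All coordinates move by multiples of the rows
  \<open>coef s\<close> and \<open>coef t\<close> only.\<close>

lemma fold_act_alt:
  fixes f :: "'a \<Rightarrow> real"
  assumes "s \<in> S" "t \<in> S"
  shows "let g = fold act (alt s t n) f; U = cheb (coef s t);
      a = (if even n then s else t); b = (if even n then t else s)
    in (\<exists>x y. g = (\<lambda>r. f r + x * coef s r + y * coef t r)) \<and>
      g a = f s * U (Suc n) + f t * U n \<and> (n > 0 \<longrightarrow> g b = - (f s * U n + f t * U (n - 1)))"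
proof (induction n)
  case 0
  show ?case by (auto simp: Let_def intro!: exI[of _ 0])
next
  case (Suc n)
  define g where "g = fold act (alt s t n) f"
  define a where "a = (if even n then s else t)"
  define b where "b = (if even n then t else s)"
  define U where "U = cheb (coef s t)"
  have ab: "a \<in> S" "b \<in> S" "coef a b = coef s t" "{a, b} = {s, t}"
    using assms coef_sym by (auto simp: a_def b_def)
  have IH: "\<exists>x y. g = (\<lambda>r. f r + x * coef s r + y * coef t r)"
    "g a = f s * U (Suc n) + f t * U n" "n > 0 \<longrightarrow> g b = - (f s * U n + f t * U (n - 1))"
    using Suc.IH by (simp_all add: Let_def g_def a_def b_def U_def)
  have g': "fold act (alt s t (Suc n)) f = act a g"
    unfolding alt_snoc g_def a_def by simp
  obtain x y where xy: "g = (\<lambda>r. f r + x * coef s r + y * coef t r)" using IH(1) by blast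
  have 1: "\<exists>x y. act a g = (\<lambda>r. f r + x * coef s r + y * coef t r)"
  proof (cases "a = s")
    case True
    then have "act a g = (\<lambda>r. f r + (x + g a) * coef s r + y * coef t r)"
      by (rule_tac ext) (simp add: act_def, simp add: xy algebra_simps)
    then show ?thesis by blast
  next
    case False
    then have "a = t" by (auto simp: a_def split: if_splits)
    then have "act a g = (\<lambda>r. f r + x * coef s r + (y + g a) * coef t r)"
      by (rule_tac ext) (simp add: act_def, simp add: xy algebra_simps)
    then show ?thesis by blast
  qed
  have 2: "act a g a = - (f s * U (Suc n) + f t * U n)"
    using IH(2) ab by (simp add: act_def coef_self)
  have 3: "act a g b = f s * U (Suc (Suc n)) + f t * U (Suc n)"
  proof (cases n)
    case 0
    then show ?thesis using ab IH(2) by (simp add: act_def U_def g_def a_def b_def)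
  next
    case (Suc k)
    have "act a g b = g b + coef s t * g a" using ab by (simp add: act_def)
    also have "\<dots> = - (f s * U (Suc k) + f t * U k) + coef s t * (f s * U (Suc (Suc k)) + f t * U (Suc k))"
      using IH(2,3) Suc by simp
    also have "\<dots> = f s * U (Suc (Suc n)) + f t * U (Suc n)"
      unfolding Suc by (simp add: U_def algebra_simps)
    finally show ?thesis .
  qed
  show ?case using 1 2 3 unfolding g' Let_def U_def[symmetric]
    by (cases "even n") (simp_all add: a_def b_def)
qed

lemma coef_distinct:
  assumes "s \<in> S" "t \<in> S" "s \<noteq> t" "m s t = enat k"
  shows "k \<ge> 2" "0 \<le> coef s t" "coef s t < 2" "coef s t = 2 * cos (pi / real k)" "sin (pi / real k) > 0"
proof -
  have "m s t \<ge> 1" "m s t \<noteq> 1" using m_ge_1[OF assms(1,2)] m_eq_1[OF assms(1,2)] assms(3) by simp_all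
  then show k: "k \<ge> 2" using assms(4) by (auto simp: one_enat_def)
  show c: "coef s t = 2 * cos (pi / real k)" by (simp add: coef_def assms(4))
  have th: "0 < pi / real k" "pi / real k \<le> pi / 2"
    using k divide_left_mono[of 2 "real k" pi] by simp_all
  then have "cos 0 > cos (pi / real k)" using pi_gt_zero by (intro cos_monotone_0_pi) linarith+
  then show "coef s t < 2" using c by simp
  show "0 \<le> coef s t" using c th by (auto intro!: cos_ge_zero)
  show "sin (pi / real k) > 0" using th pi_gt_zero by (intro sin_gt_zero) linarith+
qed

text \<open>At the angle \<open>pi / k\<close> the Chebyshev values at \<open>2k - 1\<close>,
  \<open>2k\<close>, \<open>2k + 1\<close> are -1, 0, 1, so the coordinates at \<open>s\<close> and
  \<open>t\<close> return to their start.\<close>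

lemma fold_act_relator:
  assumes "s \<in> S" "t \<in> S" "m s t = enat k"
  shows "fold act (alt s t (2 * k)) f = f"
proof (cases "s = t")
  case True
  then have "k = 1" using assms m_self[of s] by (simp add: one_enat_def)
  then show ?thesis using True assms by (simp add: numeral_2_eq_2 act_act)
next
  case False
  note c = coef_distinct[OF assms(1,2) False assms(3)]
  let ?th = "pi / real k" and ?U = "cheb (coef s t)" and ?g = "fold act (alt s t (2 * k)) f"
  have sinU: "sin ?th * ?U n = sin (real n * ?th)" for n
    using cheb_cos[of ?th n] c(4) by simp
  have k: "real k > 0" using c(1) by simp
  have U0: "?U (2 * k) = 0"
  proof -
    have "real (2 * k) * ?th = 2 * pi" using k by simp
    then show ?thesis using sinU[of "2 * k"] c(5) by simp
  qed
  have U1: "?U (Suc (2 * k)) = 1"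
  proof -
    have "real (Suc (2 * k)) * ?th = ?th + 2 * pi" using k by (simp add: field_simps)
    then have "sin ?th * ?U (Suc (2 * k)) = sin ?th" using sinU[of "Suc (2 * k)"] by simp
    then show ?thesis using c(5) by simp
  qed
  have Um: "?U (2 * k - 1) = -1"
  proof -
    have "real (2 * k - 1) = 2 * real k - 1" using c(1) by simp
    then have "real (2 * k - 1) * ?th = 2 * pi - ?th" using k by (simp add: field_simps)
    then have "sin ?th * ?U (2 * k - 1) = - sin ?th"
      using sinU[of "2 * k - 1"] sin_2pi_minus[of ?th] by simp
    then have "sin ?th * (?U (2 * k - 1) + 1) = 0" by (simp add: algebra_simps)
    then show ?thesis using c(5) by simp
  qed
  obtain x y where xy: "?g = (\<lambda>r. f r + x * coef s r + y * coef t r)"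
    and gs: "?g s = f s" and gt: "?g t = f t"
    using fold_act_alt[OF assms(1,2), of "2 * k" f] c(1) by (auto simp: Let_def U0 U1 Um[unfolded One_nat_def])
  \<comment> \<open>The total displacement vanishes at \<open>s\<close> and \<open>t\<close>. This
    is a 2 by 2 system with determinant \<open>4 - coef s t ^ 2\<close>, positive for a finite
    label, so \<open>x = y = 0\<close> and no coordinate has moved.\<close>
  have e1: "-2 * x + y * coef s t = 0" "x * coef s t - 2 * y = 0"
    using gs gt unfolding xy by (simp_all add: coef_self assms coef_sym[of t s])
  have y: "y = x * coef s t / 2" using e1(2) by simp
  have "x * (coef s t ^ 2 - 4) = 2 * (-2 * x + y * coef s t)"
    unfolding y by (simp add: power2_eq_square algebra_simps)
  then have "x * (coef s t ^ 2 - 4) = 0" using e1(1) by simp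
  moreover have "coef s t ^ 2 < 2 ^ 2" using c by (intro power_strict_mono) auto
  ultimately have "x = 0" by simp
  then show ?thesis using xy y by simp
qed

lemma fold_act_val:
  assumes "val u = val v" "set u \<subseteq> S" "set v \<subseteq> S"
  shows "fold act u f = fold act v f"
proof (rule val_invariant[OF assms, where F = "\<lambda>u. fold act u f"])
  show "fold act (x @ [s, s] @ y) f = fold act (x @ y) f" if "s \<in> S" for x y s
    using that by (simp add: act_act)
  show "fold act (x @ alt s t (2 * k) @ y) f = fold act (x @ y) f"
    if "s \<in> S" "t \<in> S" "m s t = enat k" for x y s t k
    using fold_act_relator[OF that] by simp
qed

lemma cheb_coef_nonzero:
  assumes "s \<in> S" "t \<in> S" "s \<noteq> t" "0 < n" "enat n < m s t"
  shows "cheb (coef s t) n \<noteq> 0"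
proof (cases "m s t")
  case (enat k)
  note c = coef_distinct[OF assms(1-3) enat]
  have n: "n < k" using assms enat by simp
  have "0 < real n * (pi / real k)" using assms n by simp
  moreover have "real n * (pi / real k) < pi" using n by (simp add: field_simps)
  ultimately have "sin (real n * (pi / real k)) > 0" by (intro sin_gt_zero)
  then show ?thesis using cheb_cos[of "pi / real k" n] c(4) by auto
next
  case infinity
  then show ?thesis using assms by (simp add: coef_def cheb_2)
qed

text \<open>The form with coordinates 0 at \<open>s\<close> and 1 at \<open>t\<close> separates the
  two words: at one and the same coordinate they give a Chebyshev value and its negative, nonzero
  below \<open>m s t\<close>.\<close>

lemma val_alt_neq:
  assumes "s \<in> S" "t \<in> S" "s \<noteq> t" "0 < n" "enat n < m s t"
  shows "val (alt s t n) \<noteq> val (alt t s n)"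
proof
  assume eq: "val (alt s t n) = val (alt t s n)"
  define f :: "'a \<Rightarrow> real" where "f = (\<lambda>r. if r = t then 1 else 0)"
  have f: "f s = 0" "f t = 1" using assms by (auto simp: f_def)
  let ?g = "fold act (alt s t n) f"
  have gg: "?g = fold act (alt t s n) f" using assms by (intro fold_act_val eq) simp_all
  let ?a = "if even n then s else t"
  have "?g ?a = cheb (coef s t) n"
    using fold_act_alt[OF assms(1,2), of n f] f by (simp add: Let_def)
  moreover have "?g ?a = - cheb (coef s t) n"
    using fold_act_alt[OF assms(2,1), of n f] f assms coef_sym[of t s] unfolding gg
    by (auto simp: Let_def)
  ultimately show False using cheb_coef_nonzero[OF assms] by simp
qed

text \<open>Exchange writes the element as \<open>t\<close> followed by the word with one letter
  deleted. A deletion in \<open>z\<close> is the desired result. A deletion in the alternating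
  prefix leaves either \<open>alt t s n\<close>, contradicting \<open>val_alt_neq\<close>, or a
  double letter, contradicting reducedness.\<close>

lemma alt_delete_exchange:
  assumes st: "s \<in> S" "t \<in> S" "s \<noteq> t"
    and r: "red (alt s t n @ z)" "\<not> red (t # alt s t n @ z)" and n: "0 < n" "enat n < m s t"
  shows "\<exists>z'. val (alt s t n @ z) = val (alt t s (Suc n) @ z') \<and> Suc (length z') = length z \<and> set z' \<subseteq> S"
proof -
  obtain x a y where u: "alt s t n @ z = x @ [a] @ y"
    and v: "val (alt s t n @ z) = val (t # x @ y)"
    using exchange[OF r(1) st(2) r(2)] by blast
  have "set (x @ [a] @ y) \<subseteq> S" using red_set[OF r(1)] unfolding u .
  then have xyS: "set (x @ y) \<subseteq> S" by simp
  from u consider w where "alt s t n @ w = x" "z = w @ [a] @ y"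
    | w where "alt s t n = x @ [a] @ w" "w @ z = y"
    by (auto simp: append_eq_append_conv2 append_eq_Cons_conv)
  then show ?thesis
  proof cases
    case 1
    then show ?thesis using v xyS by (intro exI[of _ "w @ y"]) auto
  next
    case 2
    let ?q = "t # x @ w"
    have sub: "set (x @ [a] @ w) \<subseteq> {s, t}" using set_alt[of s t n] 2(1) by simp
    then have q: "set ?q \<subseteq> {t, s}" by auto
    have lenq: "length ?q = n" using arg_cong[OF 2(1), of length] by simp
    have zS: "set z \<subseteq> S" using red_set[OF r(1)] by simp
    have qS: "set ?q \<subseteq> S" using q st by auto
    have eq: "val (alt s t n @ z) = val (?q @ z)" using v 2(2) by simp
    from alternating_or_double[OF q] st(3) consider
      "?q = alt t s n" | x' b y' where "?q = x' @ [b, b] @ y'" using lenq by fastforce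
    then show ?thesis
    proof cases
      case 1
      have "val (alt s t n @ z) = val (alt t s n @ z)" using eq unfolding 1 .
      then have "val (alt s t n) = val (alt t s n)"
        by (rule val_cancel_right) (simp_all add: zS st)
      then show ?thesis using val_alt_neq st n by blast
    next
      case (2 x' b y')
      have "red (?q @ z)"
        by (rule red_cong[OF r(1) eq[symmetric]]) (use qS zS lenq in simp_all)
      then have "red (x' @ [b, b] @ (y' @ z))" unfolding 2 by simp
      then show ?thesis using not_red_double by blast
    qed
  qed
qed

text \<open>Alternating prefixes grow one letter at a time: a prefix \<open>alt s t n\<close> and
  the other descent \<open>t\<close> give a prefix \<open>alt t s (Suc n)\<close>. For an infinite
  label this holds for every \<open>n\<close>, which contradicts the length of \<open>u\<close>
  sooner or later.\<close>

lemma two_descents: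
  assumes u: "red u" and s: "red (s # u')" "val u = val (s # u')" and t: "red (t # v')" "val u = val (t # v')"
    and st: "s \<noteq> t" and n: "0 < n" "enat n \<le> m s t"
  shows "(\<exists>z. val u = val (alt s t n @ z) \<and> n + length z = length u \<and> set z \<subseteq> S) \<and>
         (\<exists>z. val u = val (alt t s n @ z) \<and> n + length z = length u \<and> set z \<subseteq> S)"
  using n
proof (induction n)
  case (Suc n)
  have len: "length (s # u') = length u" "length (t # v') = length u"
    using red_le[OF s(1)] red_le[OF t(1)] red_le[OF u] s t red_set u by (metis le_antisym)+
  have S: "s \<in> S" "t \<in> S" "set u' \<subseteq> S" "set v' \<subseteq> S" "set u \<subseteq> S"
    using red_set[OF s(1)] red_set[OF t(1)] red_set[OF u] by auto
  show ?case
  proof (cases "n = 0")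
    case True
    then show ?thesis
      using s(2) t(2) len S by (intro conjI exI[of _ u'] exI[of _ v']) simp_all
  next
    case False
    then have n: "0 < n" "enat n < m s t" "enat n < m t s" "enat n \<le> m s t"
      using Suc.prems m_sym[OF S(1,2)] by (simp_all add: Suc_ile_eq order_less_imp_le)
    have step: "\<exists>z. val u = val (alt b a (Suc n) @ z) \<and> Suc n + length z = length u \<and> set z \<subseteq> S"
      if ab: "a \<in> S" "b \<in> S" "a \<noteq> b" "enat n < m a b" and z: "val u = val (alt a b n @ z)" "n + length z = length u" "set z \<subseteq> S"
        and d: "val u = val (b # w)" "length (b # w) = length u" "set w \<subseteq> S" for a b z w
    proof -
      have r: "red (alt a b n @ z)"
        using z ab by (intro red_cong[OF u]) simp_all
      \<comment> \<open>Since \<open>b\<close> is a left descent, putting \<open>b\<close> in front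
        shortens the element, so exchange applies.\<close>
      have "val (b # alt a b n @ z) = val w"
        using val_move_Cons[of b w "alt a b n @ z"] z d ab by simp
      then have "\<not> red (b # alt a b n @ z)"
        using red_le[of "b # alt a b n @ z" w] z d by auto
      then obtain z' where "val (alt a b n @ z) = val (alt b a (Suc n) @ z')" "Suc (length z') = length z" "set z' \<subseteq> S"
        using alt_delete_exchange[OF ab(1-3) r _ n(1) ab(4)] by blast
      then show ?thesis using z by (intro exI[of _ z']) simp
    qed
    show ?thesis
    proof (intro conjI)
      show "\<exists>z. val u = val (alt s t (Suc n) @ z) \<and> Suc n + length z = length u \<and> set z \<subseteq> S"
        using Suc.IH[OF n(1,4)] step[OF S(2,1) st[symmetric] n(3) _ _ _ s(2) len(1) S(3)] by blast
      show "\<exists>z. val u = val (alt t s (Suc n) @ z) \<and> Suc n + length z = length u \<and> set z \<subseteq> S"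
        using Suc.IH[OF n(1,4)] step[OF S(1,2) st n(2) _ _ _ t(2) len(2) S(4)] by blast
    qed
  qed
qed simp

end

section \<open>Words without braid moves\<close>

lemma alt_append: "alt s t (n + k) = alt s t n @ (if even n then alt s t k else alt t s k)"
  by (induction n arbitrary: s t) auto

context coxeter
begin

abbreviation "ceq \<equiv> commutation_equivalent S m"

lemma ceq_refl [simp]: "ceq u u"
  by (simp add: commutation_equivalent_def)

lemma ceq_trans [trans]: "ceq u v \<Longrightarrow> ceq v w \<Longrightarrow> ceq u w"
  by (simp add: commutation_equivalent_def)

lemma commutation_move_ctxt:
  assumes "commutation_move S m u v"
  shows "commutation_move S m (x @ u @ y) (x @ v @ y)"
proof -
  obtain x' y' s t where "s \<in> S" "t \<in> S" "m s t = 2" "u = x' @ [s, t] @ y'" "v = x' @ [t, s] @ y'"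
    using assms unfolding commutation_move_def by blast
  then show ?thesis unfolding commutation_move_def
    by (intro exI[of _ "x @ x'"] exI[of _ "y' @ y"] exI[of _ s] exI[of _ t]) simp
qed

lemma ceq_ctxt: "ceq u v \<Longrightarrow> ceq (x @ u @ y) (x @ v @ y)"
  unfolding commutation_equivalent_def
  by (induction rule: rtranclp_induct)
    (blast intro: commutation_move_ctxt rtranclp.rtrancl_into_rtrancl)+

lemma ceq_Cons: "ceq u v \<Longrightarrow> ceq (s # u) (s # v)"
  using ceq_ctxt[of u v "[s]" "[]"] by simp

lemma commutation_move_sym: "commutation_move S m u v \<Longrightarrow> commutation_move S m v u"
  unfolding commutation_move_def using m_sym by metis

lemma ceq_sym: "ceq u v \<Longrightarrow> ceq v u"
  unfolding commutation_equivalent_def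
  by (induction rule: rtranclp_induct)
    (blast intro: commutation_move_sym converse_rtranclp_into_rtranclp)+

lemma ceq_induct [consumes 1, case_names refl step]:
  assumes "ceq u v" "P u"
    "\<And>x y s t. s \<in> S \<Longrightarrow> t \<in> S \<Longrightarrow> m s t = 2 \<Longrightarrow> P (x @ [s, t] @ y) \<Longrightarrow> P (x @ [t, s] @ y)"
  shows "P v"
  using assms(1) unfolding commutation_equivalent_def
proof (induction rule: rtranclp_induct)
  case (step v w)
  then show ?case using assms(3) unfolding commutation_move_def by blast
qed (rule assms(2))

lemma ceq_swap: "s \<in> S \<Longrightarrow> t \<in> S \<Longrightarrow> m s t = 2 \<Longrightarrow> ceq (x @ [s, t] @ y) (x @ [t, s] @ y)"
  unfolding commutation_equivalent_def commutation_move_def by (intro r_into_rtranclp) blast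

lemma ceq_set: "ceq u v \<Longrightarrow> set v = set u"
  by (induction rule: ceq_induct) auto

lemma ceq_length: "ceq u v \<Longrightarrow> length v = length u"
  by (induction rule: ceq_induct) auto

lemma val_braid:
  assumes "s \<in> S" "t \<in> S" "m s t = enat k"
  shows "val (alt s t k) = val (alt t s k)"
proof (rule val_cancel_right)
  have "alt s t k @ rev (alt t s k) = alt s t (2 * k)"
    unfolding rev_alt mult_2 alt_append by simp
  then have "val (alt s t k @ rev (alt t s k)) = val []"
    using val_relator[OF assms] by simp
  also have "\<dots> = val (alt t s k @ rev (alt t s k))"
    using val_cancel_rev[of "rev (alt t s k)"] assms by simp
  finally show "val (alt s t k @ rev (alt t s k)) = val (alt t s k @ rev (alt t s k))" .
qed (use assms in simp_all)

lemma val_braid_ctxt: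
  assumes "s \<in> S" "t \<in> S" "m s t = enat k" "set x \<subseteq> S" "set y \<subseteq> S"
  shows "val (x @ alt s t k @ y) = val (x @ alt t s k @ y)"
  by (rule val_context[OF val_braid[OF assms(1-3)]]) (use assms in simp_all)

lemma ceq_val:
  assumes "ceq u v" "set u \<subseteq> S"
  shows "val v = val u"
proof -
  have "val v = val u \<and> set v \<subseteq> S" using assms(1)
  proof (induction rule: ceq_induct)
    case (step x y s t)
    have 2: "m s t = enat 2" using step(3) by (simp add: numeral_eq_enat)
    have "val (x @ alt s t 2 @ y) = val (x @ alt t s 2 @ y)"
      by (rule val_braid_ctxt[OF step(1,2) 2]) (use step in auto)
    then have "val (x @ [s, t] @ y) = val (x @ [t, s] @ y)" by (simp only: numeral_2_eq_2 alt.simps)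
    then show ?case using step(4) by auto
  qed (use assms in simp)
  then show ?thesis by simp
qed

text \<open>The combinatorial form of a reduced word of an FC element. No group value occurs in it,
  so it passes to factors and reversals; reducedness is a consequence
  (\<open>fcw_red\<close>).\<close>

definition fcw :: "'a list \<Rightarrow> bool" where
  "fcw u \<longleftrightarrow> set u \<subseteq> S \<and> (\<forall>v. ceq u v \<longrightarrow>
     (\<forall>x y s. v \<noteq> x @ [s, s] @ y) \<and>
     (\<forall>x y s t k. m s t = enat k \<longrightarrow> 3 \<le> k \<longrightarrow> v \<noteq> x @ alt s t k @ y))"

lemma fcw_set: "fcw u \<Longrightarrow> set u \<subseteq> S"
  by (simp add: fcw_def)

lemma fcw_no_double: "fcw u \<Longrightarrow> \<not> ceq u (x @ [s, s] @ y)"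
  unfolding fcw_def by blast

lemma fcw_no_braid: "fcw u \<Longrightarrow> m s t = enat k \<Longrightarrow> 3 \<le> k \<Longrightarrow> \<not> ceq u (x @ alt s t k @ y)"
  unfolding fcw_def by blast

lemma fcw_ceq: "fcw u \<Longrightarrow> ceq u v \<Longrightarrow> fcw v"
  unfolding fcw_def using ceq_set ceq_trans by metis

lemma fcw_factor:
  assumes "fcw (x @ y @ z)"
  shows "fcw y"
  unfolding fcw_def
proof (intro conjI allI impI notI)
  show "set y \<subseteq> S" using fcw_set[OF assms] by simp
next
  fix v x' y' s
  assume "ceq y v" "v = x' @ [s, s] @ y'"
  then have "ceq (x @ y @ z) ((x @ x') @ [s, s] @ (y' @ z))" using ceq_ctxt[of y v x z] by simp
  then show False using fcw_no_double[OF assms] by blast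
next
  fix v x' y' s t k
  assume "ceq y v" "v = x' @ alt s t k @ y'" and k: "m s t = enat k" "3 \<le> k"
  then have "ceq (x @ y @ z) ((x @ x') @ alt s t k @ (y' @ z))" using ceq_ctxt[of y v x z] by simp
  then show False using fcw_no_braid[OF assms k] by blast
qed

lemma fcw_Cons: "fcw (s # u) \<Longrightarrow> fcw u"
  using fcw_factor[of "[s]" u "[]"] by simp

text \<open>Matsumoto's theorem for words that admit no braid move: the argument of
  \<open>two_descents\<close> only ever produces commutations.\<close>

lemma fcw_unique:
  assumes "fcw u" "red u" "red v" "val u = val v"
  shows "ceq u v"
  using assms
proof (induction "length u" arbitrary: u v rule: less_induct)
  case less
  have lenuv: "length u = length v"
    using red_le[OF less.prems(2)] red_le[OF less.prems(3)] less.prems red_set by (simp add: le_antisym)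
  show ?case
  proof (cases u)
    case Nil
    then show ?thesis using lenuv by simp
  next
    case (Cons s u')
    then obtain t v' where v: "v = t # v'" using lenuv by (cases v) auto
    have S: "s \<in> S" "t \<in> S" "set u' \<subseteq> S" "set v' \<subseteq> S"
      using red_set[OF less.prems(2)] red_set[OF less.prems(3)] Cons v by auto
    have red': "red u'" "red v'"
      using red_suffix[of "[s]" u'] red_suffix[of "[t]" v'] less.prems Cons v by simp_all
    have fu': "fcw u'" using fcw_Cons less.prems Cons by blast
    show ?thesis
    proof (cases "s = t")
      case True
      have "val (s # u') = val (s # v')" using less.prems(4) Cons v True by simp
      then have "val u' = val v'"
        using val_move_Cons[of s u' "s # v'"] S by simp
      then have "ceq u' v'" using less.hyps[OF _ fu' red'] Cons by simp
      then show ?thesis using Cons v True ceq_Cons by simp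
    next
      case False
      have ruv: "red (s # u')" "red (t # v')" "val u = val (s # u')" "val u = val (t # v')"
        using less.prems Cons v by simp_all
      note two = two_descents[OF less.prems(2) ruv(1,3,2,4) False]
      \<comment> \<open>With an infinite label, \<open>two_descents\<close> would give a prefix
        longer than \<open>u\<close>.\<close>
      obtain k where k: "m s t = enat k"
      proof (cases "m s t")
        case infinity
        then show ?thesis using two[of "Suc (length u)"] by auto
      qed (use that in auto)
      have "m s t \<ge> 1" "m s t \<noteq> 1" using m_ge_1[OF S(1,2)] m_eq_1[OF S(1,2)] False by simp_all
      then have k2: "2 \<le> k" using k by (simp add: one_enat_def)
      obtain z where z: "val u = val (alt s t k @ z)" "k + length z = length u" "set z \<subseteq> S"
        using two[of k] k k2 by auto
      obtain j where j: "k = Suc j" using k2 by (cases k) auto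
      have val_u': "val u' = val (alt t s j @ z)"
      proof -
        have "val (s # u') = val (s # alt t s j @ z)" using z ruv(3) j by simp
        then show ?thesis using val_move_Cons[of s u' "s # alt t s j @ z"] S z by simp
      qed
      have "red (alt t s j @ z)"
        by (rule red_cong[OF red'(1) val_u'[symmetric]]) (use S z j Cons in simp_all)
      then have "ceq u' (alt t s j @ z)"
        by (intro less.hyps[OF _ fu' red'(1)] val_u') (simp_all add: Cons)
      then have c: "ceq u (alt s t k @ z)" using ceq_Cons[of u' _ s] Cons j by simp
      \<comment> \<open>The induction hypothesis has produced a braid of length \<open>k\<close> in
        the commutation class of \<open>u\<close>, so this braid can only be a commutation.\<close>
      have "\<not> 3 \<le> k" using fcw_no_braid[OF less.prems(1) k, of "[]" z] c by auto
      then have "k = 2" using k2 by simp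
      then have alt2: "alt s t k = [s, t]" "m s t = 2"
        using k by (simp_all add: numeral_2_eq_2 numeral_eq_enat)
      \<comment> \<open>After the swap the first letter is that of \<open>v\<close>, and the
        induction hypothesis applies to the tails.\<close>
      have c': "ceq u (t # s # z)"
        using ceq_trans[OF c, of "t # s # z"] ceq_swap[OF S(1,2) alt2(2), of "[]" z] alt2(1) by simp
      then have fz: "fcw (s # z)" using fcw_ceq[OF less.prems(1)] fcw_Cons by blast
      have uS: "set u \<subseteq> S" using red_set less.prems by blast
      have "val (t # s # z) = val u" using ceq_val[OF c' uS] .
      then have val_v': "val (s # z) = val v'"
        using val_move_Cons[of t "s # z" "t # v'"] ruv(4) S z by simp
      have lz: "length (s # z) = length v'" using ceq_length[OF c'] lenuv v by simp
      have "red (s # z)"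
        by (rule red_cong[OF red'(2) val_v']) (use S z lz in simp_all)
      then have "ceq (s # z) v'"
        by (intro less.hyps[OF _ fz _ red'(2) val_v']) (use ceq_length[OF c'] in simp_all)
      then show ?thesis using c' v ceq_Cons ceq_trans by metis
    qed
  qed
qed

text \<open>If \<open>s # y\<close> is not reduced, exchange gives a reduced word for
  \<open>y\<close> starting with \<open>s\<close>. By uniqueness it is commutation equivalent to
  \<open>y\<close>, and a double \<open>s\<close> appears.\<close>

lemma fcw_red: "fcw u \<Longrightarrow> red u"
proof (induction u)
  case Nil
  then show ?case by (simp add: red_def)
next
  case (Cons s y)
  have fy: "fcw y" and ry: "red y" using Cons fcw_Cons by blast+
  have S: "s \<in> S" "set y \<subseteq> S" using fcw_set[OF Cons.prems] by simp_all
  show ?case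
  proof (rule ccontr)
    assume "\<not> red (s # y)"
    then obtain x a z where y: "y = x @ [a] @ z" and v: "val y = val (s # x @ z)"
      using exchange[OF ry S(1)] by blast
    have "red (s # x @ z)"
      by (rule red_cong[OF ry v[symmetric]]) (use S y in simp_all)
    then have "ceq y (s # x @ z)" using fcw_unique[OF fy ry _ v] by blast
    then have "ceq (s # y) ([] @ [s, s] @ (x @ z))" using ceq_Cons by simp
    then show False using fcw_no_double[OF Cons.prems] by blast
  qed
qed

lemma fcw_fully_commutative:
  assumes "fcw u"
  shows "fully_commutative S m (val u)"
  unfolding fully_commutative_def reduced_expression_iff
proof (intro allI impI)
  fix v w assume "red v \<and> val u = val v" "red w \<and> val u = val w"
  then have "ceq u v" "ceq u w" using fcw_unique[OF assms fcw_red[OF assms]] by blast+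
  then show "ceq v w" using ceq_sym ceq_trans by blast
qed

text \<open>Two letters that do not commute never pass each other; their relative order is an
  invariant of the commutation class.\<close>

lemma filter_pair_ceq:
  assumes "ceq u v" "m s t \<noteq> 2" "m t s \<noteq> 2" "m s s \<noteq> 2" "m t t \<noteq> 2"
  shows "filter (\<lambda>x. x = s \<or> x = t) v = filter (\<lambda>x. x = s \<or> x = t) u"
  using assms(1)
proof (induction rule: ceq_induct)
  case (step x y a b)
  then have "\<not> ((a = s \<or> a = t) \<and> (b = s \<or> b = t))" using assms by auto
  then have "filter (\<lambda>x. x = s \<or> x = t) [a, b] = filter (\<lambda>x. x = s \<or> x = t) [b, a]" by auto
  then show ?case using step by (simp only: filter_append)
qed simp

text \<open>Performing a braid move gives another reduced word, but the order of \<open>s\<close>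
  and \<open>t\<close> in it is different, so it lies in another commutation class.\<close>

lemma fully_commutative_fcw:
  assumes "red u" "fully_commutative S m (val u)"
  shows "fcw u"
  unfolding fcw_def
proof (intro conjI allI impI notI)
  show uS: "set u \<subseteq> S" using assms red_set by blast
  have r: "red v" "val v = val u" if "ceq u v" for v
  proof -
    show "val v = val u" using ceq_val[OF that uS] .
    then show "red v" using ceq_set[OF that] ceq_length[OF that] uS assms(1) by (intro red_cong[OF assms(1)]) simp_all
  qed
  show False if "ceq u v" "v = x @ [s, s] @ y" for v x y s
    using r(1)[OF that(1)] that(2) not_red_double by blast
  show False if c: "ceq u v" and k: "m s t = enat k" "3 \<le> k" and v: "v = x @ alt s t k @ y" for v x y s t k
  proof -
    obtain j where j: "k = Suc (Suc j)" using k by (metis numeral_3_eq_3 Suc_le_D Suc_le_mono)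
    have vS: "set v \<subseteq> S" using ceq_set[OF c] uS by simp
    have S: "s \<in> S" "t \<in> S" "set x \<subseteq> S" "set y \<subseteq> S" using vS v j by auto
    have ne: "m s t \<noteq> 2" "m t s \<noteq> 2" "m s s \<noteq> 2" "m t t \<noteq> 2" "s \<noteq> t"
      using k S m_sym[OF S(1,2)] m_self[OF S(1)] m_self[OF S(2)]
      by (auto simp: numeral_eq_enat one_enat_def)
    let ?v' = "x @ alt t s k @ y"
    have "val ?v' = val v" using val_braid_ctxt[OF S(1,2) k(1) S(3,4)] v by simp
    moreover then have "red ?v'" using r(1)[OF c] v S by (intro red_cong[OF r(1)[OF c]]) simp_all
    ultimately have "ceq v ?v'"
      using assms(2) r[OF c] unfolding fully_commutative_def reduced_expression_iff by metis
    from filter_pair_ceq[OF this ne(1-4)]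
    have "filter (\<lambda>x. x = s \<or> x = t) (alt t s k) = filter (\<lambda>x. x = s \<or> x = t) (alt s t k)"
      unfolding v by simp
    then show False using j ne(5) by simp
  qed
qed

section \<open>Criteria for finiteness and infiniteness\<close>

lemma FC_finite_bounded:
  assumes "\<And>u. fcw u \<Longrightarrow> length u \<le> N"
  shows "FC_finite S m"
proof -
  have "{w \<in> carrier (coxeter_group S m). fully_commutative S m w} \<subseteq> val ` {u. set u \<subseteq> S \<and> length u \<le> N}"
  proof
    fix w assume "w \<in> {w \<in> carrier (coxeter_group S m). fully_commutative S m w}"
    then obtain u where u: "set u \<subseteq> S" "w = val u" "fully_commutative S m w"
      using carrier_val by blast
    then obtain v where "red v" "val v = w" using red_exists by blast
    then show "w \<in> val ` {u. set u \<subseteq> S \<and> length u \<le> N}"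
      using fully_commutative_fcw[of v] assms[of v] u fcw_set[of v] by blast
  qed
  then show ?thesis unfolding FC_finite_def
    using finite_lists_length_le[OF finite_S] finite_surj by blast
qed

lemma FC_finite_CFC_finite:
  assumes "FC_finite S m"
  shows "CFC_finite S m"
proof -
  have "fully_commutative S m w" if w: "w \<in> carrier (coxeter_group S m)" "cyclically_fully_commutative S m w" for w
  proof -
    obtain v where "red v" "val v = w" using carrier_val[OF w(1)] red_exists by blast
    then have "reduced_expression S m w v" by (simp add: reduced_expression_iff)
    then obtain w' where "reduced_expression S m w' (rotate 0 v)" "fully_commutative S m w'"
      using w(2) unfolding cyclically_fully_commutative_def by blast
    then show ?thesis using \<open>val v = w\<close> by (auto simp: reduced_expression_iff)
  qed
  then show ?thesis using assms unfolding FC_finite_def CFC_finite_def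
    by (elim rev_finite_subset) blast
qed

text \<open>Closure makes every word in \<open>C\<close> satisfy \<open>fcw\<close>, and by
  uniqueness all reduced words of its value lie in \<open>C\<close> again, together with their
  cyclic shifts. Hence the values are CFC.\<close>

lemma CFC_infinite:
  assumes closed: "\<And>u v. C u \<Longrightarrow> commutation_move S m u v \<Longrightarrow> C v" "\<And>u. C u \<Longrightarrow> C (rotate1 u)"
    and S: "\<And>u. C u \<Longrightarrow> set u \<subseteq> S"
    and avoid: "\<And>x s y. \<not> C (x @ [s, s] @ y)"
      "\<And>x s t k y. m s t = enat k \<Longrightarrow> 3 \<le> k \<Longrightarrow> \<not> C (x @ alt s t k @ y)"
    and unbounded: "\<And>n. \<exists>u. C u \<and> n \<le> length u"
  shows "\<not> CFC_finite S m"
proof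
  assume fin: "CFC_finite S m"
  have C_ceq: "C v" if "ceq u v" "C u" for u v
    using that unfolding commutation_equivalent_def
    by (induction rule: rtranclp_induct) (auto intro: closed)
  have C_rot: "C (rotate k u)" if "C u" for k u
    using that by (induction k) (auto intro: closed)
  have C_fcw: "fcw u" if "C u" for u
    unfolding fcw_def using C_ceq[OF _ that] S[OF that] avoid by blast
  have cfc: "cyclically_fully_commutative S m (val u)" if u: "C u" for u
    unfolding cyclically_fully_commutative_def
  proof (intro allI impI)
    fix v k assume v: "reduced_expression S m (val u) v"
    have "ceq u v"
      using v fcw_unique[OF C_fcw[OF u] fcw_red[OF C_fcw[OF u]]] by (simp add: reduced_expression_iff)
    then have "fcw (rotate k v)" using C_ceq u C_rot C_fcw by blast
    then show "\<exists>w'\<in>carrier (coxeter_group S m). reduced_expression S m w' (rotate k v) \<and> fully_commutative S m w'"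
      using fcw_fully_commutative[of "rotate k v"] fcw_red[of "rotate k v"]
        val_carrier[OF fcw_set, of "rotate k v"] reduced_expression_iff by blast
  qed
  \<comment> \<open>All words of \<open>C\<close> with a given value are reduced, so they share one
    length; unbounded lengths therefore mean infinitely many values.\<close>
  define len where "len w = length (SOME u. C u \<and> val u = w)" for w
  have len: "len (val u) = length u" if "C u" for u
  proof -
    have "\<exists>u'. C u' \<and> val u' = val u" using that by blast
    then have h: "C (SOME u'. C u' \<and> val u' = val u) \<and> val (SOME u'. C u' \<and> val u' = val u) = val u"
      by (rule someI_ex)
    then show ?thesis unfolding len_def
      using red_le[OF fcw_red[OF C_fcw]] S that by (metis le_antisym)
  qed
  have "val ` {u. C u} \<subseteq> {w \<in> carrier (coxeter_group S m). cyclically_fully_commutative S m w}"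
    using cfc val_carrier S by blast
  then have "finite (len ` val ` {u. C u})"
    using fin unfolding CFC_finite_def by (meson finite_imageI finite_subset)
  then obtain N where "\<And>l. l \<in> len ` val ` {u. C u} \<Longrightarrow> l \<le> N"
    by (metis finite_nat_set_iff_bounded_le)
  then have "length u \<le> N" if "C u" for u using len[OF that] that by (metis image_eqI mem_Collect_eq)
  then show False using unbounded[of "Suc N"] not_less_eq_eq by blast
qed

end

section \<open>Gaps between consecutive occurrences of a letter\<close>

lemma count_list_ge_2_split:
  "2 \<le> count_list y e \<Longrightarrow> \<exists>y1 y2 y3. y = y1 @ [e] @ y2 @ [e] @ y3 \<and> e \<notin> set y2"
proof -
  assume c: "2 \<le> count_list y e"
  then have "e \<in> set y" using count_notin by fastforce
  then obtain y1 z where y: "y = y1 @ e # z" "e \<notin> set y1" using split_list_first by metis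
  then have "e \<in> set z" using c count_notin[of e z] count_notin[of e y1] by fastforce
  then obtain y2 y3 where "z = y2 @ e # y3" "e \<notin> set y2" using split_list_first by metis
  then show ?thesis using y by (intro exI[of _ y1] exI[of _ y2] exI[of _ y3]) simp
qed

lemma count_list_1_split:
  "count_list y e = 1 \<Longrightarrow> \<exists>y1 y2. y = y1 @ [e] @ y2 \<and> e \<notin> set y1 \<and> e \<notin> set y2"
proof -
  assume c: "count_list y e = 1"
  then have "e \<in> set y" using count_notin by fastforce
  then obtain y1 z where y: "y = y1 @ e # z" "e \<notin> set y1" using split_list_first by metis
  then have "e \<notin> set z" using c count_list_0_iff[of z e] by simp
  then show ?thesis using y by (intro exI[of _ y1] exI[of _ z]) simp
qed

text \<open>The gaps between successive \<open>c\<close> are disjoint, one fewer than the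
  occurrences, and each contains a \<open>d\<close>.\<close>

lemma count_list_le_Suc:
  assumes "\<And>x y z. w = x @ [c] @ y @ [c] @ z \<Longrightarrow> c \<notin> set y \<Longrightarrow> d \<in> set y"
  shows "count_list w c \<le> Suc (count_list w d)"
  using assms
proof (induction "length w" arbitrary: w rule: less_induct)
  case less
  show ?case
  proof (cases "2 \<le> count_list w c")
    case True
    then obtain x y z where w: "w = x @ [c] @ y @ [c] @ z" "c \<notin> set y"
      using count_list_ge_2_split by metis
    have "c \<in> set w" using w by simp
    then obtain x' w' where x': "w = x' @ c # w'" "c \<notin> set x'" using split_list_first by metis
    then have "c \<in> set w'" using True count_notin[of c w'] count_notin[of c x'] by fastforce
    then obtain y' z' where y': "w' = y' @ c # z'" "c \<notin> set y'" using split_list_first by metis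
    have "d \<in> set y'" using less.prems[of x' y' z'] x' y' by simp
    then have d: "1 \<le> count_list y' d" using count_list_0_iff[of y' d] by (cases "count_list y' d") auto
    have "count_list (c # z') c \<le> Suc (count_list (c # z') d)"
    proof (rule less.hyps)
      show "length (c # z') < length w" using x' y' by simp
      show "d \<in> set y2" if "c # z' = x2 @ [c] @ y2 @ [c] @ z2" "c \<notin> set y2" for x2 y2 z2
      proof (rule less.prems)
        show "w = (x' @ c # y' @ x2) @ [c] @ y2 @ [c] @ z2" using x' y' that(1) by simp
      qed (rule that(2))
    qed
    then show ?thesis
      using d x' y' count_notin[of c y'] count_notin[of c x'] by (simp split: if_splits)
  qed simp
qed

context coxeter
begin

section \<open>Sliding letters through a gap\<close>

lemma ceq_block:
  assumes "\<And>a b. a \<in> set w \<Longrightarrow> b \<in> set y \<Longrightarrow> m a b = 2" "set w \<subseteq> S" "set y \<subseteq> S"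
  shows "ceq (x @ w @ y @ z) (x @ y @ w @ z)"
proof -
  have 1: "ceq ([a] @ y) (y @ [a])" if "a \<in> S" "set y \<subseteq> S" "\<And>b. b \<in> set y \<Longrightarrow> m a b = 2" for a y
    using that
  proof (induction y)
    case (Cons b y)
    then have "ceq ([] @ [a, b] @ y) ([] @ [b, a] @ y)" by (intro ceq_swap) auto
    moreover have "ceq (b # ([a] @ y)) (b # (y @ [a]))" using Cons by (intro ceq_Cons Cons.IH) auto
    ultimately show ?case using ceq_trans by simp
  qed simp
  have "ceq (w @ y) (y @ w)"
    using assms
  proof (induction w)
    case (Cons a w)
    then have "ceq (a # (w @ y)) (a # (y @ w))" by (intro ceq_Cons Cons.IH) auto
    moreover have "ceq ([] @ ([a] @ y) @ w) ([] @ (y @ [a]) @ w)"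
      using Cons by (intro ceq_ctxt 1) auto
    ultimately show ?case using ceq_trans by simp
  qed simp
  from ceq_ctxt[OF this, of x z] show ?thesis by simp
qed

lemma ceq_rev: "ceq u v \<Longrightarrow> ceq (rev u) (rev v)"
proof (induction rule: ceq_induct)
  case (step x y s t)
  have "m t s = 2" using step m_sym by metis
  then have "ceq (rev y @ [t, s] @ rev x) (rev y @ [s, t] @ rev x)"
    using step ceq_swap by blast
  then show ?case using step(4) ceq_trans by simp
qed simp

lemma fcw_rev:
  assumes "fcw u"
  shows "fcw (rev u)"
  unfolding fcw_def
proof (intro conjI allI impI notI)
  show "set (rev u) \<subseteq> S" using fcw_set[OF assms] by simp
  fix v assume "ceq (rev u) v"
  then have c: "ceq u (rev v)" using ceq_rev by fastforce
  show False if "v = x @ [s, s] @ y" for x y s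
    using c fcw_no_double[OF assms, of "rev y" s "rev x"] that by simp
  show False if k: "m s t = enat k" "3 \<le> k" and "v = x @ alt s t k @ y" for x y s t k
  proof -
    have r: "ceq u (rev y @ rev (alt s t k) @ rev x)" using c that by simp
    have "rev v = rev y @ rev (alt s t k) @ rev x" using that by simp
    moreover have "set (rev v) \<subseteq> S" using ceq_set[OF c] fcw_set[OF assms] by simp
    ultimately have "set (alt s t k) \<subseteq> S" by simp
    moreover have "s \<in> set (alt s t k)" "t \<in> set (alt s t k)"
      using k(2) by (cases k; cases "k - 1"; simp)+
    ultimately have "m t s = enat k" using k m_sym by (metis subsetD)
    then show False using r fcw_no_braid[OF assms] k unfolding rev_alt by (simp split: if_splits)
  qed
qed

text \<open>The letter \<open>s\<close> itself is kept as well, because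
  \<open>m s s = 1\<close>.\<close>

abbreviation nb :: "'a \<Rightarrow> 'a list \<Rightarrow> 'a list" where
  "nb s y \<equiv> filter (\<lambda>t. m s t \<noteq> 2) y"

lemma nb_Nil_commutes: "nb s y = [] \<Longrightarrow> b \<in> set y \<Longrightarrow> m s b = 2"
  by (simp add: filter_empty_conv)

text \<open>Otherwise the first \<open>s\<close> slides through \<open>y\<close> and meets the
  second.\<close>

lemma gap_nonempty:
  assumes "fcw (s # y @ [s])"
  shows "nb s y \<noteq> []"
proof
  assume "nb s y = []"
  then have "ceq ([] @ [s] @ y @ [s]) ([] @ y @ [s] @ [s])"
    using fcw_set[OF assms] by (intro ceq_block) (auto dest: nb_Nil_commutes)
  then show False using fcw_no_double[OF assms, of y s "[]"] by simp
qed

text \<open>Both \<open>s\<close> slide up to the single obstacle \<open>t\<close> and form the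
  braid \<open>s t s\<close>.\<close>

lemma gap_single:
  assumes f: "fcw (s # y @ [s])" and n: "nb s y = [t]"
  shows "m s t \<noteq> 3"
proof
  assume m3: "m s t = 3"
  obtain y1 y2 where y: "y = y1 @ [t] @ y2" and n12: "nb s y1 = []" "nb s y2 = []"
  proof -
    obtain us vs where "y = us @ t # vs" "\<forall>u\<in>set us. \<not> m s u \<noteq> 2" "[] = nb s vs"
      using filter_eq_ConsD[OF n] by blast
    then show thesis by (intro that[of us vs]) simp_all
  qed
  have S: "s \<in> S" "set y1 \<subseteq> S" "set y2 \<subseteq> S" using fcw_set[OF f] y by auto
  have "ceq ([] @ [s] @ y1 @ ([t] @ y2 @ [s])) ([] @ y1 @ [s] @ ([t] @ y2 @ [s]))"
    using S n12 by (intro ceq_block) (auto dest: nb_Nil_commutes)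
  also have "ceq \<dots> (y1 @ [s, t] @ y2 @ [s] @ [])" by simp
  also have "ceq \<dots> (y1 @ [s, t] @ [s] @ y2 @ [])"
  proof -
    have "ceq ((y1 @ [s, t]) @ y2 @ [s] @ []) ((y1 @ [s, t]) @ [s] @ y2 @ [])"
      using S n12 by (intro ceq_block) (auto dest!: nb_Nil_commutes simp: m_sym[of _ s] subset_iff)
    then show ?thesis by simp
  qed
  finally have "ceq (s # y @ [s]) (y1 @ alt s t 3 @ y2)" using y by (simp add: numeral_3_eq_3)
  moreover have "m s t = enat 3" by (simp only: m3 numeral_eq_enat)
  ultimately show False using fcw_no_braid[OF f, of s t 3 y1 y2] by simp
qed

lemma gap_count:
  assumes f: "fcw (s # y @ [s])" and e: "\<And>r. r \<in> set y \<Longrightarrow> m s r \<noteq> 2 \<Longrightarrow> r = e" and m3: "m s e = 3"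
  shows "2 \<le> count_list y e"
proof -
  have "m s r \<noteq> 2 \<longleftrightarrow> r = e" if "r \<in> set y" for r using e[OF that] m3 by auto
  then have "nb s y = filter (\<lambda>r. r = e) y" by (rule filter_cong[OF refl])
  also have "\<dots> = replicate (count_list y e) e" by (induction y) auto
  finally have n: "nb s y = replicate (count_list y e) e" .
  show ?thesis
  proof (rule ccontr)
    assume "\<not> 2 \<le> count_list y e"
    then consider "count_list y e = 0" | "count_list y e = 1" by linarith
    then show False using gap_nonempty[OF f] gap_single[OF f] n m3 by cases auto
  qed
qed

text \<open>The outer letters slide inwards, then the right-hand pair slides as a block through
  \<open>y2\<close>; this assembles the braid \<open>s t s t\<close>.\<close>

lemma chain_4:
  assumes f: "fcw (s # y1 @ [t] @ y2 @ [s] @ y3 @ [t])"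
    and n: "nb s y1 = []" "nb s y2 = []" "nb t y2 = []" "nb t y3 = []"
  shows "m s t \<noteq> 4"
proof
  assume m4: "m s t = 4"
  have S: "s \<in> S" "t \<in> S" "set y1 \<subseteq> S" "set y2 \<subseteq> S" "set y3 \<subseteq> S" using fcw_set[OF f] by auto
  have "ceq ([] @ [s] @ y1 @ ([t] @ y2 @ [s] @ y3 @ [t])) ([] @ y1 @ [s] @ ([t] @ y2 @ [s] @ y3 @ [t]))"
    using S n by (intro ceq_block) (auto dest: nb_Nil_commutes)
  also have "\<dots> = (y1 @ [s, t] @ y2 @ [s]) @ y3 @ [t] @ []" by simp
  also have "ceq \<dots> ((y1 @ [s, t] @ y2 @ [s]) @ [t] @ y3 @ [])"
    using S n by (intro ceq_block) (auto dest!: nb_Nil_commutes simp: m_sym[of _ t] subset_iff)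
  also have "\<dots> = (y1 @ [s, t]) @ y2 @ [s, t] @ y3" by simp
  also have "ceq \<dots> ((y1 @ [s, t]) @ [s, t] @ y2 @ y3)"
    using S n by (intro ceq_block) (auto dest!: nb_Nil_commutes simp: m_sym[of _ t] m_sym[of _ s] subset_iff)
  also have "\<dots> = y1 @ alt s t 4 @ (y2 @ y3)" by (simp add: numeral_eq_Suc)
  finally have "ceq (s # y1 @ [t] @ y2 @ [s] @ y3 @ [t]) (y1 @ alt s t 4 @ y2 @ y3)" by simp
  moreover have "m s t = enat 4" by (simp only: m4 numeral_eq_enat)
  ultimately show False using fcw_no_braid[OF f, of s t 4 y1 "y2 @ y3"] by simp
qed

lemma chain_5:
  assumes f: "fcw (s # y1 @ [t] @ y2 @ [s] @ y3 @ [t] @ y4 @ [s])"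
    and n: "nb s y1 = []" "nb s y2 = []" "nb t y2 = []" "nb s y3 = []" "nb t y3 = []" "nb s y4 = []"
  shows "m s t \<noteq> 5"
proof
  assume m5: "m s t = 5"
  have S: "s \<in> S" "t \<in> S" "set y1 \<subseteq> S" "set y2 \<subseteq> S" "set y3 \<subseteq> S" "set y4 \<subseteq> S"
    using fcw_set[OF f] by auto
  have "ceq ([] @ [s] @ y1 @ ([t] @ y2 @ [s] @ y3 @ [t] @ y4 @ [s])) ([] @ y1 @ [s] @ ([t] @ y2 @ [s] @ y3 @ [t] @ y4 @ [s]))"
    using S n by (intro ceq_block) (auto dest: nb_Nil_commutes)
  also have "\<dots> = (y1 @ [s, t] @ y2 @ [s] @ y3 @ [t]) @ y4 @ [s] @ []" by simp
  also have "ceq \<dots> ((y1 @ [s, t] @ y2 @ [s] @ y3 @ [t]) @ [s] @ y4 @ [])"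
    using S n by (intro ceq_block) (auto dest!: nb_Nil_commutes simp: m_sym[of _ s] subset_iff)
  also have "\<dots> = (y1 @ [s, t] @ y2 @ [s]) @ y3 @ [t, s] @ y4" by simp
  also have "ceq \<dots> ((y1 @ [s, t] @ y2 @ [s]) @ [t, s] @ y3 @ y4)"
    using S n by (intro ceq_block) (auto dest!: nb_Nil_commutes simp: m_sym[of _ t] m_sym[of _ s] subset_iff)
  also have "\<dots> = (y1 @ [s, t]) @ y2 @ [s, t, s] @ (y3 @ y4)" by simp
  also have "ceq \<dots> ((y1 @ [s, t]) @ [s, t, s] @ y2 @ (y3 @ y4))"
    using S n by (intro ceq_block) (auto dest!: nb_Nil_commutes simp: m_sym[of _ t] m_sym[of _ s] subset_iff)
  also have "\<dots> = y1 @ alt s t 5 @ (y2 @ y3 @ y4)" by (simp add: numeral_eq_Suc)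
  finally have "ceq (s # y1 @ [t] @ y2 @ [s] @ y3 @ [t] @ y4 @ [s]) (y1 @ alt s t 5 @ y2 @ y3 @ y4)" by simp
  moreover have "m s t = enat 5" by (simp only: m5 numeral_eq_enat)
  ultimately show False using fcw_no_braid[OF f, of s t 5 y1 "y2 @ y3 @ y4"] by simp
qed

text \<open>A path leaving \<open>c\<close> whose vertices have no links apart from those along it;
  \<open>take 1 ds\<close> is the next vertex, if any. The label between \<open>c\<close> and
  \<open>d\<close> is left free, so that the edges labelled 4 and 5 at a centre are covered as
  well.\<close>

fun arm :: "'a \<Rightarrow> 'a list \<Rightarrow> bool" where
  "arm c [] = True"
| "arm c (d # ds) \<longleftrightarrow> d \<in> S \<and> (\<forall>r\<in>S. m d r \<noteq> 2 \<longrightarrow> r = d \<or> r = c \<or> r \<in> set (take 1 ds)) \<and>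
     (\<forall>e\<in>set (take 1 ds). m d e = 3) \<and> arm d ds"

text \<open>Induction from the tip, whose only link is to its predecessor. Further in, a gap of
  \<open>d\<close> avoiding \<open>c\<close> would contain two \<open>e\<close>; between two
  successive \<open>e\<close> there is a \<open>d\<close> by induction, inside a gap of
  \<open>d\<close>.\<close>

lemma arm_gap:
  assumes "arm c (d # ds)" "fcw (d # y @ [d])" "d \<notin> set y"
  shows "c \<in> set y"
  using assms
proof (induction ds arbitrary: c d y)
  case Nil
  obtain r where "r \<in> set y" "m d r \<noteq> 2"
    using gap_nonempty[OF Nil(2)] by (auto simp: filter_empty_conv)
  then show ?case using Nil fcw_set[OF Nil(2)] by auto
next
  case (Cons e es)
  show ?case
  proof (rule ccontr)
    assume "c \<notin> set y"
    then have "2 \<le> count_list y e"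
      using Cons.prems fcw_set[OF Cons.prems(2)] by (intro gap_count[of d]) auto
    then obtain y1 y2 y3 where y: "y = y1 @ [e] @ y2 @ [e] @ y3" "e \<notin> set y2"
      using count_list_ge_2_split by metis
    have "fcw (e # y2 @ [e])"
      using fcw_factor[of "d # y1" "e # y2 @ [e]" "y3 @ [d]"] Cons.prems(2) y by simp
    then have "d \<in> set y2" using Cons.IH[of d e y2] Cons.prems(1) y by auto
    then show False using y Cons.prems by simp
  qed
qed

lemma arm_count_le:
  assumes "arm c (d # ds)" "fcw u"
  shows "count_list u d \<le> Suc (count_list u c)"
proof (rule count_list_le_Suc)
  fix x y z assume u: "u = x @ [d] @ y @ [d] @ z" and "d \<notin> set y"
  have "fcw (d # y @ [d])" using fcw_factor[of x "d # y @ [d]" z] assms(2) u by simp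
  then show "c \<in> set y" using arm_gap assms(1) \<open>d \<notin> set y\<close> by blast
qed

text \<open>The property that every gap of a vertex meets the next one travels outwards: a gap of
  \<open>d\<close> without \<open>e\<close> would contain two \<open>c\<close>, hence a
  \<open>d\<close> between them. The same argument allows one occurrence of the last vertex, and
  each of the \<open>length ds + 1\<close> steps back to \<open>c\<close> adds at most one.\<close>

lemma tail_count_le:
  assumes "arm c (d # ds)" "m d c = 3" "fcw w"
    and "\<And>x y z. w = x @ [c] @ y @ [c] @ z \<Longrightarrow> c \<notin> set y \<Longrightarrow> d \<in> set y"
  shows "count_list w c \<le> length ds + 2"
  using assms
proof (induction ds arbitrary: c d)
  case prems: (Nil c d)
  have "\<not> 2 \<le> count_list w d"
  proof
    assume "2 \<le> count_list w d"
    then obtain x y z where w: "w = x @ [d] @ y @ [d] @ z" "d \<notin> set y"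
      using count_list_ge_2_split by metis
    have f: "fcw (d # y @ [d])" using fcw_factor[of x "d # y @ [d]" z] prems(3) w by simp
    have "2 \<le> count_list y c"
      using prems(1,2) w fcw_set[OF f] by (intro gap_count[OF f]) auto
    then obtain y1 y2 y3 where y: "y = y1 @ [c] @ y2 @ [c] @ y3" "c \<notin> set y2"
      using count_list_ge_2_split by metis
    then have "d \<in> set y2" using prems(4)[of "x @ [d] @ y1" y2 "y3 @ [d] @ z"] w by simp
    then show False using w y by simp
  qed
  then show ?case using count_list_le_Suc[of w c d] prems(4) by fastforce
next
  case prems: (Cons e es c d)
  have "count_list w d \<le> length es + 2"
  proof (rule prems(1))
    show "arm d (e # es)" using prems(2) by simp
    show "m e d = 3" using prems(2) m_sym[of e d] by auto
    show "fcw w" by fact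
    fix x y z assume w: "w = x @ [d] @ y @ [d] @ z" "d \<notin> set y"
    have f: "fcw (d # y @ [d])" using fcw_factor[of x "d # y @ [d]" z] prems(4) w by simp
    show "e \<in> set y"
    proof (rule ccontr)
      assume "e \<notin> set y"
      then have "2 \<le> count_list y c"
        using prems(2,3) w fcw_set[OF f] by (intro gap_count[OF f]) auto
      then obtain y1 y2 y3 where y: "y = y1 @ [c] @ y2 @ [c] @ y3" "c \<notin> set y2"
        using count_list_ge_2_split by metis
      then have "d \<in> set y2" using prems(5)[of "x @ [d] @ y1" y2 "y3 @ [d] @ z"] w by simp
      then show False using w y by simp
    qed
  qed
  then show ?case using count_list_le_Suc[of w c d] prems(5) by fastforce
qed

text \<open>Cut \<open>u\<close> at the first and the last \<open>b\<close>. The outer pieces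
  contain no \<open>b\<close>, the middle one has a \<open>b\<close> on either side of it; in both
  cases \<open>H\<close> rules out a gap of \<open>c\<close> that avoids \<open>d\<close>. So each
  of the three pieces has at most \<open>length ds + 2\<close> letters \<open>c\<close>.\<close>

lemma centre_count_le:
  assumes arm: "arm c (d # ds)" "m d c = 3" and f: "fcw u" and bc: "b \<noteq> c"
    and H: "\<And>x y z. u = x @ [c] @ y @ [c] @ z \<Longrightarrow> c \<notin> set y \<Longrightarrow> d \<notin> set y \<Longrightarrow>
      b \<in> set y \<and> (b \<notin> set x \<or> b \<notin> set z)"
  shows "count_list u c \<le> 3 * length ds + 6"
proof -
  have part: "count_list w c \<le> length ds + 2"
    if u: "u = p @ w @ q" and b: "b \<notin> set w \<or> b \<in> set p \<and> b \<in> set q" for p w q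
  proof (rule tail_count_le[OF arm])
    show "fcw w" using fcw_factor[of p w q] f u by simp
    fix x y z assume w: "w = x @ [c] @ y @ [c] @ z" "c \<notin> set y"
    show "d \<in> set y"
    proof (rule ccontr)
      assume "d \<notin> set y"
      then have "b \<in> set y \<and> (b \<notin> set (p @ x) \<or> b \<notin> set (z @ q))"
        using H[of "p @ x" y "z @ q"] u w by simp
      then show False using b w by auto
    qed
  qed
  show ?thesis
  proof (cases "b \<in> set u")
    case False
    then show ?thesis using part[of "[]" u "[]"] by simp
  next
    case True
    then obtain x u1 where u: "u = x @ b # u1" "b \<notin> set x" using split_list_first by metis
    show ?thesis
    proof (cases "b \<in> set u1")
      case False
      then show ?thesis using part[of "[]" x "b # u1"] part[of "x @ [b]" u1 "[]"] u bc by simp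
    next
      case True
      then obtain w z where u1: "u1 = w @ b # z" "b \<notin> set z" using split_list_last by metis
      then show ?thesis
        using part[of "[]" x "b # u1"] part[of "x @ [b]" w "b # z"] part[of "x @ b # w @ [b]" z "[]"] u bc
        by simp
    qed
  qed
qed

section \<open>Letters that occur boundedly often\<close>

text \<open>Up to the first \<open>c\<close> in \<open>z\<close>, no letter but \<open>d\<close> is
  linked to \<open>c\<close>. So this gap contains two \<open>d\<close>, and by
  \<open>arm_gap\<close> a \<open>c\<close> between them. If \<open>c\<close> has no third
  neighbour, the lemma is applied with \<open>e = b\<close>.\<close>

lemma gap_inside:
  assumes f: "fcw (c # z @ [b])" and c: "c \<in> set z" and e: "e \<notin> set z \<or> m c e = 2"
    and nbrs: "\<And>r. r \<in> S \<Longrightarrow> m c r \<noteq> 2 \<Longrightarrow> r = c \<or> r = b \<or> r = e \<or> r = d"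
    and b: "b \<notin> set z" and arm: "arm c (d # ds)" and m3: "m c d = 3"
  shows False
proof -
  obtain z1 z2 where z: "z = z1 @ c # z2" "c \<notin> set z1" using split_list_first[OF c] by blast
  have g: "fcw (c # z1 @ [c])"
    using fcw_factor[of "[]" "c # z1 @ [c]" "z2 @ [b]"] f z by simp
  have "r = d" if "r \<in> set z1" "m c r \<noteq> 2" for r
    using that nbrs[of r] fcw_set[OF g] z e b by auto
  then have "2 \<le> count_list z1 d" by (rule gap_count[OF g _ m3])
  then obtain y1 y2 y3 where y: "z1 = y1 @ [d] @ y2 @ [d] @ y3" "d \<notin> set y2"
    using count_list_ge_2_split by metis
  have "fcw (d # y2 @ [d])"
    using fcw_factor[of "c # y1" "d # y2 @ [d]" "y3 @ [c]"] g y by simp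
  then have "c \<in> set y2" using arm_gap arm y by blast
  then show False using y z by simp
qed

lemma arm_count_le_1:
  assumes "arm c (b # as)" "fcw (x @ y @ z)" "c \<notin> set y"
  shows "count_list y b \<le> 1"
proof -
  have "count_list y c = 0" using assms(3) by (rule count_notin)
  then show ?thesis using arm_count_le[OF assms(1) fcw_factor[OF assms(2)]] by simp
qed

text \<open>Otherwise \<open>b\<close> would be the only letter linked to the outer neighbour \<open>a\<close> between two
  consecutive occurrences of \<open>a\<close>.\<close>

lemma outer_once:
  assumes "arm c (b # as)" "length as \<le> 1" and f: "fcw (g @ [b] @ h)" and "b \<notin> set g" "b \<notin> set h"
  shows "set as \<inter> set g = {} \<or> set as \<inter> set h = {}"
proof (rule ccontr)
  assume not: "\<not> ?thesis"
  then obtain a where as: "as = [a]" using assms(2) by (cases as) auto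
  then have "a \<in> set g" "a \<in> set h" using not by auto
  then obtain g1 g2 h1 h2 where gh: "g = g1 @ a # g2" "a \<notin> set g2" "h = h1 @ a # h2" "a \<notin> set h1"
    by (elim split_list_last[elim_format] split_list_first[elim_format] exE conjE)
  have f': "fcw (a # (g2 @ [b] @ h1) @ [a])"
    using fcw_factor[of g1 "a # (g2 @ [b] @ h1) @ [a]" h2] f gh by simp
  have ab: "m b a = 3" "a \<in> S" "b \<in> S" "a \<noteq> b" using assms(1,4) as gh by auto
  have nbrs: "r = a \<or> r = b" if "r \<in> S" "m a r \<noteq> 2" for r using assms(1) as that by auto
  have "2 \<le> count_list (g2 @ [b] @ h1) b"
  proof (rule gap_count[OF f'])
    show "m a b = 3" using ab m_sym[of a b] by simp
    show "r = b" if "r \<in> set (g2 @ [b] @ h1)" "m a r \<noteq> 2" for r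
      using that nbrs[of r] fcw_set[OF f'] gh ab by auto
  qed
  then show False using gh assms(4,5) count_notin[of b g2] count_notin[of b h1] by simp
qed

text \<open>A gap of \<open>c\<close> avoiding \<open>d\<close>, with \<open>b\<close> inside and on
  both sides, is widened to the stretch between the neighbouring occurrences of \<open>b\<close>. By
  \<open>outer_once\<close> the outer neighbour of \<open>b\<close> misses one half of it, and by
  reversal the right one; refuting this configuration is left to \<open>half\<close>.\<close>

lemma bounded_from_halves:
  assumes arm: "arm c (d # ds)" "m d c = 3" "arm c (b # as)" "length as \<le> 1" and bc: "b \<noteq> c"
    and b: "\<And>y. fcw (c # y @ [c]) \<Longrightarrow> c \<notin> set y \<Longrightarrow> d \<notin> set y \<Longrightarrow> b \<in> set y"
    and half: "\<And>x y1 y2 z. fcw (b # x @ [c] @ y1 @ [b] @ y2 @ [c] @ z @ [b]) \<Longrightarrow>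
      b \<notin> set x \<union> set y1 \<union> set y2 \<union> set z \<Longrightarrow> c \<notin> set y1 \<union> set y2 \<Longrightarrow> d \<notin> set y1 \<union> set y2 \<Longrightarrow>
      set as \<inter> set (y2 @ [c] @ z) = {} \<Longrightarrow> False"
    and f: "fcw u"
  shows "count_list u c \<le> 3 * length ds + 6"
proof (rule centre_count_le[OF arm(1,2) f bc])
  fix x y z assume u: "u = x @ [c] @ y @ [c] @ z" and y: "c \<notin> set y" "d \<notin> set y"
  have fy: "fcw (c # y @ [c])" using fcw_factor[of x "c # y @ [c]" z] f u by simp
  have by': "b \<in> set y" using b[OF fy y] .
  then have "count_list y b \<noteq> 0" by (simp add: count_list_0_iff)
  moreover have "count_list y b \<le> 1" using arm_count_le_1[OF arm(3), of "[c]" y "[c]"] fy y by simp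
  ultimately have "count_list y b = 1" by simp
  then obtain y1 y2 where y12: "y = y1 @ [b] @ y2" "b \<notin> set y1" "b \<notin> set y2"
    using count_list_1_split by metis
  have "False" if "b \<in> set x" "b \<in> set z"
  proof -
    obtain x1 x2 where x: "x = x1 @ b # x2" "b \<notin> set x2" using split_list_last[OF \<open>b \<in> set x\<close>] by blast
    obtain z1 z2 where z: "z = z1 @ b # z2" "b \<notin> set z1" using split_list_first[OF \<open>b \<in> set z\<close>] by blast
    note xz = x z
    have F: "fcw (b # x2 @ [c] @ y1 @ [b] @ y2 @ [c] @ z1 @ [b])"
      using fcw_factor[of x1 "b # x2 @ [c] @ y1 @ [b] @ y2 @ [c] @ z1 @ [b]" z2] f u xz y12 by simp
    then have "fcw ((x2 @ [c] @ y1) @ [b] @ (y2 @ [c] @ z1))"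
      using fcw_factor[of "[b]" "(x2 @ [c] @ y1) @ [b] @ (y2 @ [c] @ z1)" "[b]"] by simp
    then have "set as \<inter> set (x2 @ [c] @ y1) = {} \<or> set as \<inter> set (y2 @ [c] @ z1) = {}"
      by (rule outer_once[OF arm(3,4)]) (use xz y12 bc in simp_all)
    then consider "set as \<inter> set (x2 @ [c] @ y1) = {}" | "set as \<inter> set (y2 @ [c] @ z1) = {}"
      by blast
    then show False
    proof cases
      case 1
      have "fcw (b # rev z1 @ [c] @ rev y2 @ [b] @ rev y1 @ [c] @ rev x2 @ [b])"
        using fcw_rev[OF F] by simp
      then show ?thesis using half[of "rev z1" "rev y2" "rev y1" "rev x2"] 1 xz y y12 by auto
    next
      case 2
      show ?thesis using half[OF F] 2 xz y y12 by auto
    qed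
  qed
  then show "b \<in> set y \<and> (b \<notin> set x \<or> b \<notin> set z)" using by' by blast
qed

text \<open>A gap of \<open>c\<close> avoiding \<open>d\<close> contains both \<open>b\<close> and
  the leaf \<open>e\<close>: were one missing, the other would have to occur twice, which
  \<open>arm_count_le_1\<close> forbids. The contradiction then comes from counting the
  \<open>c\<close> between two successive \<open>e\<close>.\<close>

lemma bounded_branch:
  assumes arms: "arm c (d # ds)" "arm c (b # as)" "length as \<le> 1" "arm c [e]"
    and m3: "m c d = 3" "m c b = 3" "m c e = 3" and c: "c \<in> S" "b \<noteq> e" "b \<noteq> d" "e \<noteq> d"
    and nbrs: "\<And>r. r \<in> S \<Longrightarrow> m c r \<noteq> 2 \<Longrightarrow> r = c \<or> r = b \<or> r = e \<or> r = d"
    and f: "fcw u"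
  shows "count_list u c \<le> 3 * length ds + 6"
proof -
  have S: "b \<in> S" "d \<in> S" "e \<in> S" using arms by auto
  have ne: "b \<noteq> c" "e \<noteq> c" "d \<noteq> c" using m3 m_self[OF c(1)] by auto
  have m3': "m d c = 3" "m b c = 3" "m e c = 3" using m3 m_sym[OF c(1)] S by auto
  have both: "p \<in> set y" if y: "fcw (c # y @ [c])" "c \<notin> set y" "d \<notin> set y" and p: "p = b \<or> p = e" for y p
  proof (rule ccontr)
    assume "p \<notin> set y"
    define q where "q = (if p = b then e else b)"
    have q: "r = q" if "r \<in> set y" "m c r \<noteq> 2" for r
      using nbrs[of r] that y fcw_set[OF y(1)] p \<open>p \<notin> set y\<close> unfolding q_def by auto
    have "2 \<le> count_list y q"
      by (rule gap_count[OF y(1)]) (use q m3 in \<open>auto simp: q_def\<close>)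
    moreover have "count_list y q \<le> 1"
      using arm_count_le_1[OF arms(2), of "[c]" y "[c]"] arm_count_le_1[OF arms(4), of "[c]" y "[c]"] y
      by (auto simp: q_def)
    ultimately show False by simp
  qed
  show ?thesis
  proof (rule bounded_from_halves[OF arms(1) m3'(1) arms(2,3) ne(1) _ _ f])
    show "b \<in> set y" if "fcw (c # y @ [c])" "c \<notin> set y" "d \<notin> set y" for y
      using both that by blast
    fix x y1 y2 z
    assume F: "fcw (b # x @ [c] @ y1 @ [b] @ y2 @ [c] @ z @ [b])"
      and b: "b \<notin> set x \<union> set y1 \<union> set y2 \<union> set z" and c': "c \<notin> set y1 \<union> set y2"
      and d: "d \<notin> set y1 \<union> set y2" and a: "set as \<inter> set (y2 @ [c] @ z) = {}"
    let ?y = "y1 @ [b] @ y2"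
    have fy: "fcw (c # ?y @ [c])"
      using fcw_factor[of "b # x" "c # ?y @ [c]" "z @ [b]"] F by simp
    have "e \<in> set ?y" by (rule both[OF fy]) (use c' d ne c in simp_all)
    from split_list_last[OF this] obtain p1 p2 where p: "?y = p1 @ e # p2" "e \<notin> set p2" by blast
    have fg: "fcw (b # (y2 @ [c] @ z) @ [b])"
      using fcw_factor[of "b # x @ [c] @ y1" "b # (y2 @ [c] @ z) @ [b]" "[]"] F by simp
    \<comment> \<open>With the outer neighbour absent, only \<open>c\<close> is linked to
      \<open>b\<close> here, so this gap of \<open>b\<close> holds a second \<open>c\<close>, which
      must lie in \<open>z\<close>.\<close>
    have "2 \<le> count_list (y2 @ [c] @ z) c"
    proof (rule gap_count[OF fg _ m3'(2)])
      fix r assume r: "r \<in> set (y2 @ [c] @ z)" "m b r \<noteq> 2"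
      then have "r \<notin> set as" "r \<in> S" "r \<noteq> b" using a b fcw_set[OF fg] ne by auto
      then show "r = c" using arms(2) r by (auto dest: in_set_takeD)
    qed
    then have cz: "c \<in> set z" using c' ne count_notin[of c y2] count_notin[of c z] by (cases "c \<in> set z") simp_all
    have ez: "e \<in> set z"
    proof (rule ccontr)
      assume "e \<notin> set z"
      moreover have "fcw (c # z @ [b])"
        using fcw_factor[of "b # x @ [c] @ y1 @ [b] @ y2" "c # z @ [b]" "[]"] F by simp
      ultimately show False using gap_inside[of c z b e d ds] cz nbrs b arms(1) m3(1) by blast
    qed
    from split_list_first[OF this] obtain q1 q2 where q: "z = q1 @ e # q2" "e \<notin> set q1" by blast
    \<comment> \<open>The same lemma with the roles of \<open>b\<close> and \<open>e\<close>
      exchanged: \<open>q1\<close> stops before the first \<open>e\<close> and contains no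
      \<open>b\<close>.\<close>
    have "c \<notin> set q1"
    proof
      assume "c \<in> set q1"
      moreover have "fcw (c # q1 @ [e])"
        using fcw_factor[of "b # x @ [c] @ y1 @ [b] @ y2" "c # q1 @ [e]" "q2 @ [b]"] F q by simp
      ultimately show False using gap_inside[of c q1 e b d ds] nbrs q b arms(1) m3(1) by auto
    qed
    have "c \<notin> set p2"
    proof -
      have "set p2 \<subseteq> set ?y" unfolding p(1) by auto
      then show ?thesis using c' ne by auto
    qed
    have "b # x @ [c] @ y1 @ [b] @ y2 @ [c] @ z @ [b] = b # x @ [c] @ ?y @ [c] @ z @ [b]" by simp
    also have "\<dots> = (b # x @ [c] @ p1) @ (e # (p2 @ [c] @ q1) @ [e]) @ (q2 @ [b])"
      unfolding p(1) q(1) by simp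
    finally have eq: "b # x @ [c] @ y1 @ [b] @ y2 @ [c] @ z @ [b] =
        (b # x @ [c] @ p1) @ (e # (p2 @ [c] @ q1) @ [e]) @ (q2 @ [b])" .
    have fe: "fcw (e # (p2 @ [c] @ q1) @ [e])" using F unfolding eq by (rule fcw_factor)
    \<comment> \<open>Only one \<open>c\<close> separates these two occurrences of the leaf
      \<open>e\<close>, while the label 3 demands two.\<close>
    have "2 \<le> count_list (p2 @ [c] @ q1) c"
    proof (rule gap_count[OF fe _ m3'(3)])
      fix r assume r: "r \<in> set (p2 @ [c] @ q1)" "m e r \<noteq> 2"
      then have "r \<noteq> e" "r \<in> S" using p q ne fcw_set[OF fe] by auto
      then show "r = c" using arms(4) r by auto
    qed
    then show False
      using \<open>c \<notin> set p2\<close> \<open>c \<notin> set q1\<close> count_notin[of c p2] count_notin[of c q1] by simp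
  qed
qed

lemma only_neighbour_split:
  assumes "y = y1 @ [b] @ y2" "b \<notin> set y1" "b \<notin> set y2" "set y \<subseteq> S" "c \<notin> set y" "d \<notin> set y"
    and nbrs: "\<And>r. r \<in> S \<Longrightarrow> m c r \<noteq> 2 \<Longrightarrow> r = c \<or> r = b \<or> r = d"
  shows "nb c y1 = []" "nb c y2 = []"
proof -
  have "m c r = 2" if "r \<in> set y1 \<union> set y2" for r
    using nbrs[of r] that assms(1-6) by auto
  then show "nb c y1 = []" "nb c y2 = []" by (simp_all add: filter_empty_conv)
qed

text \<open>In the widened stretch, \<open>c y1 b y2 c z b\<close> is an unobstructed chain of
  length 4: \<open>z\<close> contains no \<open>c\<close> by \<open>gap_inside\<close>, and the
  outer neighbour of \<open>b\<close> is absent on the right.\<close>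

lemma bounded_4:
  assumes arms: "arm c (d # ds)" "arm c (b # as)" "length as \<le> 1"
    and m: "m c d = 3" "m c b = 4" and c: "c \<in> S" "b \<noteq> d"
    and nbrs: "\<And>r. r \<in> S \<Longrightarrow> m c r \<noteq> 2 \<Longrightarrow> r = c \<or> r = b \<or> r = d"
    and f: "fcw u"
  shows "count_list u c \<le> 3 * length ds + 6"
proof -
  have S: "b \<in> S" "d \<in> S" using arms by auto
  have ne: "b \<noteq> c" "d \<noteq> c" using m m_self[OF c(1)] by auto
  have m': "m d c = 3" using m m_sym[OF c(1)] S by auto
  show ?thesis
  proof (rule bounded_from_halves[OF arms(1) m' arms(2,3) ne(1) _ _ f])
    fix y assume y: "fcw (c # y @ [c])" "c \<notin> set y" "d \<notin> set y"
    obtain r where "r \<in> set y" "m c r \<noteq> 2"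
      using gap_nonempty[OF y(1)] by (auto simp: filter_empty_conv)
    then show "b \<in> set y" using nbrs[of r] y fcw_set[OF y(1)] by auto
  next
    fix x y1 y2 z
    assume F: "fcw (b # x @ [c] @ y1 @ [b] @ y2 @ [c] @ z @ [b])"
      and b: "b \<notin> set x \<union> set y1 \<union> set y2 \<union> set z" and c': "c \<notin> set y1 \<union> set y2"
      and d: "d \<notin> set y1 \<union> set y2" and a: "set as \<inter> set (y2 @ [c] @ z) = {}"
    have FS: "set x \<subseteq> S" "set y1 \<subseteq> S" "set y2 \<subseteq> S" "set z \<subseteq> S" using fcw_set[OF F] by auto
    have "fcw (c # z @ [b])"
      using fcw_factor[of "b # x @ [c] @ y1 @ [b] @ y2" "c # z @ [b]" "[]"] F by simp
    then have cz: "c \<notin> set z" using gap_inside[of c z b b d ds] nbrs b arms(1) m(1) by blast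
    have n: "nb c y1 = []" "nb c y2 = []"
      by (rule only_neighbour_split[OF refl _ _ _ _ _ nbrs]; use b c' d FS S ne c(2) in auto)+
    have nb: "m b r = 2" if "r \<in> set y2 \<union> set z" for r
    proof -
      have r: "r \<in> S" "r \<notin> set as" "r \<noteq> b" "r \<noteq> c" using that a b c' cz FS by auto
      then have "r \<notin> set (take 1 as)" by (meson in_set_takeD)
      then show ?thesis using r arms(2) by auto
    qed
    have "fcw (c # y1 @ [b] @ y2 @ [c] @ z @ [b])"
      using fcw_factor[of "b # x" "c # y1 @ [b] @ y2 @ [c] @ z @ [b]" "[]"] F by simp
    then show False using chain_4[of c y1 b y2 z] n nb m(2) by (simp add: filter_empty_conv)
  qed
qed

text \<open>Now \<open>b\<close> is a leaf, so nothing obstructs either half and the chain runs from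
  \<open>b\<close> to \<open>b\<close> with five letters.\<close>

lemma bounded_5:
  assumes arms: "arm c (d # ds)" "arm c [b]"
    and m: "m c d = 3" "m c b = 5" and c: "c \<in> S" "b \<noteq> d"
    and nbrs: "\<And>r. r \<in> S \<Longrightarrow> m c r \<noteq> 2 \<Longrightarrow> r = c \<or> r = b \<or> r = d"
    and f: "fcw u"
  shows "count_list u c \<le> 3 * length ds + 6"
proof -
  have S: "b \<in> S" "d \<in> S" using arms by auto
  have ne: "b \<noteq> c" "d \<noteq> c" using m m_self[OF c(1)] by auto
  have m': "m d c = 3" "m b c = 5" using m m_sym[OF c(1)] S by auto
  show ?thesis
  proof (rule bounded_from_halves[OF arms(1) m'(1) arms(2) _ ne(1) _ _ f])
    fix y assume y: "fcw (c # y @ [c])" "c \<notin> set y" "d \<notin> set y"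
    obtain r where "r \<in> set y" "m c r \<noteq> 2"
      using gap_nonempty[OF y(1)] by (auto simp: filter_empty_conv)
    then show "b \<in> set y" using nbrs[of r] y fcw_set[OF y(1)] by auto
  next
    fix x y1 y2 z
    assume F: "fcw (b # x @ [c] @ y1 @ [b] @ y2 @ [c] @ z @ [b])"
      and b: "b \<notin> set x \<union> set y1 \<union> set y2 \<union> set z" and c': "c \<notin> set y1 \<union> set y2"
      and d: "d \<notin> set y1 \<union> set y2"
    have FS: "set x \<subseteq> S" "set y1 \<subseteq> S" "set y2 \<subseteq> S" "set z \<subseteq> S" using fcw_set[OF F] by auto
    have "fcw (c # z @ [b])"
      using fcw_factor[of "b # x @ [c] @ y1 @ [b] @ y2" "c # z @ [b]" "[]"] F by simp
    then have cz: "c \<notin> set z" using gap_inside[of c z b b d ds] nbrs b arms(1) m(1) by blast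
    have "fcw (b # x @ [c])"
      using fcw_factor[of "[]" "b # x @ [c]" "y1 @ [b] @ y2 @ [c] @ z @ [b]"] F by simp
    then have "fcw (c # rev x @ [b])" using fcw_rev[of "b # x @ [c]"] by simp
    then have cx: "c \<notin> set x" using gap_inside[of c "rev x" b b d ds] nbrs b arms(1) m(1) by auto
    have n: "nb c y1 = []" "nb c y2 = []"
      by (rule only_neighbour_split[OF refl _ _ _ _ _ nbrs]; use b c' d FS S ne c(2) in auto)+
    have nb: "m b r = 2" if "r \<in> set x \<union> set y1 \<union> set y2 \<union> set z" for r
      using that arms(2) b c' cz cx FS by auto
    show False using chain_5[of b x c y1 y2 z] F n nb m'(2) by (simp add: filter_empty_conv)
  qed simp
qed

lemma bounded_end:
  assumes "arm c (d # ds)" "m c d = 3" "c \<in> S"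
    and nbrs: "\<And>r. r \<in> S \<Longrightarrow> m c r \<noteq> 2 \<Longrightarrow> r = c \<or> r = d" and f: "fcw u"
  shows "count_list u c \<le> length ds + 2"
proof (rule tail_count_le[OF assms(1) _ f])
  show "m d c = 3" using assms m_sym[of d c] by auto
  fix x y z assume u: "u = x @ [c] @ y @ [c] @ z" and c: "c \<notin> set y"
  have fy: "fcw (c # y @ [c])" using fcw_factor[of x "c # y @ [c]" z] f u by simp
  obtain r where "r \<in> set y" "m c r \<noteq> 2"
    using gap_nonempty[OF fy] by (auto simp: filter_empty_conv)
  then show "d \<in> set y" using nbrs[of r] c fcw_set[OF fy] by auto
qed

lemma bounded_isolated:
  assumes nbrs: "\<And>r. r \<in> S \<Longrightarrow> m c r \<noteq> 2 \<Longrightarrow> r = c" and f: "fcw u"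
  shows "count_list u c \<le> 1"
proof (rule ccontr)
  assume "\<not> count_list u c \<le> 1"
  then obtain x y z where u: "u = x @ [c] @ y @ [c] @ z" "c \<notin> set y"
    using count_list_ge_2_split[of u c] by auto
  have fy: "fcw (c # y @ [c])" using fcw_factor[of x "c # y @ [c]" z] f u by simp
  obtain r where "r \<in> set y" "m c r \<noteq> 2"
    using gap_nonempty[OF fy] by (auto simp: filter_empty_conv)
  then show False using nbrs[of r] u fcw_set[OF fy] by auto
qed

lemma ceq_filter:
  assumes "\<And>a b. a \<in> set u \<Longrightarrow> P a \<Longrightarrow> b \<in> set u \<Longrightarrow> \<not> P b \<Longrightarrow> m a b = 2" "set u \<subseteq> S"
  shows "ceq u (filter P u @ filter (\<lambda>x. \<not> P x) u)"
  using assms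
proof (induction u)
  case (Cons a u)
  have IH: "ceq (a # u) (a # (filter P u @ filter (\<lambda>x. \<not> P x) u))"
    using Cons by (intro ceq_Cons Cons.IH) auto
  show ?case
  proof (cases "P a")
    case False
    have "m b a = 2" if "b \<in> set u" "P b" for b using Cons.prems(1)[of b a] that False by simp
    then have "m a b = 2" if "b \<in> set u" "P b" for b using that m_sym[of a b] Cons.prems(2) by auto
    then have "ceq ([] @ [a] @ filter P u @ filter (\<lambda>x. \<not> P x) u) ([] @ filter P u @ [a] @ filter (\<lambda>x. \<not> P x) u)"
      using Cons.prems(2) by (intro ceq_block) auto
    then show ?thesis using IH ceq_trans False by simp
  qed (use IH in simp)
qed simp

text \<open>The letters \<open>s\<close> and \<open>t\<close> commute with all others and can be
  collected in front. The word they form has no double letter, so it alternates, and it is shorter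
  than \<open>k\<close>.\<close>

lemma bounded_dihedral:
  assumes m: "m s t = enat k" "3 \<le> k" and S: "s \<in> S" "t \<in> S"
    and nbrs: "\<And>r. r \<in> S \<Longrightarrow> m s r \<noteq> 2 \<or> m t r \<noteq> 2 \<Longrightarrow> r = s \<or> r = t" and f: "fcw u"
  shows "count_list u s \<le> k"
proof -
  let ?P = "\<lambda>x. x = s \<or> x = t"
  let ?q = "filter ?P u" and ?r = "filter (\<lambda>x. \<not> ?P x) u"
  have "ceq u (?q @ ?r)"
    using nbrs fcw_set[OF f] by (intro ceq_filter) auto
  then have fq: "fcw ?q" using fcw_factor[of "[]" ?q ?r] fcw_ceq[OF f] by simp
  have "s \<noteq> t" using m m_self[OF S(1)] by (auto simp: one_enat_def)
  have mts: "m t s = enat k" using m m_sym[OF S] by simp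
  have "length ?q < k"
  proof (cases "?q = []")
    case False
    define a where "a = hd ?q"
    define b where "b = (if a = s then t else s)"
    have "a \<in> set ?q" using hd_in_set[OF False] by (simp only: a_def)
    then have ab: "a = s \<or> a = t" "a \<noteq> b" "{a, b} = {s, t}" "m a b = enat k"
      using \<open>s \<noteq> t\<close> m mts by (auto simp: b_def)
    have "set ?q \<subseteq> {a, b}" unfolding ab by auto
    then consider "?q = alt a b (length ?q)" | x c y where "?q = x @ [c, c] @ y"
      using alternating_or_double[of ?q a b] False ab a_def by metis
    then show ?thesis
    proof cases
      case 1
      show ?thesis
      proof (rule ccontr)
        assume "\<not> length ?q < k"
        then have "length ?q = k + (length ?q - k)" by simp
        then have "\<exists>z. alt a b (length ?q) = alt a b k @ z" using alt_append by metis
        then obtain z where "?q = alt a b k @ z" using 1 by metis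
        then have "ceq ?q ([] @ alt a b k @ z)" by simp
        then show False using fcw_no_braid[OF fq ab(4) m(2)] by blast
      qed
    next
      case 2
      then have "ceq ?q (x @ [c, c] @ y)" by simp
      then show ?thesis using fcw_no_double[OF fq] by blast
    qed
  qed (use m in simp)
  moreover have "count_list u s = count_list ?q s" by (induction u) auto
  ultimately show ?thesis using count_le_length[of ?q s] by linarith
qed

text \<open>Stated for one letter, so that each component of a reducible system can be treated on
  its own.\<close>

definition bounded_letter :: "'a \<Rightarrow> bool" where
  "bounded_letter s \<longleftrightarrow> (\<exists>N. \<forall>u. fcw u \<longrightarrow> count_list u s \<le> N)"

lemma bounded_letterI: "(\<And>u. fcw u \<Longrightarrow> count_list u s \<le> N) \<Longrightarrow> bounded_letter s"
  unfolding bounded_letter_def by blast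

lemma bounded_letter_arm:
  "arm c ds \<Longrightarrow> bounded_letter c \<Longrightarrow> d \<in> set ds \<Longrightarrow> bounded_letter d"
proof (induction ds arbitrary: c)
  case (Cons e es)
  obtain N where "\<And>u. fcw u \<Longrightarrow> count_list u c \<le> N"
    using Cons.prems(2) unfolding bounded_letter_def by blast
  then have "count_list u e \<le> Suc N" if "fcw u" for u
    using arm_count_le[OF Cons.prems(1) that] that by (meson Suc_le_mono order_trans)
  then have "bounded_letter e" by (rule bounded_letterI)
  then show ?case using Cons by auto
qed simp

lemma FC_finite_bounded_letters:
  assumes "\<And>s. s \<in> S \<Longrightarrow> bounded_letter s"
  shows "FC_finite S m"
proof -
  obtain N where N: "\<And>s u. s \<in> S \<Longrightarrow> fcw u \<Longrightarrow> count_list u s \<le> N s"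
    using assms unfolding bounded_letter_def by metis
  have "length u \<le> (\<Sum>s\<in>S. N s)" if "fcw u" for u
  proof -
    have "length u = (\<Sum>s\<in>S. count_list u s)"
      using sum_count_set[of u S] fcw_set[OF that] finite_S by simp
    also have "\<dots> \<le> (\<Sum>s\<in>S. N s)" using N that by (intro sum_mono) auto
    finally show ?thesis .
  qed
  then show ?thesis by (rule FC_finite_bounded)
qed

end

section \<open>Periodic words avoiding braids\<close>

fun run :: "('a \<Rightarrow> 'q \<Rightarrow> 'q option) \<Rightarrow> 'a list \<Rightarrow> 'q \<Rightarrow> 'q option" where
  "run \<delta> [] q = Some q"
| "run \<delta> (a # u) q = Option.bind (\<delta> a q) (run \<delta> u)"

lemma run_append: "run \<delta> (u @ v) q = Option.bind (run \<delta> u q) (run \<delta> v)"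
proof (induction u arbitrary: q)
  case (Cons a u)
  then show ?case by (cases "\<delta> a q") auto
qed simp

lemma run_append_Some:
  "run \<delta> (u @ v) q = Some q'' \<longleftrightarrow> (\<exists>q'. run \<delta> u q = Some q' \<and> run \<delta> v q' = Some q'')"
  by (auto simp: run_append bind_eq_Some_conv)

text \<open>The state is the weight of the letters read since the last \<open>s\<close>; an
  \<open>s\<close> that comes too early kills the run.\<close>

definition gap_step :: "'a \<Rightarrow> ('a \<Rightarrow> nat) \<Rightarrow> 'a \<Rightarrow> nat \<Rightarrow> nat option" where
  "gap_step s \<omega> a n = (if a = s then (if 2 \<le> n then Some 0 else None) else Some (n + \<omega> a))"

abbreviation weight :: "('a \<Rightarrow> nat) \<Rightarrow> 'a list \<Rightarrow> nat" where
  "weight \<omega> u \<equiv> sum_list (map \<omega> u)"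

lemma run_gap_step: "s \<notin> set u \<Longrightarrow> run (gap_step s \<omega>) u n = Some (n + weight \<omega> u)"
  by (induction u arbitrary: n) (auto simp: gap_step_def)

text \<open>The state is (whether the last letter of \<open>{s, t}\<close> was \<open>s\<close>, whether \<open>x\<close>
  has occurred since the last \<open>s\<close>, whether \<open>y\<close> has occurred since the last \<open>t\<close>, a bound for the
  length of the alternating chain of \<open>s\<close> and \<open>t\<close>, unseparated by \<open>x\<close> and \<open>y\<close>, that has just been
  read).\<close>

definition chain_step :: "nat \<Rightarrow> 'a \<Rightarrow> 'a \<Rightarrow> 'a \<Rightarrow> 'a \<Rightarrow> 'a \<Rightarrow>
    bool \<times> bool \<times> bool \<times> nat \<Rightarrow> (bool \<times> bool \<times> bool \<times> nat) option" where
  "chain_step M s t x y a = (\<lambda>(l, p, q, n).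
    if a = s then
      (if \<not> l \<and> (if p then 2 else Suc n) < M then Some (True, False, q, if p then 2 else Suc n) else None)
    else if a = t then
      (if l \<and> (if q then 2 else Suc n) < M then Some (False, p, False, if q then 2 else Suc n) else None)
    else if a = x then Some (l, True, q, n)
    else if a = y then Some (l, p, True, n)
    else Some (l, p, q, n))"

text \<open>When \<open>x\<close> lies between two successive \<open>s\<close>, the chain ending in
  the new \<open>s\<close> still includes the \<open>t\<close> between them, which is why the
  counter restarts at 2. Inside an alternating block a restart can happen only at the first two
  letters, where 2 is large enough; so the counter dominates the length of the block from any
  initial state.\<close>

lemma run_chain_step_alt:
  assumes "s \<noteq> t" "run (chain_step M s t x y) (alt s t (Suc j)) q0 = Some (l, p, q, n)"
  shows "Suc j \<le> n \<and> n < M \<and> \<not> p \<and> (0 < j \<longrightarrow> \<not> q)"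
  using assms(2)
proof (induction j arbitrary: l p q n)
  case 0
  then show ?case by (cases q0) (auto simp: chain_step_def split: if_splits)
next
  case (Suc j)
  obtain l' p' q' n' where 1: "run (chain_step M s t x y) (alt s t (Suc j)) q0 = Some (l', p', q', n')"
    and 2: "run (chain_step M s t x y) [if even (Suc j) then s else t] (l', p', q', n') = Some (l, p, q, n)"
    using Suc.prems unfolding alt_snoc[of s t "Suc j"] run_append_Some by (metis prod_cases4)
  show ?case using Suc.IH[OF 1] 2 assms(1) by (cases "even j") (auto simp: chain_step_def split: if_splits)
qed

lemma run_chain_step_alt':
  assumes "s \<noteq> t" "run (chain_step M s t x y) (alt t s (Suc j)) q0 = Some (l, p, q, n)"
  shows "Suc j \<le> n \<and> n < M \<and> \<not> q \<and> (0 < j \<longrightarrow> \<not> p)"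
  using assms(2)
proof (induction j arbitrary: l p q n)
  case 0
  then show ?case using assms(1) by (cases q0) (auto simp: chain_step_def split: if_splits)
next
  case (Suc j)
  obtain l' p' q' n' where 1: "run (chain_step M s t x y) (alt t s (Suc j)) q0 = Some (l', p', q', n')"
    and 2: "run (chain_step M s t x y) [if even (Suc j) then t else s] (l', p', q', n') = Some (l, p, q, n)"
    using Suc.prems unfolding alt_snoc[of t s "Suc j"] run_append_Some by (metis prod_cases4)
  show ?case using Suc.IH[OF 1] 2 assms(1) by (cases "even j") (auto simp: chain_step_def split: if_splits)
qed

context coxeter
begin

text \<open>The moves may be mixed in any order, so the closure conditions of
  \<open>CFC_infinite\<close> hold by construction.\<close>

inductive cyc :: "'a list \<Rightarrow> 'a list \<Rightarrow> bool" for c where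
  cyc_power: "cyc c (concat (replicate k c))"
| cyc_move: "cyc c u \<Longrightarrow> commutation_move S m u v \<Longrightarrow> cyc c v"
| cyc_rotate: "cyc c u \<Longrightarrow> cyc c (rotate1 u)"

lemma cyc_set: "cyc c u \<Longrightarrow> set u \<subseteq> set c"
  by (induction rule: cyc.induct) (auto simp: commutation_move_def)

definition avoids :: "'a list \<Rightarrow> 'a list \<Rightarrow> bool" where
  "avoids c f \<longleftrightarrow> (\<forall>x y. \<not> cyc c (x @ f @ y))"

lemma avoids_factor: "avoids c f \<Longrightarrow> avoids c (x @ f @ y)"
  unfolding avoids_def by (metis append.assoc)

lemma avoids_alt:
  assumes "avoids c (alt s t n)" "n \<le> k"
  shows "avoids c (alt s t k)"
proof -
  obtain j where "k = n + j" using assms(2) le_Suc_ex by blast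
  then show ?thesis using avoids_factor[OF assms(1), of "[]"] alt_append[of s t n j] by simp
qed

text \<open>The invariant is a loop, a state that the word maps to itself. Commutations leave the
  map unchanged; a cyclic shift moves the loop to the state after the first letter.\<close>

lemma cyc_run:
  assumes comm: "\<And>s t q. s \<in> S \<Longrightarrow> t \<in> S \<Longrightarrow> m s t = 2 \<Longrightarrow> Option.bind (\<delta> s q) (\<delta> t) = Option.bind (\<delta> t q) (\<delta> s)"
    and c: "run \<delta> c q = Some q" and u: "cyc c u"
  shows "\<exists>q. run \<delta> u q = Some q"
  using u
proof induction
  case (cyc_power k)
  have "run \<delta> (concat (replicate k c)) q = Some q"
    using c by (induction k) (auto simp: run_append)
  then show ?case by blast
next
  case (cyc_move u v)
  then obtain x y s t where st: "s \<in> S" "t \<in> S" "m s t = 2" "u = x @ [s, t] @ y" "v = x @ [t, s] @ y"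
    unfolding commutation_move_def by blast
  have "run \<delta> [a] = \<delta> a" for a
  proof
    show "run \<delta> [a] q = \<delta> a q" for q by (cases "\<delta> a q") simp_all
  qed
  then have "run \<delta> [s, t] = run \<delta> [t, s]" using comm[OF st(1-3)] by (intro ext) simp
  then have "run \<delta> ([t, s] @ y) = run \<delta> ([s, t] @ y)" by (intro ext) (simp only: run_append)
  then have "run \<delta> v = run \<delta> u" unfolding st(4,5) by (intro ext) (simp only: run_append)
  then show ?case using cyc_move by simp
next
  case (cyc_rotate u)
  then obtain q where q: "run \<delta> u q = Some q" by blast
  show ?case
  proof (cases u)
    case (Cons a v)
    then obtain q' where "\<delta> a q = Some q'" "run \<delta> v q' = Some q"
      using q by (auto simp: bind_eq_Some_conv)
    then have "run \<delta> (rotate1 u) q' = Some q'" using Cons by (simp add: run_append)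
    then show ?thesis by blast
  qed simp
qed

lemma avoids_run:
  assumes "\<And>s t q. s \<in> S \<Longrightarrow> t \<in> S \<Longrightarrow> m s t = 2 \<Longrightarrow> Option.bind (\<delta> s q) (\<delta> t) = Option.bind (\<delta> t q) (\<delta> s)"
    and "run \<delta> c q = Some q" and "\<And>q. run \<delta> f q = None"
  shows "avoids c f"
  unfolding avoids_def
proof (intro allI notI)
  fix x y assume "cyc c (x @ f @ y)"
  then obtain q where "run \<delta> (x @ f @ y) q = Some q" using cyc_run[OF assms(1,2)] by blast
  then show False using assms(3) by (auto simp: run_append_Some)
qed

lemma CFC_infinite_word:
  assumes c: "c \<noteq> []" "set c \<subseteq> S" and double: "\<And>s. s \<in> set c \<Longrightarrow> avoids c [s, s]"
    and braid: "\<And>s t k. s \<in> set c \<Longrightarrow> t \<in> set c \<Longrightarrow> s \<noteq> t \<Longrightarrow> m s t = enat k \<Longrightarrow> 3 \<le> k \<Longrightarrow> avoids c (alt s t k)"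
  shows "\<not> CFC_finite S m"
proof (rule CFC_infinite[of "cyc c"])
  show "cyc c u \<Longrightarrow> set u \<subseteq> S" for u using cyc_set c by blast
  show "\<not> cyc c (x @ [s, s] @ y)" for x s y
    using double[of s] cyc_set[of c "x @ [s, s] @ y"] unfolding avoids_def by auto
  show "\<not> cyc c (x @ alt s t k @ y)" if k: "m s t = enat k" "3 \<le> k" for x s t k y
  proof
    assume cy: "cyc c (x @ alt s t k @ y)"
    have "s \<in> set (alt s t k)" "t \<in> set (alt s t k)"
      using k(2) by (cases k; cases "k - 1"; simp)+
    then have "s \<in> set c" "t \<in> set c" using cyc_set[OF cy] by auto
    moreover have "s \<noteq> t" using k m_self[of s] \<open>s \<in> set c\<close> c by (auto simp: one_enat_def)
    ultimately show False using braid k cy unfolding avoids_def by blast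
  qed
  show "\<exists>u. cyc c u \<and> n \<le> length u" for n
  proof (intro exI conjI)
    show "cyc c (concat (replicate n c))" by (rule cyc_power)
    show "n \<le> length (concat (replicate n c))" using c(1)
      by (induction n) (auto simp: Suc_le_eq neq_Nil_conv)
  qed
qed (auto intro: cyc.intros)

text \<open>Calibrated to the threshold 2 of \<open>gap_step\<close>: a gap has weight below 2 iff
  it holds no linked letter or a single \<open>t\<close>. For \<open>t = s\<close> a single linked
  letter suffices.\<close>

definition wt :: "'a \<Rightarrow> 'a \<Rightarrow> 'a \<Rightarrow> nat" where
  "wt s t a = (if m s a = 2 then 0 else if a = t then 1 else 2)"

text \<open>\<open>spread c s t\<close> holds if in the periodic word \<open>c c c \<dots>\<close> the linked letters between consecutive
  occurrences of \<open>s\<close> are neither none nor a single \<open>t\<close>.\<close>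

definition spread :: "'a list \<Rightarrow> 'a \<Rightarrow> 'a \<Rightarrow> bool" where
  "spread c s t \<longleftrightarrow> (\<exists>n. run (gap_step s (wt s t)) c n = Some n)"

lemma gap_step_comm:
  assumes "a \<in> S" "b \<in> S" "m a b = 2"
  shows "Option.bind (gap_step s (wt s t) a n) (gap_step s (wt s t) b)
    = Option.bind (gap_step s (wt s t) b n) (gap_step s (wt s t) a)"
proof -
  have "m b a = 2" using assms m_sym by metis
  then show ?thesis using assms m_self[of a] by (auto simp: gap_step_def wt_def one_enat_def numeral_eq_enat)
qed

lemma spread_avoids:
  assumes "spread c s t"
  shows "avoids c [s, s]" "s \<noteq> t \<Longrightarrow> avoids c [s, t, s]"
proof -
  obtain n where n: "run (gap_step s (wt s t)) c n = Some n" using assms by (auto simp: spread_def)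
  show "avoids c [s, s]"
    by (rule avoids_run[OF gap_step_comm n]) (auto simp: gap_step_def)
  show "avoids c [s, t, s]" if "s \<noteq> t"
    by (rule avoids_run[OF gap_step_comm n]) (use that in \<open>auto simp: gap_step_def wt_def\<close>)
qed

text \<open>A braid of length at least 4 contains both \<open>s t s\<close> and
  \<open>t s t\<close>, so excluding either is enough; for the label 3 it has to be
  \<open>s t s\<close>. The third alternative is the entry point for chain automata.\<close>

lemma CFC_infinite_spread:
  assumes c: "c \<noteq> []" "set c \<subseteq> S" and double: "\<And>s. s \<in> set c \<Longrightarrow> spread c s s"
    and pair: "\<And>s t k. s \<in> set c \<Longrightarrow> t \<in> set c \<Longrightarrow> s \<noteq> t \<Longrightarrow> m s t = enat k \<Longrightarrow> 3 \<le> k \<Longrightarrow>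
      spread c s t \<or> (k \<noteq> 3 \<and> spread c t s) \<or> avoids c (alt s t k)"
  shows "\<not> CFC_finite S m"
proof (rule CFC_infinite_word[OF c])
  show "avoids c [s, s]" if "s \<in> set c" for s using spread_avoids double that by blast
  show "avoids c (alt s t k)"
    if st: "s \<in> set c" "t \<in> set c" "s \<noteq> t" "m s t = enat k" "3 \<le> k" for s t k
    using pair[OF st]
  proof (elim disjE conjE)
    assume "spread c s t"
    then have "avoids c (alt s t 3)" using spread_avoids(2) st(3) by (simp add: numeral_3_eq_3)
    then show ?thesis using avoids_alt st(5) by blast
  next
    assume k: "k \<noteq> 3" and "spread c t s"
    then have "avoids c [t, s, t]" using spread_avoids(2) st(3) by blast
    then have "avoids c ([s] @ [t, s, t] @ [])" by (rule avoids_factor)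
    then have "avoids c (alt s t 4)" by (simp add: numeral_eq_Suc)
    moreover have "4 \<le> k" using st(5) k by simp
    ultimately show ?thesis by (rule avoids_alt)
  qed
qed

text \<open>The loop starts with the weight behind the last \<open>s\<close> of the period, which is
  what an open gap carries into the next period.\<close>

lemma spread_once:
  assumes "s \<notin> set x" "s \<notin> set y" "2 \<le> weight (wt s t) y + weight (wt s t) x"
  shows "spread (x @ [s] @ y) s t"
  unfolding spread_def
  by (rule exI[of _ "weight (wt s t) y"]) (use assms in \<open>simp add: run_append run_gap_step gap_step_def\<close>)

lemma spread_twice:
  assumes "s \<notin> set x" "s \<notin> set y" "s \<notin> set z" "2 \<le> weight (wt s t) y"
    "2 \<le> weight (wt s t) z + weight (wt s t) x"
  shows "spread (x @ [s] @ y @ [s] @ z) s t"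
  unfolding spread_def
  by (rule exI[of _ "weight (wt s t) z"]) (use assms in \<open>simp add: run_append run_gap_step gap_step_def\<close>)

lemma wt_pos: "m s r \<noteq> 2 \<Longrightarrow> 1 \<le> wt s t r"
  by (simp add: wt_def)

lemma weight_pos:
  assumes "r \<in> set u" "m s r \<noteq> 2"
  shows "1 \<le> weight (wt s t) u"
proof -
  have "wt s t r \<le> weight (wt s t) u" using assms(1) by (intro member_le_sum_list) auto
  then show ?thesis using wt_pos[OF assms(2), of t] by linarith
qed

section \<open>Infinite families from gap weights\<close>

abbreviation "linked s t \<equiv> m s t \<noteq> 2"

lemma linked_sym: "s \<in> S \<Longrightarrow> t \<in> S \<Longrightarrow> linked s t \<Longrightarrow> linked t s"
  using m_sym by metis

text \<open>The period goes once around the cycle, so every gap of a vertex contains both of its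
  neighbours.\<close>

lemma cycle_infinite:
  assumes "distinct c" "3 \<le> length c" "set c \<subseteq> S" "successively linked c" "linked (last c) (hd c)"
  shows "\<not> CFC_finite S m"
proof -
  have sp: "spread c s t" if "s \<in> set c" for s t
  proof -
    obtain x y where c: "c = x @ [s] @ y" using split_list[OF \<open>s \<in> set c\<close>] by auto
    have S: "s \<in> S" "set x \<subseteq> S" "set y \<subseteq> S" using c assms(3) by auto
    let ?l = "y @ x"
    have "linked s (hd ?l)"
    proof (cases "y = []")
      case True
      then show ?thesis using assms(2,5) c by (cases x) auto
    next
      case False
      then show ?thesis using assms(4) unfolding c successively_append_iff by simp
    qed
    moreover have "linked s (last ?l)"
    proof (cases "x = []")
      case True
      then have y: "y \<noteq> []" using assms(2) c by auto
      then have y': "linked (last y) s" using assms(5) c True by simp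
      have "last y \<in> S" using S last_in_set y by blast
      then show ?thesis using True y' S linked_sym[of "last y" s] by simp
    next
      case False
      then have "linked (last x) s" using assms(4) unfolding c successively_append_iff by simp
      moreover have "last x \<in> S" using False S last_in_set by blast
      ultimately show ?thesis using False S linked_sym[of "last x" s] by simp
    qed
    \<comment> \<open>Length at least 3 puts the two cyclic neighbours of \<open>s\<close> at
      different positions.\<close>
    moreover obtain a w b where l: "?l = a # w @ [b]"
    proof -
      have "2 \<le> length ?l" using assms(2) c by simp
      then obtain a v where av: "?l = a # v" "v \<noteq> []" by (cases ?l) (auto simp: Suc_le_eq)
      then show thesis using that[of a "butlast v" "last v"] by simp
    qed
    ultimately have "linked s a" "linked s b" by simp_all
    then have "2 \<le> weight (wt s t) ?l"
      using wt_pos[of s a t] wt_pos[of s b t] unfolding l by simp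
    then show ?thesis unfolding c using assms(1) c by (intro spread_once) simp_all
  qed
  show ?thesis using assms sp by (intro CFC_infinite_spread[of c]) auto
qed

text \<open>Without a relation between \<open>s\<close> and \<open>t\<close> only double letters
  have to be avoided.\<close>

lemma infinite_edge_infinite:
  assumes "s \<in> S" "t \<in> S" "m s t = \<infinity>"
  shows "\<not> CFC_finite S m"
proof -
  have ne: "s \<noteq> t" using assms m_self[of s] by (auto simp: one_enat_def)
  have ts: "m t s = \<infinity>" using assms m_sym by metis
  show ?thesis
  proof (rule CFC_infinite_spread[of "[s, t]"])
    show "spread [s, t] r r" if "r \<in> set [s, t]" for r
      using that spread_once[of s "[]" "[t]" s] spread_once[of t "[s]" "[]" t] ne assms ts
      by (auto simp: wt_def)
  qed (use assms ts in auto)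
qed

definition gadget :: "'a \<Rightarrow> 'a list \<Rightarrow> bool" where
  "gadget a P \<longleftrightarrow> (\<exists>p q. P = [p, q] \<and> linked a p \<and> linked a q) \<or> (\<exists>p. P = [p] \<and> linked a p \<and> m a p \<noteq> 3)"

lemma gadget_linked: "gadget a P \<Longrightarrow> p \<in> set P \<Longrightarrow> linked a p"
  by (auto simp: gadget_def)

lemma gadget_weight: "gadget a P \<Longrightarrow> P = [t] \<and> m a t \<noteq> 3 \<or> 2 \<le> weight (wt a t) P"
  by (auto simp: gadget_def wt_def split: if_splits)

text \<open>The period walks along \<open>A\<close>, visits all of \<open>Q\<close>, walks back and
  visits all of \<open>P\<close>. Between visits to an inner vertex the walk passes one of its
  neighbours twice. At a turning point the gap is a gadget: two linked letters, or one across a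
  label other than 3.\<close>

lemma double_end_infinite:
  assumes A: "A \<noteq> []" "successively linked A" and d: "distinct (P @ A @ Q)" and S: "set (P @ A @ Q) \<subseteq> S"
    and P: "gadget (hd A) P" and Q: "gadget (last A) Q"
  shows "\<not> CFC_finite S m"
proof -
  let ?c = "A @ Q @ rev A @ P"
  have gP: "spread ?c s t" if "s \<in> set P" for s t
  proof -
    obtain P1 P2 where P12: "P = P1 @ [s] @ P2" using split_list[OF \<open>s \<in> set P\<close>] by auto
    have "hd A \<in> S" "s \<in> S" using S A(1) that hd_in_set[of A] by auto
    then have l: "linked s (hd A)" using gadget_linked[OF P that] linked_sym by blast
    have "1 \<le> weight (wt s t) A" using l A(1) by (intro weight_pos[of "hd A"]) simp_all
    moreover have "weight (wt s t) (rev A) = weight (wt s t) A" by (simp add: rev_map[symmetric])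
    ultimately have "spread ((A @ Q @ rev A @ P1) @ [s] @ P2) s t"
      using d P12 by (intro spread_once) simp_all
    then show ?thesis using P12 by simp
  qed
  have gR: "spread ?c s t" if "s \<in> set Q" for s t
  proof -
    obtain P1 P2 where P12: "Q = P1 @ [s] @ P2" using split_list[OF \<open>s \<in> set Q\<close>] by auto
    have "last A \<in> S" "s \<in> S" using S A(1) that last_in_set[of A] by auto
    then have l: "linked s (last A)" using gadget_linked[OF Q that] linked_sym by blast
    have "1 \<le> weight (wt s t) A" using l A(1) by (intro weight_pos[of "last A"]) simp_all
    moreover have "weight (wt s t) (rev A) = weight (wt s t) A" by (simp add: rev_map[symmetric])
    ultimately have "spread ((A @ P1) @ [s] @ (P2 @ rev A @ P)) s t"
      using d P12 by (intro spread_once) simp_all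
    then show ?thesis using P12 by simp
  qed
  have gA: "spread ?c s t"
    if s: "s \<in> set A" and "\<not> (s = last A \<and> Q = [t] \<and> m s t \<noteq> 3)" "\<not> (s = hd A \<and> P = [t] \<and> m s t \<noteq> 3)" for s t
  proof -
    obtain X Y where XY: "A = X @ [s] @ Y" using split_list[OF s] by auto
    have XYS: "set X \<subseteq> S" "set Y \<subseteq> S" "s \<in> S" using S XY by auto
    have wrev: "weight (wt s t) (rev Z) = weight (wt s t) Z" for Z by (simp add: rev_map[symmetric])
    have 1: "2 \<le> weight (wt s t) (Y @ Q @ rev Y)"
    proof (cases "Y = []")
      case True
      then show ?thesis using gadget_weight[OF Q, of t] that(2) XY by auto
    next
      case False
      then have "linked s (hd Y)" using A(2) unfolding XY successively_append_iff by simp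
      then have "1 \<le> weight (wt s t) Y" using False by (intro weight_pos[of "hd Y"]) simp_all
      then show ?thesis using wrev[of Y] by simp
    qed
    have 2: "2 \<le> weight (wt s t) (rev X @ P) + weight (wt s t) X"
    proof (cases "X = []")
      case True
      then show ?thesis using gadget_weight[OF P, of t] that(3) XY by auto
    next
      case False
      then have "linked (last X) s" using A(2) unfolding XY successively_append_iff by simp
      moreover have "last X \<in> S" using False XYS last_in_set by blast
      ultimately have "linked s (last X)" using XYS linked_sym by blast
      then have "1 \<le> weight (wt s t) X" using False by (intro weight_pos[of "last X"]) simp_all
      then show ?thesis using wrev[of X] by simp
    qed
    have "spread (X @ [s] @ (Y @ Q @ rev Y) @ [s] @ (rev X @ P)) s t"
      using 1 2 d XY by (intro spread_twice) auto
    then show ?thesis using XY by simp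
  qed
  show ?thesis
  proof (rule CFC_infinite_spread[of ?c])
    show "spread ?c s s" if "s \<in> set ?c" for s
    proof (cases "s \<in> set A")
      case True
      then have "Q \<noteq> [s]" "P \<noteq> [s]" using d by auto
      then show ?thesis using gA[OF True] by blast
    qed (use that gP gR in auto)
    show "spread ?c s t \<or> (k \<noteq> 3 \<and> spread ?c t s) \<or> avoids ?c (alt s t k)"
      if "s \<in> set ?c" "t \<in> set ?c" "s \<noteq> t" "m s t = enat k" "3 \<le> k" for s t k
    proof (cases "spread ?c s t")
      case False
      then have sA: "s \<in> set A" using that gP gR by auto
      \<comment> \<open>The gap of \<open>s\<close> may be the single letter \<open>t\<close>; but
        the label is not 3, and the gaps of \<open>t\<close> contain a whole walk there and
        back.\<close>
      then have "Q = [t] \<and> m s t \<noteq> 3 \<or> P = [t] \<and> m s t \<noteq> 3" using gA[of s t] False by blast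
      then have "spread ?c t s" "m s t \<noteq> 3" using gP[of t s] gR[of t s] by auto
      then show ?thesis using that by (auto simp: numeral_eq_enat)
    qed simp
  qed (use A S in auto)
qed

lemma spread_suffix:
  "run (gap_step s (wt s t)) c (weight (wt s t) v) = Some (weight (wt s t) v) \<Longrightarrow> spread c s t"
  unfolding spread_def by blast

text \<open>Affine \<open>E_6\<close>. The three gaps of \<open>x\<close> hold the three pairs of
  the \<open>y\<close>. Each \<open>y\<close> occurs twice: one of its gaps holds \<open>x\<close>
  and its own \<open>z\<close>, the other two \<open>x\<close>. Each \<open>z\<close> occurs once,
  with two of its \<open>y\<close> in the gap.\<close>

lemma spider_222_infinite:
  assumes d: "distinct [x, y1, y2, y3, z1, z2, z3]"
    and S: "set [x, y1, y2, y3, z1, z2, z3] \<subseteq> S"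
    and l: "linked x y1" "linked x y2" "linked x y3" "linked y1 z1" "linked y2 z2" "linked y3 z3"
  shows "\<not> CFC_finite S m"
proof -
  let ?c = "[x, y1, y2, z1, x, y1, y3, z3, x, y2, y3, z2]"
  have "distinct (rev [x, y1, y2, y3, z1, z2, z3])" using d by (simp only: distinct_rev)
  note ne = d[simplified] this[simplified]
  have l': "linked y1 x" "linked y2 x" "linked y3 x" "linked z1 y1" "linked z2 y2" "linked z3 y3"
    using l S linked_sym by auto
  have "spread ?c s t" if s: "s \<in> set ?c" for s t
  proof -
    note w = ne l[THEN wt_pos[where t = t]] l'[THEN wt_pos[where t = t]]
    have "spread ?c x t"
      by (rule spread_suffix[of _ _ _ "[y2, y3, z2]"]) (use w in \<open>simp add: gap_step_def\<close>)
    moreover have "spread ?c y1 t"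
      by (rule spread_suffix[of _ _ _ "[y3, z3, x, y2, y3, z2]"]) (use w in \<open>simp add: gap_step_def\<close>)
    moreover have "spread ?c y2 t"
      by (rule spread_suffix[of _ _ _ "[y3, z2]"]) (use w in \<open>simp add: gap_step_def\<close>)
    moreover have "spread ?c y3 t"
      by (rule spread_suffix[of _ _ _ "[z2]"]) (use w in \<open>simp add: gap_step_def\<close>)
    moreover have "spread ?c z1 t"
      by (rule spread_suffix[of _ _ _ "[x, y1, y3, z3, x, y2, y3, z2]"]) (use w in \<open>simp add: gap_step_def\<close>)
    moreover have "spread ?c z2 t"
      by (rule spread_suffix[of _ _ _ "[]"]) (use w in \<open>simp add: gap_step_def\<close>)
    moreover have "spread ?c z3 t"
      by (rule spread_suffix[of _ _ _ "[x, y2, y3, z2]"]) (use w in \<open>simp add: gap_step_def\<close>)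
    ultimately show ?thesis using s by auto
  qed
  then show ?thesis using S by (intro CFC_infinite_spread[of ?c]) auto
qed

text \<open>Affine \<open>E_7\<close>. The four gaps of \<open>x\<close> hold \<open>y1 z1\<close>,
  \<open>p y1\<close>, \<open>y1 z1\<close>, \<open>p z1\<close>. On each long leg the inner, middle
  and outer vertex occur three times, twice and once.\<close>

lemma spider_133_infinite:
  assumes d: "distinct [x, p, y1, y2, y3, z1, z2, z3]"
    and S: "set [x, p, y1, y2, y3, z1, z2, z3] \<subseteq> S"
    and l: "linked x p" "linked x y1" "linked x z1" "linked y1 y2" "linked y2 y3" "linked z1 z2"
      "linked z2 z3"
  shows "\<not> CFC_finite S m"
proof -
  let ?c = "[x, y1, z1, y2, x, p, y1, y3, y2, x, y1, z1, z2, x, p, z1, z3, z2]"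
  have "distinct (rev [x, p, y1, y2, y3, z1, z2, z3])" using d by (simp only: distinct_rev)
  note ne = d[simplified] this[simplified]
  have l': "linked p x" "linked y1 x" "linked z1 x" "linked y2 y1" "linked y3 y2" "linked z2 z1"
    "linked z3 z2"
    using l S linked_sym by auto
  have "spread ?c s t" if s: "s \<in> set ?c" for s t
  proof -
    note w = ne l[THEN wt_pos[where t = t]] l'[THEN wt_pos[where t = t]]
    have "spread ?c x t"
      by (rule spread_suffix[of _ _ _ "[p, z1, z3, z2]"]) (use w in \<open>simp add: gap_step_def\<close>)
    moreover have "spread ?c p t"
      by (rule spread_suffix[of _ _ _ "[z1, z3, z2]"]) (use w in \<open>simp add: gap_step_def\<close>)
    moreover have "spread ?c y1 t"
      by (rule spread_suffix[of _ _ _ "[z1, z2, x, p, z1, z3, z2]"]) (use w in \<open>simp add: gap_step_def\<close>)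
    moreover have "spread ?c y2 t"
      by (rule spread_suffix[of _ _ _ "[x, y1, z1, z2, x, p, z1, z3, z2]"]) (use w in \<open>simp add: gap_step_def\<close>)
    moreover have "spread ?c y3 t"
      by (rule spread_suffix[of _ _ _ "[y2, x, y1, z1, z2, x, p, z1, z3, z2]"]) (use w in \<open>simp add: gap_step_def\<close>)
    moreover have "spread ?c z1 t"
      by (rule spread_suffix[of _ _ _ "[z3, z2]"]) (use w in \<open>simp add: gap_step_def\<close>)
    moreover have "spread ?c z2 t"
      by (rule spread_suffix[of _ _ _ "[]"]) (use w in \<open>simp add: gap_step_def\<close>)
    moreover have "spread ?c z3 t"
      by (rule spread_suffix[of _ _ _ "[z2]"]) (use w in \<open>simp add: gap_step_def\<close>)
    ultimately show ?thesis using s by auto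
  qed
  then show ?thesis using S by (intro CFC_infinite_spread[of ?c]) auto
qed

section \<open>Infinite families from chains across a heavy inner edge\<close>

lemma wt_other: "linked s a \<Longrightarrow> r \<noteq> a \<Longrightarrow> wt s r a = 2"
  by (simp add: wt_def)

text \<open>A flag is set by a letter linked to the one that clears it, so commuting letters never
  compete for it. For \<open>y = x\<close> the branch of \<open>x\<close> comes first, and the
  second flag is never set.\<close>

lemma chain_step_comm:
  assumes "a \<in> S" "b \<in> S" "m a b = 2" and st: "s \<noteq> t" "linked s t" "linked s x" "y = x \<or> linked t y"
  shows "Option.bind (chain_step M s t x y a q) (chain_step M s t x y b)
    = Option.bind (chain_step M s t x y b q) (chain_step M s t x y a)"
proof -
  have "m b a = 2" "a \<noteq> b" using assms m_sym[of b a] m_self[of a] by (auto simp: numeral_eq_enat one_enat_def)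
  then have ne: "a = s \<longrightarrow> b \<noteq> t \<and> b \<noteq> x" "a = t \<longrightarrow> b \<noteq> s \<and> (y \<noteq> x \<longrightarrow> b \<noteq> y)"
    "a = x \<longrightarrow> b \<noteq> s" "y \<noteq> x \<longrightarrow> a = y \<longrightarrow> b \<noteq> t" "a \<noteq> b"
    using assms by auto
  obtain l p r n where q: "q = (l, p, r, n)" by (cases q)
  consider "a = s" | "a = t" "a \<noteq> s" | "a = x" "a \<noteq> s" "a \<noteq> t" | "a = y" "a \<noteq> x" "a \<noteq> s" "a \<noteq> t"
    | "a \<notin> {s, t, x, y}" by blast
  then show ?thesis
    using ne st(1) unfolding q by cases (auto simp: chain_step_def)
qed

lemma avoids_chain:
  assumes st: "s \<noteq> t" "linked s t" "linked s x" "y = x \<or> linked t y"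
    and c: "run (chain_step M s t x y) c q = Some q" and M: "0 < M"
  shows "avoids c (alt s t M) \<and> avoids c (alt t s M)"
proof -
  obtain j where j: "M = Suc j" using M by (cases M) auto
  have "run (chain_step M s t x y) (alt s t M) q = None" for q
    using run_chain_step_alt[OF st(1), of M x y j q] j by (cases "run (chain_step M s t x y) (alt s t M) q") auto
  moreover have "run (chain_step M s t x y) (alt t s M) q = None" for q
    using run_chain_step_alt'[OF st(1), of M x y j q] j by (cases "run (chain_step M s t x y) (alt t s M) q") auto
  ultimately show ?thesis using avoids_run[OF chain_step_comm[OF _ _ _ st] c] by blast
qed

lemma CFC_infinite_chain:
  assumes st: "s \<noteq> t" "linked s t" "linked s x" "y = x \<or> linked t y" "s \<in> S" "t \<in> S"
    and c: "c \<noteq> []" "set c \<subseteq> S" and M: "0 < M" "enat M \<le> m s t"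
    and run: "run (chain_step M s t x y) c q = Some q"
    and spread: "\<And>a b. a \<in> set c \<Longrightarrow> (a, b) \<noteq> (s, t) \<Longrightarrow> (a, b) \<noteq> (t, s) \<Longrightarrow> spread c a b"
  shows "\<not> CFC_finite S m"
proof (rule CFC_infinite_spread[OF c])
  show "spread c a a" if "a \<in> set c" for a by (rule spread[OF that]) (use st(1) in auto)
  show "spread c a b \<or> (k \<noteq> 3 \<and> spread c b a) \<or> avoids c (alt a b k)"
    if ab: "a \<in> set c" "b \<in> set c" "a \<noteq> b" "m a b = enat k" "3 \<le> k" for a b k
  proof (cases "(a, b) = (s, t) \<or> (a, b) = (t, s)")
    case True
    then have "M \<le> k" using M(2) ab(4) m_sym[OF st(5,6)] by auto
    then have "avoids c (alt s t k)" "avoids c (alt t s k)"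
      using avoids_chain[OF st(1-4) run M(1)] by (blast intro: avoids_alt)+
    then show ?thesis using True by auto
  next
    case False
    then have "spread c a b" by (intro spread[OF ab(1)]) simp_all
    then show ?thesis ..
  qed
qed

text \<open>Cyclically \<open>s\<close> and \<open>t\<close> alternate. \<open>x\<close> separates
  successive \<open>s\<close> except across the end of the period, and \<open>y\<close> separates
  successive \<open>t\<close> except the first two; unseparated chains thus have length at most 3.
  The loop state describes the end of the period: \<open>t\<close> was last, \<open>y\<close> has
  occurred since, and the chain counter is 2.\<close>

lemma path_33433_infinite:
  assumes d: "distinct [v, x, s, t, y, w]"
    and S: "set [v, x, s, t, y, w] \<subseteq> S"
    and l: "linked v x" "linked s x" "linked t y" "linked y w"
    and m: "enat 4 \<le> m s t"
  shows "\<not> CFC_finite S m"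
proof -
  let ?c = "[s, x, t, s, v, x, t, y, s, t, w, y]"
  have "distinct (rev [v, x, s, t, y, w])" using d by (simp only: distinct_rev)
  note ne = d[simplified] this[simplified]
  have l': "linked x v" "linked x s" "linked y t" "linked w y"
    using l S linked_sym by auto
  have st: "linked s t" using m by (auto simp: numeral_eq_enat)
  then have ts: "linked t s" using S linked_sym by simp
  show ?thesis
  proof (rule CFC_infinite_chain[of s t x y ?c 4 "(False, False, True, 2)"])
    fix a b assume a: "a \<in> set ?c" and ab: "(a, b) \<noteq> (s, t)" "(a, b) \<noteq> (t, s)"
    note w = ne l[THEN wt_pos[where t = b]] l'[THEN wt_pos[where t = b]]
    have "spread ?c v b"
      by (rule spread_suffix[of _ _ _ "[x, t, y, s, t, w, y]"]) (use w in \<open>simp add: gap_step_def\<close>)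
    moreover have "spread ?c x b"
      by (rule spread_suffix[of _ _ _ "[t, y, s, t, w, y]"]) (use w in \<open>simp add: gap_step_def\<close>)
    moreover have "spread ?c s b" if "b \<noteq> t"
      by (rule spread_suffix[of _ _ _ "[t, w, y]"]) (use w wt_other[OF st, of b] that in \<open>simp add: gap_step_def\<close>)
    moreover have "spread ?c t b" if "b \<noteq> s"
      by (rule spread_suffix[of _ _ _ "[w, y]"]) (use w wt_other[OF ts, of b] that in \<open>simp add: gap_step_def\<close>)
    moreover have "spread ?c y b"
      by (rule spread_suffix[of _ _ _ "[]"]) (use w in \<open>simp add: gap_step_def\<close>)
    moreover have "spread ?c w b"
      by (rule spread_suffix[of _ _ _ "[y]"]) (use w in \<open>simp add: gap_step_def\<close>)
    ultimately show "spread ?c a b" using a ab by auto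
  next
    show "run (chain_step 4 s t x y) ?c (False, False, True, 2) = Some (False, False, True, 2)" using ne by (simp add: chain_step_def)
  qed (use S l ne st m in auto)
qed

text \<open>Only across the end of the period are two \<open>s\<close> or two \<open>t\<close>
  unseparated, so the longest chain is \<open>s t s t\<close>.\<close>

lemma path_353_infinite:
  assumes d: "distinct [x, s, t, y]"
    and S: "set [x, s, t, y] \<subseteq> S"
    and l: "linked s x" "linked t y"
    and m: "enat 5 \<le> m s t"
  shows "\<not> CFC_finite S m"
proof -
  let ?c = "[s, x, t, s, y, t]"
  have "distinct (rev [x, s, t, y])" using d by (simp only: distinct_rev)
  note ne = d[simplified] this[simplified]
  have l': "linked x s" "linked y t"
    using l S linked_sym by auto
  have st: "linked s t" using m by (auto simp: numeral_eq_enat)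
  then have ts: "linked t s" using S linked_sym by simp
  show ?thesis
  proof (rule CFC_infinite_chain[of s t x y ?c 5 "(False, False, False, 2)"])
    fix a b assume a: "a \<in> set ?c" and ab: "(a, b) \<noteq> (s, t)" "(a, b) \<noteq> (t, s)"
    note w = ne l[THEN wt_pos[where t = b]] l'[THEN wt_pos[where t = b]]
    have "spread ?c x b"
      by (rule spread_suffix[of _ _ _ "[t, s, y, t]"]) (use w in \<open>simp add: gap_step_def\<close>)
    moreover have "spread ?c s b" if "b \<noteq> t"
      by (rule spread_suffix[of _ _ _ "[y, t]"]) (use w wt_other[OF st, of b] that in \<open>simp add: gap_step_def\<close>)
    moreover have "spread ?c t b" if "b \<noteq> s"
      by (rule spread_suffix[of _ _ _ "[]"]) (use w wt_other[OF ts, of b] that in \<open>simp add: gap_step_def\<close>)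
    moreover have "spread ?c y b"
      by (rule spread_suffix[of _ _ _ "[t]"]) (use w in \<open>simp add: gap_step_def\<close>)
    ultimately show "spread ?c a b" using a ab by auto
  next
    show "run (chain_step 5 s t x y) ?c (False, False, False, 2) = Some (False, False, False, 2)" using ne by (simp add: chain_step_def)
  qed (use S l ne st m in auto)
qed

text \<open>Here \<open>x\<close> separates \<open>s\<close> once per period and nothing separates
  \<open>t\<close>; the longest chain is \<open>t s t s t\<close>.\<close>

lemma path_36_infinite:
  assumes d: "distinct [x, s, t]"
    and S: "set [x, s, t] \<subseteq> S"
    and l: "linked s x"
    and m: "enat 6 \<le> m s t"
  shows "\<not> CFC_finite S m"
proof -
  let ?c = "[s, t, x, s, t]"
  have "distinct (rev [x, s, t])" using d by (simp only: distinct_rev)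
  note ne = d[simplified] this[simplified]
  have l': "linked x s"
    using l S linked_sym by auto
  have st: "linked s t" using m by (auto simp: numeral_eq_enat)
  then have ts: "linked t s" using S linked_sym by simp
  show ?thesis
  proof (rule CFC_infinite_chain[of s t x x ?c 6 "(False, False, False, 3)"])
    fix a b assume a: "a \<in> set ?c" and ab: "(a, b) \<noteq> (s, t)" "(a, b) \<noteq> (t, s)"
    note w = ne l[THEN wt_pos[where t = b]] l'[THEN wt_pos[where t = b]]
    have "spread ?c x b"
      by (rule spread_suffix[of _ _ _ "[s, t]"]) (use w in \<open>simp add: gap_step_def\<close>)
    moreover have "spread ?c s b" if "b \<noteq> t"
      by (rule spread_suffix[of _ _ _ "[t]"]) (use w wt_other[OF st, of b] that in \<open>simp add: gap_step_def\<close>)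
    moreover have "spread ?c t b" if "b \<noteq> s"
      by (rule spread_suffix[of _ _ _ "[]"]) (use w wt_other[OF ts, of b] that in \<open>simp add: gap_step_def\<close>)
    ultimately show "spread ?c a b" using a ab by auto
  next
    show "run (chain_step 6 s t x x) ?c (False, False, False, 3) = Some (False, False, False, 3)" using ne by (simp add: chain_step_def)
  qed (use S l ne st m in auto)
qed

section \<open>Classification of Coxeter graphs of CFC-finite groups\<close>

text \<open>Connectedness by cuts, the form in which maximality arguments can extend a path by an
  edge.\<close>

definition conn :: "'a set \<Rightarrow> bool" where
  "conn K \<longleftrightarrow> K \<subseteq> S \<and> K \<noteq> {} \<and>
    (\<forall>Y. Y \<subseteq> K \<longrightarrow> Y \<noteq> {} \<longrightarrow> Y \<noteq> K \<longrightarrow> (\<exists>v\<in>Y. \<exists>w\<in>K - Y. linked v w))"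

definition closed :: "'a set \<Rightarrow> bool" where
  "closed K \<longleftrightarrow> K \<subseteq> S \<and> (\<forall>s\<in>K. \<forall>t\<in>S. linked s t \<longrightarrow> t \<in> K)"

definition lpath :: "'a list \<Rightarrow> bool" where
  "lpath p \<longleftrightarrow> distinct p \<and> set p \<subseteq> S \<and> successively linked p"

lemma lpath_factor: "lpath (x @ y @ z) \<Longrightarrow> lpath y"
  by (auto simp: lpath_def successively_append_iff)

lemma lpath_snoc:
  "lpath p \<Longrightarrow> p \<noteq> [] \<Longrightarrow> linked (last p) w \<Longrightarrow> w \<in> S \<Longrightarrow> w \<notin> set p \<Longrightarrow> lpath (p @ [w])"
  by (auto simp: lpath_def successively_append_iff)

lemma lpath_rev:
  assumes "lpath p"
  shows "lpath (rev p)"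
proof -
  have "successively (\<lambda>s t. linked t s) p"
    using assms unfolding lpath_def by (elim conjE successively_mono) (meson linked_sym subsetD)
  then show ?thesis using assms by (simp add: lpath_def)
qed

lemma lpath_Cons:
  assumes "lpath p" "p \<noteq> []" "linked w (hd p)" "w \<in> S" "w \<notin> set p"
  shows "lpath (w # p)"
  using assms by (cases p) (auto simp: lpath_def)

lemma path_exists:
  assumes K: "conn K" and cv: "c \<in> K" "v \<in> K"
  shows "\<exists>p. lpath p \<and> set p \<subseteq> K \<and> p \<noteq> [] \<and> hd p = c \<and> last p = v"
proof -
  define Y where "Y = {v \<in> K. \<exists>p. lpath p \<and> set p \<subseteq> K \<and> p \<noteq> [] \<and> hd p = c \<and> last p = v}"
  have KS: "K \<subseteq> S" using K by (simp add: conn_def)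
  have "lpath [c]" using cv KS by (auto simp: lpath_def)
  then have cY: "c \<in> Y" using cv unfolding Y_def by (auto intro!: exI[of _ "[c]"])
  have "Y = K"
  proof (rule ccontr)
    assume "Y \<noteq> K"
    then obtain v w where vw: "v \<in> Y" "w \<in> K" "w \<notin> Y" "linked v w"
      using K cY unfolding conn_def by (metis (no_types, lifting) DiffE Y_def empty_iff mem_Collect_eq subsetI)
    obtain p where p: "lpath p" "set p \<subseteq> K" "p \<noteq> []" "hd p = c" "last p = v"
      using vw(1) unfolding Y_def by blast
    have "\<exists>p. lpath p \<and> set p \<subseteq> K \<and> p \<noteq> [] \<and> hd p = c \<and> last p = w"
    proof (cases "w \<in> set p")
      case True
      then obtain a b where ab: "p = a @ w # b" using split_list by metis
      then have "lpath (a @ [w])" using lpath_factor[of "[]" "a @ [w]" b] p by simp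
      then show ?thesis using ab p by (intro exI[of _ "a @ [w]"]) (cases a; auto)
    next
      case False
      have "lpath (p @ [w])" using p vw False KS by (intro lpath_snoc) auto
      then show ?thesis using p vw by (intro exI[of _ "p @ [w]"]) auto
    qed
    then show False using vw unfolding Y_def by blast
  qed
  then show ?thesis using cv unfolding Y_def by blast
qed

text \<open>A path from \<open>c\<close> to \<open>v\<close> either avoids \<open>w\<close> and is
  prolonged by it, or is cut at \<open>w\<close> and then prolonged by \<open>v\<close>.\<close>

lemma edge_path_exists:
  assumes K: "conn K" and "c \<in> K" "v \<in> K" "w \<in> K" "v \<noteq> w" "linked v w"
  shows "\<exists>p x y. lpath (p @ [x, y]) \<and> hd (p @ [x, y]) = c \<and> {x, y} = {v, w}"
proof -
  have S: "v \<in> S" "w \<in> S" using assms by (auto simp: conn_def)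
  obtain p where p: "lpath p" "set p \<subseteq> K" "p \<noteq> []" "hd p = c" "last p = v"
    using path_exists[OF K assms(2,3)] by blast
  show ?thesis
  proof (cases "w \<in> set p")
    case True
    then obtain a b where ab: "p = a @ w # b" using split_list by metis
    have l: "lpath (a @ [w])" using lpath_factor[of "[]" "a @ [w]" b] p ab by simp
    have "b \<noteq> []" using ab p assms(5) by auto
    then have "v \<in> set b" using ab p by auto
    then have "v \<notin> set (a @ [w])" using p(1) ab by (auto simp: lpath_def)
    then have "lpath ((a @ [w]) @ [v])"
      using l S linked_sym[OF S assms(6)] by (intro lpath_snoc[of "a @ [w]"]) simp_all
    then show ?thesis using p ab
      by (intro exI[of _ a] exI[of _ w] exI[of _ v]) (auto simp: hd_append)
  next
    case False
    have "lpath (p @ [w])" using p S assms False by (intro lpath_snoc) auto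
    moreover have pb: "p = butlast p @ [v]" using p by (metis append_butlast_last_id)
    ultimately have "lpath ((butlast p @ [v]) @ [w])" by simp
    then have 1: "lpath (butlast p @ [v, w])" by simp
    have "hd (butlast p @ [v]) = c" using p(4) pb by simp
    then have "hd (butlast p @ [v, w]) = c" by (cases "butlast p") simp_all
    then show ?thesis using 1 by blast
  qed
qed

definition nbr :: "'a \<Rightarrow> 'a \<Rightarrow> bool" where
  "nbr c x \<longleftrightarrow> x \<in> S \<and> x \<noteq> c \<and> linked c x"

definition branch :: "'a \<Rightarrow> bool" where
  "branch c \<longleftrightarrow> c \<in> S \<and> (\<exists>x y z. distinct [x, y, z] \<and> nbr c x \<and> nbr c y \<and> nbr c z)"

definition pathlike :: "'a list \<Rightarrow> (nat \<Rightarrow> enat) \<Rightarrow> bool" where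
  "pathlike p l \<longleftrightarrow> (\<forall>i j. i < j \<longrightarrow> j < length p \<longrightarrow> m (p ! i) (p ! j) = (if j = Suc i then l i else 2))"

end

locale cfc_finite_coxeter = coxeter +
  assumes fin: "CFC_finite S m"
begin

lemma no_cycle:
  assumes "lpath c" "3 \<le> length c"
  shows "\<not> linked (last c) (hd c)"
  using assms cycle_infinite[of c] fin unfolding lpath_def by blast

lemma no_double_end:
  assumes "lpath A" "A \<noteq> []" "distinct (P @ A @ Q)" "set P \<subseteq> S" "set Q \<subseteq> S" "gadget (hd A) P" "gadget (last A) Q"
  shows False
  using double_end_infinite[of A P Q] assms fin by (auto simp: lpath_def)

lemma finite_label: "s \<in> S \<Longrightarrow> t \<in> S \<Longrightarrow> m s t \<noteq> \<infinity>"
  using infinite_edge_infinite fin by blast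

text \<open>Otherwise the path up to \<open>x\<close>, closed by the edge back to \<open>c\<close>,
  is a cycle.\<close>

lemma nbr_off_path:
  assumes "lpath (c # z # r)" "nbr c x" "x \<noteq> z"
  shows "x \<notin> set (c # z # r)"
proof
  assume "x \<in> set (c # z # r)"
  then have "x \<in> set r" using assms by (auto simp: nbr_def)
  then obtain r1 r2 where r: "r = r1 @ x # r2" using split_list by metis
  then have "lpath (c # z # r1 @ [x])" using lpath_factor[of "[]" "c # z # r1 @ [x]" r2] assms by simp
  moreover have "c \<in> S" using assms(1) by (simp add: lpath_def)
  then have "linked x c" using assms(2) linked_sym[of c x] by (simp add: nbr_def)
  ultimately show False using no_cycle[of "c # z # r1 @ [x]"] by simp
qed

lemma branch_fork:
  assumes "branch c" "lpath (c # z # r)"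
  shows "\<exists>p q. p \<noteq> q \<and> nbr c p \<and> nbr c q \<and> p \<notin> set (c # z # r) \<and> q \<notin> set (c # z # r)"
proof -
  obtain x1 x2 x3 where x: "distinct [x1, x2, x3]" "nbr c x1" "nbr c x2" "nbr c x3"
    using assms(1) unfolding branch_def by blast
  have "\<exists>p q. p \<noteq> q \<and> nbr c p \<and> nbr c q \<and> p \<noteq> z \<and> q \<noteq> z"
  proof (cases "x1 = z")
    case True
    then show ?thesis using x by (intro exI[of _ x2] exI[of _ x3]) auto
  next
    case False
    show ?thesis
    proof (cases "x2 = z")
      case True
      then show ?thesis using x False by (intro exI[of _ x1] exI[of _ x3]) auto
    qed (use x False in \<open>intro exI[of _ x1] exI[of _ x2]; auto\<close>)
  qed
  then obtain p q where "p \<noteq> q" "nbr c p" "nbr c q" "p \<noteq> z" "q \<noteq> z" by blast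
  then show ?thesis using nbr_off_path[OF assms(2)] by blast
qed

text \<open>A path from the branch vertex to the heavy edge would have a fork at one end and the
  edge at the other.\<close>

lemma no_heavy_edge_if_branch:
  assumes K: "conn K" and c: "c \<in> K" "branch c" and vw: "v \<in> K" "w \<in> K" "v \<noteq> w" "linked v w"
  shows "m v w = 3"
proof (rule ccontr)
  assume m3: "m v w \<noteq> 3"
  have S: "v \<in> S" "w \<in> S" using K vw by (auto simp: conn_def)
  obtain p x y where p: "lpath (p @ [x, y])" "hd (p @ [x, y]) = c" "{x, y} = {v, w}"
    using edge_path_exists[OF K c(1) vw] by blast
  have xy: "linked x y" "m x y \<noteq> 3" "y \<in> S"
    using p(3) vw m3 m_sym[OF S] linked_sym[OF S] S by (auto simp: doubleton_eq_iff)
  obtain z r where zr: "p @ [x, y] = c # z # r" using p(2) by (cases p; cases "tl p") auto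
  obtain a b where ab: "a \<noteq> b" "nbr c a" "nbr c b" "a \<notin> set (c # z # r)" "b \<notin> set (c # z # r)"
    using branch_fork[OF c(2)] p(1) zr by metis
  show False
  proof (rule no_double_end[of "p @ [x]" "[a, b]" "[y]"])
    show "lpath (p @ [x])" using lpath_factor[of "[]" "p @ [x]" "[y]"] p(1) by simp
    show "distinct ([a, b] @ (p @ [x]) @ [y])"
      using p(1) ab unfolding zr[symmetric] by (auto simp: lpath_def)
    have "hd (p @ [x]) = c" using p(2) by (cases p) auto
    then show "gadget (hd (p @ [x])) [a, b]" using ab by (auto simp: gadget_def nbr_def)
    show "gadget (last (p @ [x])) [y]" using xy by (auto simp: gadget_def)
  qed (use ab xy in \<open>auto simp: nbr_def\<close>)
qed

lemma branch_unique:
  assumes K: "conn K" and c: "c \<in> K" "branch c" and d: "d \<in> K" "branch d"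
  shows "c = d"
proof (rule ccontr)
  assume ne: "c \<noteq> d"
  obtain A where A: "lpath A" "A \<noteq> []" "hd A = c" "last A = d"
    using path_exists[OF K c(1) d(1)] by blast
  obtain z r where zr: "A = c # z # r" using A ne by (cases A; cases "tl A") auto
  obtain z' r' where zr': "rev A = d # z' # r'"
  proof -
    have "hd (rev A) = d" "length (rev A) \<ge> 2" using A zr by (auto simp: hd_rev)
    then show thesis using that by (cases "rev A"; cases "tl (rev A)") auto
  qed
  have sA: "set A = set (d # z' # r')" using zr' by (metis set_rev)
  obtain a b where ab: "a \<noteq> b" "nbr c a" "nbr c b" "a \<notin> set A" "b \<notin> set A"
    using branch_fork[OF c(2)] A(1) zr by metis
  obtain a' b' where ab': "a' \<noteq> b'" "nbr d a'" "nbr d b'" "a' \<notin> set A" "b' \<notin> set A"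
    using branch_fork[OF d(2)] lpath_rev[OF A(1)] zr' sA by metis
  \<comment> \<open>A common neighbour off the path would close a cycle, so the two forks are
    disjoint.\<close>
  have no: "\<not> (nbr c x \<and> nbr d x)" if "x \<notin> set A" for x
  proof
    assume x: "nbr c x \<and> nbr d x"
    have "lpath (A @ [x])" using A x that by (intro lpath_snoc) (auto simp: nbr_def)
    moreover have "linked x c" using x A linked_sym[of c x] zr by (auto simp: nbr_def lpath_def)
    ultimately show False using no_cycle[of "A @ [x]"] A zr by simp
  qed
  show False
  proof (rule no_double_end[OF A(1,2), of "[a, b]" "[a', b']"])
    show "distinct ([a, b] @ A @ [a', b'])"
      using ab ab' A(1) no[of a] no[of b] by (auto simp: lpath_def)
  qed (use ab ab' A in \<open>auto simp: nbr_def gadget_def\<close>)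
qed

text \<open>Two forks at a path consisting of one vertex.\<close>

lemma degree_le_3:
  assumes "c \<in> S" "distinct [x1, x2, x3, x4]" "nbr c x1" "nbr c x2" "nbr c x3" "nbr c x4"
  shows False
  by (rule no_double_end[of "[c]" "[x1, x2]" "[x3, x4]"])
    (use assms in \<open>auto simp: nbr_def gadget_def lpath_def\<close>)

text \<open>Take a longest path in \<open>X\<close>. An edge leaving it at an end would prolong it;
  one leaving at an inner vertex gives that vertex three neighbours.\<close>

lemma path_cover:
  assumes X: "conn X" and deg: "\<And>v x y z. v \<in> X \<Longrightarrow> distinct [x, y, z] \<Longrightarrow> {x, y, z} \<subseteq> X \<Longrightarrow>
      nbr v x \<Longrightarrow> nbr v y \<Longrightarrow> nbr v z \<Longrightarrow> False"
  shows "\<exists>p. lpath p \<and> set p = X"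
proof -
  have XS: "X \<subseteq> S" using X by (simp add: conn_def)
  obtain v0 where v0: "v0 \<in> X" using X by (auto simp: conn_def)
  define P where "P p \<longleftrightarrow> lpath p \<and> set p \<subseteq> X \<and> p \<noteq> []" for p
  have "P [v0]" using v0 XS by (auto simp: P_def lpath_def)
  moreover have "length p \<le> card X" if "P p" for p
    using that card_mono[OF finite_subset[OF XS finite_S], of "set p"] distinct_card[of p]
    by (simp add: P_def lpath_def)
  ultimately have "\<exists>p. P p \<and> (\<forall>q. P q \<longrightarrow> length q \<le> length p)"
    by (intro ex_has_greatest_nat[of P "[v0]" length "Suc (card X)"]) (auto simp: less_Suc_eq_le)
  then obtain p where p: "P p" "\<And>q. P q \<Longrightarrow> length q \<le> length p" by blast
  have "set p = X"
  proof (rule ccontr)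
    assume "set p \<noteq> X"
    then obtain v w where vw: "v \<in> set p" "w \<in> X" "w \<notin> set p" "linked v w"
      using X p(1) unfolding conn_def P_def by (metis DiffE set_empty2)
    have lp: "lpath p" "set p \<subseteq> X" "p \<noteq> []" using p(1) by (simp_all add: P_def)
    obtain a b where ab: "p = a @ v # b" using vw(1) split_list by metis
    have S: "v \<in> S" "w \<in> S" "v \<in> X" using vw lp XS by auto
    consider "a = []" | "b = []" | "a \<noteq> []" "b \<noteq> []" by blast
    then show False
    proof cases
      case 1
      have "lpath (w # p)" using lp(1,3) vw(3) S ab 1 linked_sym[OF S(1,2) vw(4)]
        by (intro lpath_Cons) simp_all
      then have "P (w # p)" using lp vw by (simp add: P_def)
      then show False using p(2)[of "w # p"] by simp
    next
      case 2
      have "lpath (p @ [w])" using lp vw S ab 2 by (intro lpath_snoc) auto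
      then have "P (p @ [w])" using lp vw by (simp add: P_def)
      then show False using p(2)[of "p @ [w]"] by simp
    next
      case 3
      have d: "distinct (a @ v # b)" "successively linked (a @ v # b)" "set (a @ v # b) \<subseteq> X"
        using lp ab by (auto simp: lpath_def)
      have la: "last a \<in> set a" "hd b \<in> set b" using 3 by simp_all
      have laS: "last a \<in> S" "hd b \<in> S" using la d(3) XS by auto
      have lv: "linked (last a) v" "linked v (hd b)"
        using d(2) 3 by (simp_all add: successively_append_iff successively_Cons)
      then have "nbr v (last a)" "nbr v (hd b)" "nbr v w"
        using d(1) la laS vw S linked_sym[OF laS(1) S(1)] ab by (auto simp: nbr_def)
      moreover have "last a \<noteq> hd b" using d(1) la by (auto simp: disjoint_iff)
      moreover have "last a \<noteq> w" "hd b \<noteq> w" using la vw(3) ab by auto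
      moreover have "last a \<in> X" "hd b \<in> X" using la d(3) by auto
      ultimately show False using deg[of v "last a" "hd b" w] S(3) vw(2) by simp
    qed
  qed
  then show ?thesis using p(1) unfolding P_def by blast
qed

lemma lpath_linked_Suc: "lpath p \<Longrightarrow> Suc i < length p \<Longrightarrow> linked (p ! i) (p ! Suc i)"
  unfolding lpath_def by (simp add: successively_conv_nth)

lemma lpath_slice:
  assumes "lpath p" "i \<le> j" "j < length p"
  shows "\<exists>x c y. p = x @ c @ y \<and> lpath c \<and> c \<noteq> [] \<and> hd c = p ! i \<and> last c = p ! j \<and> length c = Suc j - i
    \<and> length x = i"
proof -
  let ?c = "take (Suc j - i) (drop i p)"
  have p: "p = take i p @ ?c @ drop (Suc j - i) (drop i p)"
    by (simp only: append_take_drop_id)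
  have len: "length ?c = Suc j - i" using assms by simp
  have ne: "?c \<noteq> []" using assms by auto
  have "hd ?c = p ! i" using assms ne by (simp add: hd_conv_nth)
  moreover have "last ?c = p ! j" using assms ne len by (simp add: last_conv_nth)
  moreover have "lpath ?c" using p lpath_factor assms(1) by metis
  ultimately show ?thesis using p len ne assms
    by (intro exI[of _ "take i p"] exI[of _ ?c] exI[of _ "drop (Suc j - i) (drop i p)"]) simp
qed

text \<open>Any further link between vertices of the path would close a cycle.\<close>

lemma lpath_pathlike:
  assumes "lpath p"
  shows "pathlike p (\<lambda>i. m (p ! i) (p ! Suc i))"
  unfolding pathlike_def
proof (intro allI impI)
  fix i j assume ij: "i < j" "j < length p"
  show "m (p ! i) (p ! j) = (if j = Suc i then m (p ! i) (p ! Suc i) else 2)"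
  proof (cases "j = Suc i")
    case False
    obtain x c y where c: "p = x @ c @ y" "lpath c" "hd c = p ! i" "last c = p ! j" "length c = Suc j - i"
      using lpath_slice[OF assms, of i j] ij by auto
    have "\<not> linked (p ! j) (p ! i)" using no_cycle[OF c(2)] c ij False by simp
    moreover have "p ! i \<in> S" "p ! j \<in> S" using assms ij by (auto simp: lpath_def)
    ultimately show ?thesis using m_sym False by metis
  qed simp
qed

end

context coxeter
begin

lemma pathlike_rev:
  assumes "set p \<subseteq> S" "pathlike p l"
  shows "pathlike (rev p) (\<lambda>i. l (length p - 2 - i))"
  unfolding pathlike_def
proof (intro allI impI)
  fix i j assume ij: "i < j" "j < length (rev p)"
  let ?i = "length p - Suc j" and ?j = "length p - Suc i"
  have lt: "?i < ?j" "?j < length p" using ij by auto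
  have "p ! ?i \<in> S" "p ! ?j \<in> S" using assms(1) lt by auto
  then have "m (rev p ! i) (rev p ! j) = m (p ! ?i) (p ! ?j)"
    using ij by (simp add: rev_nth m_sym)
  also have "\<dots> = (if ?j = Suc ?i then l ?i else 2)" using assms(2) lt by (simp add: pathlike_def)
  also have "\<dots> = (if j = Suc i then l (length p - 2 - i) else 2)"
    using ij by (auto intro!: arg_cong[of _ _ l])
  finally show "m (rev p ! i) (rev p ! j) = (if j = Suc i then l (length p - 2 - i) else 2)" .
qed

lemma pathlike_cong:
  "pathlike p l \<Longrightarrow> (\<And>i. Suc i < length p \<Longrightarrow> l i = l' i) \<Longrightarrow> pathlike p l'"
  by (simp add: pathlike_def)

definition path_type :: "'a set \<Rightarrow> nat \<Rightarrow> (nat \<Rightarrow> enat) \<Rightarrow> bool" where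
  "path_type K n l \<longleftrightarrow> (\<exists>p. distinct p \<and> length p = n \<and> set p = K \<and> pathlike p l)"

text \<open>Positions count from 0, so type D has \<open>j = 1\<close> and type E has
  \<open>j = 2\<close>.\<close>

definition spider_type :: "'a set \<Rightarrow> nat \<Rightarrow> nat \<Rightarrow> bool" where
  "spider_type K n j \<longleftrightarrow> (\<exists>p x. distinct p \<and> Suc (length p) = n \<and> x \<notin> set p \<and> K = insert x (set p) \<and>
    pathlike p (\<lambda>_. 3) \<and> (\<forall>i<length p. m x (p ! i) = (if i = j then 3 else 2)))"

definition listed :: "'a set \<Rightarrow> bool" where
  "listed K \<longleftrightarrow>
    (\<exists>n\<ge>1. path_type K n (\<lambda>_. 3)) \<or>
    (\<exists>n\<ge>2. path_type K n (\<lambda>i. if i = 0 then 4 else 3)) \<or>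
    (\<exists>n\<ge>4. spider_type K n 1) \<or>
    (\<exists>n\<ge>6. spider_type K n 2) \<or>
    (\<exists>n\<ge>4. path_type K n (\<lambda>i. if i = 1 then 4 else 3)) \<or>
    (\<exists>n\<ge>3. path_type K n (\<lambda>i. if i = 0 then 5 else 3)) \<or>
    (\<exists>k\<ge>5. path_type K 2 (\<lambda>_. enat k))"

lemma spider_listed:
  assumes p: "distinct p" "set p \<subseteq> S" "pathlike p (\<lambda>_. 3)" and x: "x \<notin> set p" "K = insert x (set p)"
    and mx: "\<And>i. i < length p \<Longrightarrow> m x (p ! i) = (if i = j then 3 else 2)"
    and j: "0 < j" "Suc j < length p" "j < 3 \<or> length p \<le> j + 3"
  shows "listed K"
proof -
  have *: "listed K" if "distinct p" "pathlike p (\<lambda>_. 3)" "x \<notin> set p" "K = insert x (set p)"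
    "\<And>i. i < length p \<Longrightarrow> m x (p ! i) = (if i = j then 3 else 2)"
    "j = 1 \<and> 3 \<le> length p \<or> j = 2 \<and> 5 \<le> length p" for p j
  proof -
    have "spider_type K (Suc (length p)) j" unfolding spider_type_def using that by blast
    then have "(\<exists>n\<ge>4. spider_type K n 1) \<or> (\<exists>n\<ge>6. spider_type K n 2)"
      using that(6) by (auto intro!: exI[of _ "Suc (length p)"])
    then show ?thesis unfolding listed_def by blast
  qed
  show ?thesis
  \<comment> \<open>A path of four vertices with \<open>j = 2\<close> is of type D read from the
    other end, so it belongs to the reversed case.\<close>
  proof (cases "j = 1 \<or> j = 2 \<and> 5 \<le> length p")
    case True
    then show ?thesis using *[OF p(1,3) x mx] j by auto
  next
    case False
    let ?j = "length p - Suc j"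
    have mx': "m x (rev p ! i) = (if i = ?j then 3 else 2)" if "i < length (rev p)" for i
    proof -
      have "m x (rev p ! i) = (if length p - Suc i = j then 3 else 2)"
        using that mx by (simp add: rev_nth)
      then show ?thesis using that j by auto
    qed
    have "?j = 1 \<and> 3 \<le> length p \<or> ?j = 2 \<and> 5 \<le> length p"
      using False j by linarith
    then show ?thesis
      using *[of "rev p" ?j] p x mx' pathlike_rev[OF p(2,3)] by simp
  qed
qed

end

context cfc_finite_coxeter
begin

lemma no_triangle: "c \<in> S \<Longrightarrow> nbr c a \<Longrightarrow> nbr c b \<Longrightarrow> a \<noteq> b \<Longrightarrow> \<not> linked a b"
  using no_cycle[of "[c, a, b]"] linked_sym[of c b] by (auto simp: lpath_def nbr_def)

lemma no_square:
  assumes "c \<in> S" "nbr c a" "nbr c b" "a \<noteq> b" "nbr a z" "nbr b z" "z \<noteq> c"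
  shows False
proof -
  have "linked z b" "linked b c" using assms linked_sym by (simp_all add: nbr_def)
  then show False using no_cycle[of "[c, a, z, b]"] assms by (auto simp: lpath_def nbr_def)
qed

text \<open>Otherwise there is a spider with legs 2, 2, 2, whose vertices are distinct because
  triangles and squares are excluded.\<close>

lemma branch_has_leaf:
  assumes c: "c \<in> S" and x: "distinct [x1, x2, x3]" "nbr c x1" "nbr c x2" "nbr c x3"
  shows "\<exists>x\<in>{x1, x2, x3}. \<forall>r. nbr x r \<longrightarrow> r = c"
proof (rule ccontr)
  assume "\<not> ?thesis"
  then obtain z1 z2 z3 where z: "nbr x1 z1" "z1 \<noteq> c" "nbr x2 z2" "z2 \<noteq> c" "nbr x3 z3" "z3 \<noteq> c"
    by blast
  have ne: "z \<noteq> b" "z \<noteq> a" if "nbr c a" "nbr c b" "a \<noteq> b" "nbr a z" for a b z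
    using no_triangle[OF c that(1-3)] that(4) by (auto simp: nbr_def)
  have ne2: "z \<noteq> z'" if "nbr c a" "nbr c b" "a \<noteq> b" "nbr a z" "nbr b z'" "z \<noteq> c" for a b z z'
    using no_square[OF c that(1-4)] that by blast
  have "distinct [c, x1, x2, x3, z1, z2, z3]"
    using x z ne[OF x(2,3) _ z(1)] ne[OF x(2,4) _ z(1)] ne[OF x(3,2) _ z(3)] ne[OF x(3,4) _ z(3)]
      ne[OF x(4,2) _ z(5)] ne[OF x(4,3) _ z(5)]
      ne2[OF x(2,3) _ z(1,3)] ne2[OF x(2,4) _ z(1,5)] ne2[OF x(3,4) _ z(3,5)]
    by (auto simp: nbr_def)
  moreover have "set [c, x1, x2, x3, z1, z2, z3] \<subseteq> S" using c x z by (auto simp: nbr_def)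
  ultimately show False
    using spider_222_infinite[of c x1 x2 x3 z1 z2 z3] fin x z unfolding nbr_def by blast
qed

text \<open>Removing a leaf \<open>x\<close> next to the branch vertex leaves a connected set
  without vertices of degree 3, hence a path through \<open>c\<close>.\<close>

lemma branch_listed:
  assumes K: "conn K" "closed K" and c: "c \<in> K" "branch c"
  shows "listed K"
proof -
  have KS: "K \<subseteq> S" using K(1) by (simp add: conn_def)
  have cS: "c \<in> S" using c KS by blast
  have nbrK: "y \<in> K" if "nbr x y" "x \<in> K" for x y
    using that K(2) by (auto simp: nbr_def closed_def)
  have lab: "m v w = 3" if "v \<in> K" "nbr v w" for v w
    using no_heavy_edge_if_branch[OF K(1) c that(1) nbrK[OF that(2,1)]] that by (auto simp: nbr_def)
  obtain x1 x2 x3 where x123: "distinct [x1, x2, x3]" "nbr c x1" "nbr c x2" "nbr c x3"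
    using c(2) unfolding branch_def by blast
  obtain x where x: "x \<in> {x1, x2, x3}" "\<And>r. nbr x r \<Longrightarrow> r = c"
    using branch_has_leaf[OF cS x123] by blast
  obtain a b where ab: "a \<noteq> b" "nbr c a" "nbr c b" "a \<noteq> x" "b \<noteq> x"
  proof -
    have "\<exists>a b. a \<noteq> b \<and> nbr c a \<and> nbr c b \<and> a \<noteq> x \<and> b \<noteq> x"
    proof (cases "x = x1")
      case True
      then show ?thesis using x123 by (intro exI[of _ x2] exI[of _ x3]) auto
    next
      case False
      show ?thesis
      proof (cases "x = x2")
        case True
        then show ?thesis using x123 False by (intro exI[of _ x1] exI[of _ x3]) auto
      qed (use x123 False in \<open>intro exI[of _ x1] exI[of _ x2]; auto\<close>)
    qed
    then show thesis using that by blast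
  qed
  have cx: "nbr c x" using x(1) x123 by auto
  have xc: "x \<in> K" "x \<noteq> c" "x \<in> S" using nbrK[OF cx c(1)] cx KS by (auto simp: nbr_def)
  let ?X = "K - {x}"
  have conn: "conn ?X"
    unfolding conn_def
  proof (intro conjI allI impI)
    show "?X \<subseteq> S" "?X \<noteq> {}" using KS c(1) xc by auto
    fix Y assume Y: "Y \<subseteq> ?X" "Y \<noteq> {}" "Y \<noteq> ?X"
    \<comment> \<open>A cut of \<open>K - {x}\<close> becomes a cut of \<open>K\<close> when
      \<open>x\<close> is put on the side of its only neighbour \<open>c\<close>.\<close>
    define Z where "Z = (if c \<in> Y then insert x Y else Y)"
    have "Z \<subseteq> K" "Z \<noteq> {}" "Z \<noteq> K" using Y xc by (auto simp: Z_def split: if_splits)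
    then obtain v w where vw: "v \<in> Z" "w \<in> K - Z" "linked v w" using K(1) unfolding conn_def by blast
    have vwS: "v \<in> S" "w \<in> S" "v \<noteq> w" using vw \<open>Z \<subseteq> K\<close> KS by auto
    have "v \<noteq> x"
    proof
      assume "v = x"
      then have "w = c" using x(2)[of w] vw vwS by (simp add: nbr_def)
      moreover have "c \<in> Y" using \<open>v = x\<close> vw Y by (auto simp: Z_def split: if_splits)
      ultimately show False using vw by (simp add: Z_def)
    qed
    moreover have "w \<noteq> x"
    proof
      assume w: "w = x"
      then have "v = c" using x(2)[of v] linked_sym[OF vwS(1,2) vw(3)] vwS by (simp add: nbr_def)
      then show False using vw w Y by (auto simp: Z_def split: if_splits)
    qed
    ultimately show "\<exists>v\<in>Y. \<exists>w\<in>?X - Y. linked v w"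
      using vw by (intro bexI[of _ v] bexI[of _ w]) (auto simp: Z_def split: if_splits)
  qed
  have "\<exists>p. lpath p \<and> set p = ?X"
  proof (rule path_cover[OF conn])
    fix v y1 y2 y3
    assume v: "v \<in> ?X" and y: "distinct [y1, y2, y3]" "{y1, y2, y3} \<subseteq> ?X" "nbr v y1" "nbr v y2" "nbr v y3"
    then have "branch v" using KS by (auto simp: branch_def)
    then have "v = c" using branch_unique[OF K(1) _ _ c] v by blast
    then show False using degree_le_3[OF cS, of x y1 y2 y3] y cx by auto
  qed
  then obtain p where p: "lpath p" "set p = ?X" by blast
  have pS: "set p \<subseteq> S" "distinct p" using p by (simp_all add: lpath_def)
  have pl: "pathlike p (\<lambda>_. 3)"
  proof (rule pathlike_cong[OF lpath_pathlike[OF p(1)]])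
    fix i assume i: "Suc i < length p"
    then have "p ! i \<in> K" "p ! Suc i \<in> S" "p ! i \<noteq> p ! Suc i" using p pS nth_mem[of i p] nth_mem[of "Suc i" p]
      by (auto simp: nth_eq_iff_index_eq)
    then show "m (p ! i) (p ! Suc i) = 3"
      using lab[of "p ! i" "p ! Suc i"] lpath_linked_Suc[OF p(1) i] by (simp add: nbr_def)
  qed
  obtain j where j: "j < length p" "p ! j = c" using c(1) xc p(2) by (metis DiffI in_set_conv_nth singletonD)
  have pos: "k = Suc j \<or> j = Suc k" if "k < length p" "nbr c (p ! k)" for k
  proof -
    have "linked (p ! j) (p ! k)" "linked (p ! k) (p ! j)" "j \<noteq> k"
      using that j cS linked_sym[of c "p ! k"] by (auto simp: nbr_def)
    then show ?thesis using pl j(1) that(1) unfolding pathlike_def by (metis linorder_neqE_nat)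
  qed
  have "a \<in> set p" "b \<in> set p" using ab nbrK[OF _ c(1)] p(2) by auto
  then obtain ka kb where k: "ka < length p" "p ! ka = a" "kb < length p" "p ! kb = b"
    by (metis in_set_conv_nth)
  then have "ka = Suc j \<or> j = Suc ka" "kb = Suc j \<or> j = Suc kb" "ka \<noteq> kb"
    using pos[of ka] pos[of kb] ab by auto
  then have j2: "0 < j" "Suc j < length p" using k by auto
  have xnot: "x \<notin> set p" "K = insert x (set p)" using p(2) xc by auto
  have mx: "m x (p ! i) = (if i = j then 3 else 2)" if i: "i < length p" for i
  proof (cases "i = j")
    case True
    have "m x c = 3" using lab[OF c(1) cx] m_sym[OF cS xc(3)] by simp
    then show ?thesis using True j by simp
  next
    case False
    have "p ! i \<in> set p" using i by simp
    moreover have "p ! i \<noteq> c" using False i j pS by (metis nth_eq_iff_index_eq)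
    ultimately have "\<not> nbr x (p ! i)" using x(2) by blast
    then show ?thesis using False \<open>p ! i \<in> set p\<close> pS xnot by (auto simp: nbr_def)
  qed
  show ?thesis
  proof (rule spider_listed[OF pS(2,1) pl xnot mx j2])
    show "j < 3 \<or> length p \<le> j + 3"
    proof (rule ccontr)
      assume "\<not> ?thesis"
      then obtain h where h: "j = h + 3" and j3: "h + 6 < length p"
        using le_Suc_ex[of 3 j] by (auto simp: add.commute)
      \<comment> \<open>A window of seven vertices centred at \<open>q 3 = c\<close>: with
        \<open>x\<close> it would be a spider with legs 1, 3, 3.\<close>
      define q where "q i = p ! (h + i)" for i
      have q: "distinct [q 3, x, q 2, q 1, q 0, q 4, q 5, q 6]"
        using j3 pS xnot by (auto simp: q_def nth_eq_iff_index_eq)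
      have qS: "q i \<in> S" if "i \<le> 6" for i
        using that j3 pS nth_mem[of "h + i" p] by (auto simp: q_def)
      have ql: "linked (q i) (q (Suc i))" if "i < 6" for i
        using that j3 lpath_linked_Suc[OF p(1), of "h + i"] by (simp add: q_def)
      have ql': "linked (q (Suc i)) (q i)" if "i < 6" for i
        using ql[OF that] linked_sym qS that by simp
      have "q 3 = c" using j h by (simp add: q_def)
      then have "linked (q 3) x" using cx by (simp add: nbr_def)
      then show False
        using spider_133_infinite[OF q] fin qS xc ql'[of 2] ql'[of 1] ql'[of 0] ql[of 3] ql[of 4] ql[of 5]
        by (simp add: numeral_eq_Suc)
    qed
  qed
qed

text \<open>By \<open>half\<close>, at least as many vertices lie behind the heavy edge as before
  it. So one vertex before a label 5, or two before a label 4, have counterparts behind it, and a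
  forbidden path appears.\<close>

lemma heavy_path_listed:
  assumes p: "lpath p" and i: "Suc i < length p" and k: "m (p ! i) (p ! Suc i) = enat k" "4 \<le> k"
    and rest: "\<And>j. Suc j < length p \<Longrightarrow> j \<noteq> i \<Longrightarrow> m (p ! j) (p ! Suc j) = 3"
    and half: "2 * i + 2 \<le> length p"
  shows "listed (set p)"
proof -
  have pS: "set p \<subseteq> S" "distinct p" using p by (simp_all add: lpath_def)
  have S: "p ! a \<in> S" if "a < length p" for a using that pS nth_mem by blast
  have l: "linked (p ! a) (p ! Suc a)" "linked (p ! Suc a) (p ! a)" if "Suc a < length p" for a
    using lpath_linked_Suc[OF p that] linked_sym S that by simp_all
  have ne: "p ! a = p ! b \<longleftrightarrow> a = b" if "a < length p" "b < length p" for a b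
    using that pS by (simp add: nth_eq_iff_index_eq)
  have k': "m (p ! Suc i) (p ! i) = enat k" using k m_sym[of "p ! i" "p ! Suc i"] S i by simp
  have pt: "path_type (set p) (length p) l" if "\<And>j. Suc j < length p \<Longrightarrow> l j = (if j = i then enat k else 3)" for l
  proof -
    have "pathlike p l"
      by (rule pathlike_cong[OF lpath_pathlike[OF p]]) (use that rest k in simp)
    then show ?thesis unfolding path_type_def using pS by blast
  qed
  show ?thesis
  proof (cases "length p = 2")
    case True
    then have i0: "i = 0" using i by simp
    show ?thesis
    proof (cases "k = 4")
      case True
      then have "path_type (set p) 2 (\<lambda>i. if i = 0 then 4 else 3)"
        using pt[of "\<lambda>i. if i = 0 then 4 else 3"] \<open>length p = 2\<close> i0 by (simp add: numeral_eq_enat)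
      then show ?thesis unfolding listed_def by blast
    next
      case False
      then have "5 \<le> k" using k by simp
      moreover have "path_type (set p) 2 (\<lambda>_. enat k)"
        using pt[of "\<lambda>_. enat k"] \<open>length p = 2\<close> i0 by simp
      ultimately show ?thesis unfolding listed_def by blast
    qed
  next
    case False
    then have n3: "3 \<le> length p" using i by simp
    have k5: "k < 6"
    proof (rule ccontr)
      assume "\<not> k < 6"
      then have m6: "enat 6 \<le> m (p ! i) (p ! Suc i)" "enat 6 \<le> m (p ! Suc i) (p ! i)" using k k' by auto
      show False
      proof (cases i)
        case 0
        have n: "0 < length p" "Suc 0 < length p" "Suc (Suc 0) < length p" using n3 by linarith+
        have "distinct [p ! Suc (Suc 0), p ! Suc 0, p ! 0]"
          using ne[OF n(3,2)] ne[OF n(3,1)] ne[OF n(2,1)] by simp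
        then show ?thesis
          using path_36_infinite[of "p ! Suc (Suc 0)" "p ! Suc 0" "p ! 0"] fin m6 0 S[OF n(1)] S[OF n(2)]
            S[OF n(3)] l[OF n(3)] by simp
      next
        case (Suc a)
        then show ?thesis
          using path_36_infinite[of "p ! a" "p ! i" "p ! Suc i"] fin m6 n3 ne S l[of a] i
          by simp
      qed
    qed
    show ?thesis
    proof (cases "k = 5")
      case True
      have "i = 0"
      proof (rule ccontr)
        assume "i \<noteq> 0"
        then obtain a where a: "i = Suc a" by (cases i) auto
        then have "Suc (Suc i) < length p" using half by simp
        then show False
          using path_353_infinite[of "p ! a" "p ! i" "p ! Suc i" "p ! Suc (Suc i)"] fin k True ne S
            l[of a] l[of "Suc i"] i a by simp
      qed
      then have "path_type (set p) (length p) (\<lambda>i. if i = 0 then 5 else 3)"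
        using pt[of "\<lambda>i. if i = 0 then 5 else 3"] True by (simp add: numeral_eq_enat)
      then show ?thesis unfolding listed_def using n3 by blast
    next
      case False
      then have k4: "k = 4" using k k5 by simp
      consider "i = 0" | "i = 1" | a where "i = Suc (Suc a)" by (metis One_nat_def not0_implies_Suc)
      then show ?thesis
      proof cases
        case 1
        then have "path_type (set p) (length p) (\<lambda>i. if i = 0 then 4 else 3)"
          using pt[of "\<lambda>i. if i = 0 then 4 else 3"] k4 by (simp add: numeral_eq_enat)
        moreover have "2 \<le> length p" using n3 by simp
        ultimately show ?thesis unfolding listed_def by blast
      next
        case 2
        then have "path_type (set p) (length p) (\<lambda>i. if i = 1 then 4 else 3)"
          using pt[of "\<lambda>i. if i = 1 then 4 else 3"] k4 by (simp add: numeral_eq_enat)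
        moreover have "4 \<le> length p" using half 2 by simp
        ultimately show ?thesis unfolding listed_def by blast
      next
        case 3
        then have "Suc (Suc (Suc i)) < length p" using half by simp
        then have False
          using path_33433_infinite[of "p ! a" "p ! Suc a" "p ! i" "p ! Suc i" "p ! Suc (Suc i)" "p ! Suc (Suc (Suc i))"]
            fin k k4 ne S l[of a] l[of "Suc a"] l[of "Suc i"] l[of "Suc (Suc i)"] i 3 by simp
        then show ?thesis ..
      qed
    qed
  qed
qed

text \<open>The path between two heavy edges would end in a gadget on either side.\<close>

lemma heavy_edge_unique:
  assumes p: "lpath p" and ij: "i < j" "Suc j < length p" and heavy: "m (p ! i) (p ! Suc i) \<noteq> 3" "m (p ! j) (p ! Suc j) \<noteq> 3"
  shows False
proof -
  have pS: "set p \<subseteq> S" "distinct p" using p by (simp_all add: lpath_def)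
  have S: "p ! a \<in> S" if "a < length p" for a using that pS nth_mem by blast
  obtain x A y where A: "p = x @ A @ y" "lpath A" "A \<noteq> []" "hd A = p ! Suc i" "last A = p ! j"
    "length A = Suc j - Suc i" "length x = Suc i"
    using lpath_slice[OF p, of "Suc i" j] ij by auto
  have "p ! i \<in> set x" "p ! Suc j \<in> set y"
  proof -
    have "p ! i = x ! i" using A by (simp add: nth_append)
    then show "p ! i \<in> set x" using A by simp
    have "p ! Suc j = y ! 0" "0 < length y" using A ij by (simp_all add: nth_append)
    then show "p ! Suc j \<in> set y" by (metis nth_mem)
  qed
  then have "distinct ([p ! i] @ A @ [p ! Suc j])" using pS(2) unfolding A(1) by auto
  moreover have "linked (p ! Suc i) (p ! i)" "m (p ! Suc i) (p ! i) \<noteq> 3"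
    using lpath_linked_Suc[OF p, of i] S[of i] S[of "Suc i"] ij heavy(1) m_sym[of "p ! i" "p ! Suc i"] by auto
  moreover have "linked (p ! j) (p ! Suc j)" using lpath_linked_Suc[OF p ij(2)] .
  ultimately show False
    using no_double_end[OF A(2,3), of "[p ! i]" "[p ! Suc j]"] A(4,5) S[of i] S[of "Suc j"] ij heavy
    by (simp add: gadget_def)
qed

lemma path_listed:
  assumes p: "lpath p" "p \<noteq> []"
  shows "listed (set p)"
proof (cases "\<forall>i. Suc i < length p \<longrightarrow> m (p ! i) (p ! Suc i) = 3")
  case True
  then have "pathlike p (\<lambda>_. 3)" by (intro pathlike_cong[OF lpath_pathlike[OF p(1)]]) auto
  then have "path_type (set p) (length p) (\<lambda>_. 3)" using p(1) by (auto simp: path_type_def lpath_def)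
  moreover have "1 \<le> length p" using p(2) by (cases p) auto
  ultimately show ?thesis unfolding listed_def by blast
next
  case False
  then obtain i where i: "Suc i < length p" "m (p ! i) (p ! Suc i) \<noteq> 3" by blast
  have pS: "set p \<subseteq> S" "distinct p" using p by (simp_all add: lpath_def)
  have S: "p ! a \<in> S" if "a < length p" for a using that pS nth_mem by blast
  have rest: "m (p ! j) (p ! Suc j) = 3" if "Suc j < length p" "j \<noteq> i" for j
    using heavy_edge_unique[OF p(1), of i j] heavy_edge_unique[OF p(1), of j i] that i by (metis linorder_neqE_nat)
  obtain k where k: "m (p ! i) (p ! Suc i) = enat k" using finite_label[of "p ! i" "p ! Suc i"] S[of i] S[of "Suc i"] i by auto
  have "m (p ! i) (p ! Suc i) \<ge> 1" "m (p ! i) (p ! Suc i) \<noteq> 1" "m (p ! i) (p ! Suc i) \<noteq> 2"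
    using m_ge_1[of "p ! i" "p ! Suc i"] m_eq_1[of "p ! i" "p ! Suc i"] S[of i] S[of "Suc i"] i pS
      lpath_linked_Suc[OF p(1) i(1)]
    by (auto simp: nth_eq_iff_index_eq)
  then have k4: "4 \<le> k" using k i(2) by (simp add: one_enat_def numeral_eq_enat)
  show ?thesis
  proof (cases "2 * i + 2 \<le> length p")
    case True
    then show ?thesis using heavy_path_listed[OF p(1) i(1) k k4 rest] by blast
  next
    case False
    let ?i = "length p - 2 - i"
    have rv: "m (rev p ! j) (rev p ! Suc j) = m (p ! (length p - 2 - j)) (p ! Suc (length p - 2 - j))"
      if "Suc j < length p" for j
    proof -
      have "length p - Suc j = Suc (length p - 2 - j)" using that by simp
      then show ?thesis using that S m_sym by (simp add: rev_nth)
    qed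
    have "listed (set (rev p))"
    proof (rule heavy_path_listed[OF lpath_rev[OF p(1)], of ?i k])
      show "Suc ?i < length (rev p)" "4 \<le> k" using i k4 by simp_all
      show "m (rev p ! ?i) (rev p ! Suc ?i) = enat k" 
      proof -
        have "length p - 2 - ?i = i" "Suc ?i < length p" using i(1) by simp_all
        then show ?thesis using rv[of ?i] k by simp
      qed
      show "m (rev p ! j) (rev p ! Suc j) = 3" if "Suc j < length (rev p)" "j \<noteq> ?i" for j
        using rv[of j] rest[of "length p - 2 - j"] that i by auto
      show "2 * ?i + 2 \<le> length (rev p)" using False i by simp
    qed
    then show ?thesis by simp
  qed
qed

lemma conn_closed_listed:
  assumes K: "conn K" "closed K"
  shows "listed K"
proof (cases "\<exists>c\<in>K. branch c")
  case True
  then show ?thesis using branch_listed[OF K] by blast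
next
  case False
  have "\<exists>p. lpath p \<and> set p = K"
    by (rule path_cover[OF K(1)]) (use False K(1) in \<open>auto simp: branch_def conn_def\<close>)
  then obtain p where p: "lpath p" "set p = K" by blast
  then show ?thesis using path_listed[OF p(1)] K(1) by (auto simp: conn_def)
qed

end

section \<open>Listed graphs have finitely many FC elements\<close>

context coxeter
begin

lemma pathlike_nbr:
  assumes "pathlike p l" "set p \<subseteq> S" "k < length p" "r \<in> set p" "linked (p ! k) r"
  shows "r = p ! k \<or> (0 < k \<and> r = p ! (k - 1)) \<or> (Suc k < length p \<and> r = p ! Suc k)"
proof -
  obtain i where i: "i < length p" "r = p ! i" using assms(4) by (metis in_set_conv_nth)
  have S: "p ! k \<in> S" "p ! i \<in> S" using assms(2,3) i nth_mem by blast+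
  then have "linked (p ! i) (p ! k)" using assms(5) i linked_sym by simp
  then have "i = k \<or> i = Suc k \<or> k = Suc i"
    using assms(1,3,5) i unfolding pathlike_def by (metis linorder_neqE_nat)
  then show ?thesis using i by auto
qed

lemma arm_drop:
  assumes p: "pathlike p l" "set p \<subseteq> S"
    and nb: "\<And>k r. i < k \<Longrightarrow> k < length p \<Longrightarrow> r \<in> S \<Longrightarrow> linked (p ! k) r \<Longrightarrow> r \<in> set p"
    and l: "\<And>k. i < k \<Longrightarrow> Suc k < length p \<Longrightarrow> l k = 3"
  shows "arm (p ! i) (drop (Suc i) p)"
  using nb l
proof (induction "length p - i" arbitrary: i rule: less_induct)
  case less
  show ?case
  proof (cases "Suc i < length p")
    case True
    let ?k = "Suc i"
    have d: "drop ?k p = p ! ?k # drop (Suc ?k) p" using True by (simp add: Cons_nth_drop_Suc)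
    have t: "take 1 (drop (Suc ?k) p) = (if Suc ?k < length p then [p ! Suc ?k] else [])"
      by (simp add: take_Suc_conv_app_nth)
    have "arm (p ! ?k) (drop (Suc ?k) p)"
    proof (rule less.hyps)
      show "length p - ?k < length p - i" using True by simp
      show "r \<in> set p" if "?k < k" "k < length p" "r \<in> S" "linked (p ! k) r" for k r
        using less.prems(1)[of k r] that by simp
      show "l k = 3" if "?k < k" "Suc k < length p" for k using less.prems(2)[of k] that by simp
    qed
    moreover have "p ! ?k \<in> S" using True p(2) nth_mem by blast
    moreover have "r = p ! ?k \<or> r = p ! i \<or> r \<in> set (take 1 (drop (Suc ?k) p))"
      if "r \<in> S" "linked (p ! ?k) r" for r
      using pathlike_nbr[OF p True less.prems(1)[OF _ True that] that(2)] t by auto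
    moreover have "\<forall>e\<in>set (take 1 (drop (Suc ?k) p)). m (p ! ?k) e = 3"
      using p(1) less.prems(2)[of ?k] unfolding t by (auto simp: pathlike_def)
    ultimately show ?thesis unfolding d arm.simps by blast
  qed simp
qed

lemma nth_cases:
  assumes "s \<in> set p" "i < length p" "\<And>k. k < i \<Longrightarrow> P (p ! k)" "P (p ! i)"
    "\<And>d. d \<in> set (drop (Suc i) p) \<Longrightarrow> P d"
  shows "P s"
proof -
  have "s \<in> set (take i p) \<or> s = p ! i \<or> s \<in> set (drop (Suc i) p)"
    using assms(1) id_take_nth_drop[OF assms(2)] by (metis Un_iff set_append set_ConsD)
  moreover have "P s" if h: "s \<in> set (take i p)"
  proof -
    obtain k where "k < length (take i p)" "s = take i p ! k" using h by (metis in_set_conv_nth)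
    then show ?thesis using assms(3)[of k] by simp
  qed
  ultimately show ?thesis using assms(4,5) by blast
qed

context
  fixes p l
  assumes p: "distinct p" "pathlike p l" "closed (set p)"
begin

lemma path_S: "set p \<subseteq> S"
  using p(3) by (simp add: closed_def)

lemma path_in_S: "k < length p \<Longrightarrow> p ! k \<in> S"
  using path_S nth_mem by blast

lemma path_nbr:
  assumes "k < length p" "r \<in> S" "linked (p ! k) r"
  shows "r = p ! k \<or> (0 < k \<and> r = p ! (k - 1)) \<or> (Suc k < length p \<and> r = p ! Suc k)"
proof -
  have "r \<in> set p" using assms p(3) nth_mem[of k p] unfolding closed_def by blast
  then show ?thesis using pathlike_nbr[OF p(2) path_S assms(1) _ assms(3)] by blast
qed

lemma path_arm:
  assumes "\<And>k. i < k \<Longrightarrow> Suc k < length p \<Longrightarrow> l k = 3" "Suc i < length p"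
  shows "arm (p ! i) (p ! Suc i # drop (Suc (Suc i)) p)"
proof -
  have "arm (p ! i) (drop (Suc i) p)"
  proof (rule arm_drop[OF p(2) path_S])
    show "r \<in> set p" if "k < length p" "r \<in> S" "linked (p ! k) r" for k r
      using that p(3) nth_mem[of k p] unfolding closed_def by blast
  qed (rule assms(1))
  then show ?thesis using assms(2) by (simp add: Cons_nth_drop_Suc del: arm.simps)
qed

lemma path_label: "Suc k < length p \<Longrightarrow> m (p ! k) (p ! Suc k) = l k" "Suc k < length p \<Longrightarrow> m (p ! Suc k) (p ! k) = l k"
  using p(2) m_sym[OF path_in_S[of k] path_in_S[of "Suc k"]] by (auto simp: pathlike_def)

lemma path_ne: "a < length p \<Longrightarrow> b < length p \<Longrightarrow> p ! a = p ! b \<longleftrightarrow> a = b"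
  using p(1) by (simp add: nth_eq_iff_index_eq)

lemma path_A_bounded:
  assumes "\<And>k. Suc k < length p \<Longrightarrow> l k = 3" "s \<in> set p"
  shows "bounded_letter s"
proof (cases "length p = 1")
  case True
  then have "s = p ! 0" using assms(2) by (cases p) auto
  moreover have "count_list u (p ! 0) \<le> 1" if "fcw u" for u
    by (rule bounded_isolated[OF _ that]) (use path_nbr[of 0] True in auto)
  ultimately show ?thesis using bounded_letterI by blast
next
  case False
  then have n: "Suc 0 < length p" "0 < length p" using assms(2) by (cases p; auto)+
  note arm = path_arm[OF assms(1) n(1)]
  have b: "bounded_letter (p ! 0)"
  proof (rule bounded_letterI[OF bounded_end[OF arm _ path_in_S]])
    show "m (p ! 0) (p ! Suc 0) = 3" using path_label(1)[OF n(1)] assms(1)[OF n(1)] by simp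
  qed (use path_nbr[of 0] n in auto)
  show ?thesis
    by (rule nth_cases[OF assms(2), of 0])
      (use n b bounded_letter_arm[OF arm b] in \<open>auto simp: Cons_nth_drop_Suc\<close>)
qed

text \<open>The centre is \<open>p ! 1\<close>, with \<open>b = p ! 0\<close> a leaf across the
  heavy edge.\<close>

lemma path_45_bounded:
  assumes "3 \<le> length p" "l 0 = 4 \<or> l 0 = 5" "\<And>k. 0 < k \<Longrightarrow> Suc k < length p \<Longrightarrow> l k = 3" "s \<in> set p"
  shows "bounded_letter s"
proof -
  have n: "0 < length p" "Suc 0 < length p" "Suc (Suc 0) < length p" using assms(1) by linarith+
  have arm: "arm (p ! Suc 0) (p ! Suc (Suc 0) # drop (Suc (Suc (Suc 0))) p)"
    using assms(3) n by (intro path_arm) auto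
  have armb: "arm (p ! Suc 0) [p ! 0]"
    using path_in_S[OF n(1)] path_nbr[of 0] n by auto
  have m3: "m (p ! Suc 0) (p ! Suc (Suc 0)) = 3" using path_label(1)[OF n(3)] assms(3)[OF _ n(3)] by simp
  have mb: "m (p ! Suc 0) (p ! 0) = l 0" using path_label(2)[OF n(2)] .
  have nbrs: "r = p ! Suc 0 \<or> r = p ! 0 \<or> r = p ! Suc (Suc 0)" if "r \<in> S" "linked (p ! Suc 0) r" for r
    using path_nbr[OF n(2) that] by auto
  have ne: "p ! 0 \<noteq> p ! Suc (Suc 0)" using path_ne n by simp
  have b: "bounded_letter (p ! Suc 0)"
  proof (rule bounded_letterI)
    show "count_list u (p ! Suc 0) \<le> 3 * length (drop (Suc (Suc (Suc 0))) p) + 6" if f: "fcw u" for u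
    proof (cases "l 0 = 4")
      case True
      show ?thesis
        by (rule bounded_4[OF arm armb _ m3 _ path_in_S[OF n(2)] ne nbrs f]) (use True mb in simp_all)
    next
      case False
      show ?thesis
        by (rule bounded_5[OF arm armb m3 _ path_in_S[OF n(2)] ne nbrs f]) (use False assms(2) mb in simp_all)
    qed
  qed
  show ?thesis
    by (rule nth_cases[OF assms(4) n(2)])
      (use n b bounded_letter_arm[OF arm b] bounded_letter_arm[OF armb b] in \<open>auto simp: Cons_nth_drop_Suc\<close>)
qed

text \<open>The centre is \<open>p ! 2\<close>; now \<open>b = p ! 1\<close> has the outer neighbour
  \<open>p ! 0\<close>.\<close>

lemma path_F_bounded:
  assumes "4 \<le> length p" "l 1 = 4" "\<And>k. k \<noteq> 1 \<Longrightarrow> Suc k < length p \<Longrightarrow> l k = 3" "s \<in> set p"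
  shows "bounded_letter s"
proof -
  let ?c = "Suc (Suc 0)"
  have n: "0 < length p" "Suc 0 < length p" "?c < length p" "Suc ?c < length p" using assms(1) by linarith+
  have arm: "arm (p ! ?c) (p ! Suc ?c # drop (Suc (Suc ?c)) p)"
    using assms(3) n by (intro path_arm) auto
  have armb: "arm (p ! ?c) [p ! Suc 0, p ! 0]"
    using path_in_S[OF n(1)] path_in_S[OF n(2)] path_nbr[of 0] path_nbr[of "Suc 0"] n
      path_label(2)[OF n(2)] assms(3)[of 0] by auto
  have m3: "m (p ! ?c) (p ! Suc ?c) = 3" using path_label(1)[OF n(4)] assms(3)[OF _ n(4)] by simp
  have mb: "m (p ! ?c) (p ! Suc 0) = 4" using path_label(2)[OF n(3)] assms(2) by simp
  have nbrs: "r = p ! ?c \<or> r = p ! Suc 0 \<or> r = p ! Suc ?c" if "r \<in> S" "linked (p ! ?c) r" for r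
    using path_nbr[OF n(3) that] by auto
  have ne: "p ! Suc 0 \<noteq> p ! Suc ?c" using path_ne n by simp
  have b: "bounded_letter (p ! ?c)"
    by (rule bounded_letterI[OF bounded_4[OF arm armb _ m3 mb path_in_S[OF n(3)] ne nbrs]]) simp_all
  show ?thesis
    by (rule nth_cases[OF assms(4) n(3)])
      (use n b bounded_letter_arm[OF arm b] bounded_letter_arm[OF armb b] in \<open>auto simp: Cons_nth_drop_Suc less_Suc_eq\<close>)
qed

lemma path_I_bounded:
  assumes n: "length p = 2" and k: "l 0 = enat k" "3 \<le> k" and s: "s \<in> set p"
  shows "bounded_letter s"
proof -
  have n': "0 < length p" "Suc 0 < length p" using n by simp_all
  have nbrs: "r = p ! 0 \<or> r = p ! Suc 0" if "r \<in> S" "linked (p ! 0) r \<or> linked (p ! Suc 0) r" for r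
    using that path_nbr[OF n'(1)] path_nbr[OF n'(2)] n by auto
  have mm: "m (p ! 0) (p ! Suc 0) = enat k" "m (p ! Suc 0) (p ! 0) = enat k"
    using path_label[OF n'(2)] k by simp_all
  have "bounded_letter (p ! 0)"
    by (rule bounded_letterI[OF bounded_dihedral[OF mm(1) k(2) path_in_S[OF n'(1)] path_in_S[OF n'(2)]]])
      (use nbrs in auto)
  moreover have "bounded_letter (p ! Suc 0)"
    by (rule bounded_letterI[OF bounded_dihedral[OF mm(2) k(2) path_in_S[OF n'(2)] path_in_S[OF n'(1)]]])
      (use nbrs in auto)
  moreover have "s = p ! 0 \<or> s = p ! Suc 0"
    using s n by (metis in_set_conv_nth less_2_cases One_nat_def)
  ultimately show ?thesis by auto
qed

end

text \<open>The centre is the branch vertex, with \<open>x\<close> as the leaf \<open>e\<close>. On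
  the short side \<open>b = p ! (j - 1)\<close> has the outer neighbour \<open>p ! 0\<close> exactly
  in type E.\<close>

lemma spider_bounded:
  assumes p: "distinct p" "pathlike p (\<lambda>_. 3)" and x: "x \<notin> set p" "closed (insert x (set p))"
    and mx: "\<And>i. i < length p \<Longrightarrow> m x (p ! i) = (if i = j then 3 else 2)"
    and j: "j = 1 \<or> j = 2" "Suc j < length p" and s: "s \<in> insert x (set p)"
  shows "bounded_letter s"
proof -
  have S: "x \<in> S" "set p \<subseteq> S" using x(2) by (auto simp: closed_def)
  have pS: "p ! k \<in> S" if "k < length p" for k using S(2) that nth_mem by blast
  have lab: "m (p ! k) (p ! Suc k) = 3" "m (p ! Suc k) (p ! k) = 3" if "Suc k < length p" for k
    using p(2) that m_sym[OF pS[of k] pS[of "Suc k"]] by (auto simp: pathlike_def)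
  have nbr': "r \<in> set p \<or> r = x \<and> k = j" if "k < length p" "r \<in> S" "linked (p ! k) r" for k r
  proof -
    have "r \<in> insert x (set p)" using that x(2) nth_mem[of k p] unfolding closed_def by blast
    moreover have "k = j" if "r = x"
      using mx[OF \<open>k < length p\<close>] that \<open>linked (p ! k) r\<close> m_sym[OF S(1) pS[OF \<open>k < length p\<close>]]
      by (auto split: if_splits)
    ultimately show ?thesis by blast
  qed
  have nbrs: "r = p ! k \<or> (0 < k \<and> r = p ! (k - 1)) \<or> (Suc k < length p \<and> r = p ! Suc k) \<or> r = x \<and> k = j"
    if "k < length p" "r \<in> S" "linked (p ! k) r" for k r
    using nbr'[OF that] pathlike_nbr[OF p(2) S(2) that(1) _ that(3)] by blast
  let ?c = "p ! j"
  have jl: "j < length p" "0 < j" using j by auto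
  have arm: "arm ?c (p ! Suc j # drop (Suc (Suc j)) p)"
  proof -
    have "arm ?c (drop (Suc j) p)"
    proof (rule arm_drop[OF p(2) S(2)])
      show "r \<in> set p" if "j < k" "k < length p" "r \<in> S" "linked (p ! k) r" for k r
        using nbr'[OF that(2-4)] that(1) by blast
    qed simp
    then show ?thesis using j(2) by (simp add: Cons_nth_drop_Suc del: arm.simps)
  qed
  have armx: "arm ?c [x]"
  proof -
    have "r = x \<or> r = ?c" if r: "r \<in> S" "linked x r" for r
    proof -
      have "r \<in> insert x (set p)" using r x(2) unfolding closed_def by blast
      then show ?thesis using mx r(2) by (auto simp: in_set_conv_nth split: if_splits)
    qed
    then show ?thesis using S by auto
  qed
  define as where "as = (if j = 2 then [p ! 0] else [])"
  have armb: "arm ?c (p ! (j - 1) # as)"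
  proof (cases "j = 2")
    case True
    have "0 < length p" "Suc 0 < length p" using True j by auto
    then show ?thesis
      using True nbrs[of 0] nbrs[of "Suc 0"] pS[of 0] pS[of "Suc 0"] lab[of 0]
      by (auto simp: as_def numeral_2_eq_2)
  next
    case False
    moreover have "0 < length p" using jl by linarith
    ultimately show ?thesis using j nbrs[of 0] pS[of 0] by (auto simp: as_def)
  qed
  have ne: "p ! (j - 1) \<noteq> x" "p ! (j - 1) \<noteq> p ! Suc j" "x \<noteq> p ! Suc j"
  proof -
    have j1: "j - 1 < length p" using jl by simp
    show "p ! (j - 1) \<noteq> x" using nth_mem[OF j1] x(1) by metis
    show "x \<noteq> p ! Suc j" using nth_mem[OF j(2)] x(1) by metis
    show "p ! (j - 1) \<noteq> p ! Suc j" using nth_eq_iff_index_eq[OF p(1) j1 j(2)] by simp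
  qed
  have m3: "m ?c (p ! Suc j) = 3" "m ?c (p ! (j - 1)) = 3" "m ?c x = 3"
    using lab(1)[OF j(2)] lab(2)[of "j - 1"] jl mx[OF jl(1)] m_sym[OF S(1) pS[OF jl(1)]] by simp_all
  have b: "bounded_letter ?c"
  proof (rule bounded_letterI[OF bounded_branch[OF arm armb _ armx m3 pS[OF jl(1)] ne]])
    show "length as \<le> 1" by (simp add: as_def)
    show "r = ?c \<or> r = p ! (j - 1) \<or> r = x \<or> r = p ! Suc j" if "r \<in> S" "linked ?c r" for r
      using nbrs[OF jl(1) that] by auto
  qed
  show ?thesis
  proof (cases "s = x")
    case True
    then show ?thesis using bounded_letter_arm[OF armx b] by simp
  next
    case False
    then have sp: "s \<in> set p" using s by simp
    show ?thesis
    proof (rule nth_cases[OF sp jl(1)])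
      show "bounded_letter (p ! k)" if "k < j" for k
      proof -
        have "k = j - 1 \<or> (j = 2 \<and> k = 0)" using that j by auto
        then show ?thesis using bounded_letter_arm[OF armb b] by (auto simp: as_def)
      qed
      show "bounded_letter d" if "d \<in> set (drop (Suc j) p)" for d
        using bounded_letter_arm[OF arm b] that j(2) by (simp add: Cons_nth_drop_Suc)
    qed (rule b)
  qed
qed

lemma listed_bounded:
  assumes "listed K" "closed K" "s \<in> K"
  shows "bounded_letter s"
proof -
  have path: "bounded_letter s" if pt: "path_type K n l" and
    h: "(\<forall>k. l k = 3) \<or> (3 \<le> n \<and> (l 0 = 4 \<or> l 0 = 5) \<and> (\<forall>k>0. l k = 3)) \<or>
      (4 \<le> n \<and> l 1 = 4 \<and> (\<forall>k. k \<noteq> 1 \<longrightarrow> l k = 3)) \<or> (n = 2 \<and> (\<exists>k\<ge>3. l 0 = enat k))" for n l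
  proof -
    obtain p where p: "distinct p" "length p = n" "set p = K" "pathlike p l"
      using pt unfolding path_type_def by blast
    note * = p(1,4) assms(2)[folded p(3)]
    have s: "s \<in> set p" using p(3) assms(3) by simp
    from h consider "\<forall>k. l k = 3" | "3 \<le> n" "l 0 = 4 \<or> l 0 = 5" "\<forall>k>0. l k = 3"
      | "4 \<le> n" "l 1 = 4" "\<forall>k. k \<noteq> 1 \<longrightarrow> l k = 3"
      | k where "n = 2" "3 \<le> k" "l 0 = enat k"
      by blast
    then show ?thesis
    proof cases
      case 1
      then show ?thesis using path_A_bounded[OF * _ s] by blast
    next
      case 2
      then show ?thesis using path_45_bounded[OF * _ _ _ s] p(2) by blast
    next
      case 3
      then show ?thesis using path_F_bounded[OF * _ _ _ s] p(2) by blast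
    next
      case 4
      then show ?thesis using path_I_bounded[OF * _ _ _ s] p(2) by blast
    qed
  qed
  have spider: "bounded_letter s" if sp: "spider_type K n j" and n: "j = 1 \<and> 4 \<le> n \<or> j = 2 \<and> 6 \<le> n" for n j
  proof -
    obtain p x where p: "distinct p" "Suc (length p) = n" "x \<notin> set p" "K = insert x (set p)"
      "pathlike p (\<lambda>_. 3)" "\<And>i. i < length p \<Longrightarrow> m x (p ! i) = (if i = j then 3 else 2)"
      using sp unfolding spider_type_def by blast
    show ?thesis
      by (rule spider_bounded[OF p(1,5,3) _ p(6)]) (use n p(2,4) assms in auto)
  qed
  from assms(1) show ?thesis
    unfolding listed_def
  proof (elim disjE exE conjE)
    fix n assume "path_type K n (\<lambda>_. 3)"
    then show ?thesis by (rule path) simp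
  next
    fix n :: nat assume n: "2 \<le> n" and pt: "path_type K n (\<lambda>i. if i = 0 then 4 else 3)"
    \<comment> \<open>\<open>B_2\<close> has no third vertex and is treated as a dihedral group with
      label 4.\<close>
    have "3 \<le> n \<or> n = 2 \<and> (\<exists>k\<ge>3. (4 :: enat) = enat k)"
      using n by (auto simp: numeral_eq_enat)
    then show ?thesis by (intro path[OF pt]) auto
  next
    fix n assume "4 \<le> n" "spider_type K n 1"
    then show ?thesis using spider by blast
  next
    fix n assume "6 \<le> n" "spider_type K n 2"
    then show ?thesis using spider by blast
  next
    fix n assume "4 \<le> n" "path_type K n (\<lambda>i. if i = 1 then 4 else 3)"
    then show ?thesis by (intro path) auto
  next
    fix n assume "3 \<le> n" "path_type K n (\<lambda>i. if i = 0 then 5 else 3)"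
    then show ?thesis by (intro path) auto
  next
    fix k assume k: "5 \<le> k" "path_type K 2 (\<lambda>_. enat k)"
    moreover have "3 \<le> k" using k by simp
    ultimately show ?thesis by (intro path) auto
  qed
qed

end

section \<open>Graph isomorphisms\<close>

definition model_graph :: "nat \<Rightarrow> (nat \<Rightarrow> nat \<Rightarrow> enat) \<Rightarrow> nat labelled_graph" where
  "model_graph n M = ({1..n}, {({i, j}, M i j) | i j. 1 \<le> i \<and> i < j \<and> j \<le> n \<and> 3 \<le> M i j})"

text \<open>Graph vertices count from 1 and list positions from 0, hence the shift in
  \<open>l (i - 1)\<close>.\<close>

definition path_matrix :: "(nat \<Rightarrow> enat) \<Rightarrow> nat \<Rightarrow> nat \<Rightarrow> enat" where
  "path_matrix l i j = (if j = Suc i then l (i - 1) else 2)"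

definition spider_matrix :: "nat \<Rightarrow> nat \<Rightarrow> nat \<Rightarrow> nat \<Rightarrow> enat" where
  "spider_matrix n b i j = (if j = n then (if i = Suc b then 3 else 2) else if j = Suc i then 3 else 2)"

lemma path_edges_model:
  assumes "\<And>i. 3 \<le> l i" "\<And>i. l' (Suc i) = l i"
  shows "({1..n}, path_edges n l') = model_graph n (path_matrix l)"
proof -
  have "path_edges n l' = {({i, j}, path_matrix l i j) | i j. 1 \<le> i \<and> i < j \<and> j \<le> n \<and> 3 \<le> path_matrix l i j}"
    (is "?L = ?R")
  proof (intro equalityI subsetI)
    fix e assume "e \<in> ?L"
    then obtain i where i: "1 \<le> i" "i + 1 \<le> n" "e = ({i, i + 1}, l' i)" unfolding path_edges_def by blast
    have "path_matrix l i (Suc i) = l' i" using i(1) assms(2)[of "i - 1"] by (simp add: path_matrix_def)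
    moreover have "3 \<le> path_matrix l i (Suc i)" using assms(1) by (simp add: path_matrix_def)
    ultimately show "e \<in> ?R" using i by (intro CollectI exI[of _ i] exI[of _ "Suc i"]) simp
  next
    fix e assume "e \<in> ?R"
    then obtain i j where ij: "1 \<le> i" "j \<le> n" "3 \<le> path_matrix l i j" "e = ({i, j}, path_matrix l i j)" by blast
    then have "j = Suc i" by (auto simp: path_matrix_def split: if_splits)
    moreover have "path_matrix l i (Suc i) = l' i" using ij(1) assms(2)[of "i - 1"] by (simp add: path_matrix_def)
    ultimately show "e \<in> ?L" using ij unfolding path_edges_def by auto
  qed
  then show ?thesis by (simp add: model_graph_def)
qed

lemma spider_edges_model:
  assumes "Suc b < n"
  shows "({1..n}, insert ({Suc b, n}, 3) (path_edges (n - 1) (\<lambda>i. 3))) = model_graph n (spider_matrix n b)"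
proof -
  have "insert ({Suc b, n}, 3) (path_edges (n - 1) (\<lambda>i. 3)) =
    {({i, j}, spider_matrix n b i j) | i j. 1 \<le> i \<and> i < j \<and> j \<le> n \<and> 3 \<le> spider_matrix n b i j}"
    (is "?L = ?R")
  proof (intro equalityI subsetI)
    fix e assume e: "e \<in> ?L"
    show "e \<in> ?R"
    proof (cases "e = ({Suc b, n}, 3)")
      case True
      then show ?thesis
        using assms by (intro CollectI exI[of _ "Suc b"] exI[of _ n]) (simp add: spider_matrix_def)
    next
      case False
      then obtain i where i: "1 \<le> i" "i + 1 \<le> n - 1" "e = ({i, i + 1}, 3)"
        using e unfolding path_edges_def by blast
      then show ?thesis
        by (intro CollectI exI[of _ i] exI[of _ "Suc i"]) (auto simp: spider_matrix_def)
    qed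
  next
    fix e assume "e \<in> ?R"
    then obtain i j where ij: "1 \<le> i" "i < j" "j \<le> n" "3 \<le> spider_matrix n b i j"
      "e = ({i, j}, spider_matrix n b i j)" by blast
    then consider "j = n" "i = Suc b" "spider_matrix n b i j = 3"
      | "j \<noteq> n" "j = Suc i" "spider_matrix n b i j = 3"
      by (auto simp: spider_matrix_def split: if_splits)
    then show "e \<in> ?L"
    proof cases
      case 2
      then have "e = ({i, i + 1}, 3)" "i + 1 \<le> n - 1" using ij by auto
      then show ?thesis using ij(1) unfolding path_edges_def by blast
    qed (use ij in simp)
  qed
  then show ?thesis by (simp add: model_graph_def)
qed

lemma A_graph_model: "A_graph n = model_graph n (path_matrix (\<lambda>_. 3))"
  unfolding A_graph_def by (intro path_edges_model) simp_all

lemma B_graph_model: "B_graph n = model_graph n (path_matrix (\<lambda>i. if i = 0 then 4 else 3))"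
  unfolding B_graph_def by (intro path_edges_model) simp_all

lemma F_graph_model: "F_graph n = model_graph n (path_matrix (\<lambda>i. if i = 1 then 4 else 3))"
  unfolding F_graph_def by (intro path_edges_model) simp_all

lemma H_graph_model: "H_graph n = model_graph n (path_matrix (\<lambda>i. if i = 0 then 5 else 3))"
  unfolding H_graph_def by (intro path_edges_model) simp_all

lemma D_graph_model: "4 \<le> n \<Longrightarrow> D_graph n = model_graph n (spider_matrix n 1)"
  using spider_edges_model[of 1 n] unfolding D_graph_def by (simp add: numeral_2_eq_2)

lemma E_graph_model: "6 \<le> n \<Longrightarrow> E_graph n = model_graph n (spider_matrix n 2)"
  using spider_edges_model[of 2 n] unfolding E_graph_def by (simp add: numeral_3_eq_3)

lemma I2_graph_model:
  assumes "3 \<le> k"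
  shows "I2_graph k = model_graph 2 (path_matrix (\<lambda>_. enat k))"
proof -
  have "path_edges 2 (\<lambda>_. enat k) = {({1, 2}, enat k)}"
  proof (intro equalityI subsetI)
    fix e assume "e \<in> path_edges 2 (\<lambda>_. enat k)"
    then obtain i where "1 \<le> i" "i + 1 \<le> 2" "e = ({i, i + 1}, enat k)" unfolding path_edges_def by blast
    moreover from this have "i = 1" by simp
    ultimately show "e \<in> {({1, 2}, enat k)}" by (simp add: numeral_2_eq_2)
  next
    fix e assume "e \<in> {({1, 2 :: nat}, enat k)}"
    then show "e \<in> path_edges 2 (\<lambda>_. enat k)"
      unfolding path_edges_def by (auto intro!: exI[of _ 1])
  qed
  moreover have "{1..2} = {1, 2 :: nat}" by auto
  ultimately show ?thesis
    using path_edges_model[of "\<lambda>_. enat k" "\<lambda>_. enat k" 2] assms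
    unfolding I2_graph_def by (simp add: numeral_eq_enat)
qed

context coxeter
begin

lemma m_distinct: "s \<in> S \<Longrightarrow> t \<in> S \<Longrightarrow> s \<noteq> t \<Longrightarrow> m s t = 2 \<or> 3 \<le> m s t"
proof -
  assume st: "s \<in> S" "t \<in> S" "s \<noteq> t"
  have "1 \<le> m s t" "m s t \<noteq> 1" using m_ge_1[OF st(1,2)] m_eq_1[OF st(1,2)] st(3) by simp_all
  then show ?thesis by (cases "m s t") (auto simp: one_enat_def numeral_eq_enat)
qed

lemma coxeter_edge:
  assumes "s \<in> S" "t \<in> S"
  shows "({s, t}, k) \<in> snd (coxeter_graph S m) \<longleftrightarrow> k = m s t \<and> 3 \<le> m s t"
  using assms m_sym by (auto simp: coxeter_graph_def doubleton_eq_iff)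

text \<open>Non-edges carry no label in the graph, but for distinct vertices both sides then force
  the label 2, so the isomorphism preserves all labels.\<close>

lemma iso_model_iff:
  assumes M: "\<And>i j. 1 \<le> i \<Longrightarrow> i < j \<Longrightarrow> j \<le> n \<Longrightarrow> M i j = 2 \<or> 3 \<le> M i j"
  shows "graph_isomorphic (model_graph n M) (coxeter_graph S m) \<longleftrightarrow>
    (\<exists>f. bij_betw f {1..n} S \<and> (\<forall>i j. 1 \<le> i \<longrightarrow> i < j \<longrightarrow> j \<le> n \<longrightarrow> m (f i) (f j) = M i j))"
proof -
  let ?E = "{({i, j}, M i j) | i j. 1 \<le> i \<and> i < j \<and> j \<le> n \<and> 3 \<le> M i j}"
  let ?F = "\<lambda>f :: nat \<Rightarrow> 'a. (\<lambda>(e, l). (f ` e, l)) ` ?E"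
  have F: "({f i, f j}, k) \<in> ?F f \<longleftrightarrow> k = M i j \<and> 3 \<le> M i j"
    if f: "bij_betw f {1..n} S" and ij: "1 \<le> i" "i < j" "j \<le> n" for f i j k
  proof
    assume "({f i, f j}, k) \<in> ?F f"
    then obtain i' j' where h: "1 \<le> i'" "i' < j'" "j' \<le> n" "3 \<le> M i' j'" "f ` {i, j} = f ` {i', j'}" "k = M i' j'"
      by auto
    have "{i, j} = {i', j'}"
      using f h ij by (intro inj_on_image_eq_iff[THEN iffD1, of f "{1..n}", OF _ _ _ h(5)]) (auto simp: bij_betw_def)
    then show "k = M i j \<and> 3 \<le> M i j" using h ij by (auto simp: doubleton_eq_iff)
  next
    assume "k = M i j \<and> 3 \<le> M i j"
    then have "({i, j}, k) \<in> ?E" using ij by blast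
    then have "(\<lambda>(e, l). (f ` e, l)) ({i, j}, k) \<in> ?F f" by (rule imageI)
    then show "({f i, f j}, k) \<in> ?F f" by simp
  qed
  have key: "snd (coxeter_graph S m) = ?F f \<longleftrightarrow> (\<forall>i j. 1 \<le> i \<longrightarrow> i < j \<longrightarrow> j \<le> n \<longrightarrow> m (f i) (f j) = M i j)"
    if f: "bij_betw f {1..n} S" for f
  proof (intro iffI allI impI)
    fix i j assume eq: "snd (coxeter_graph S m) = ?F f" and ij: "1 \<le> i" "i < j" "j \<le> n"
    have S: "f i \<in> S" "f j \<in> S" using bij_betwE[OF f] ij by simp_all
    have ne: "f i \<noteq> f j" using inj_onD[OF bij_betw_imp_inj_on[OF f], of i j] ij by auto
    have "k = m (f i) (f j) \<and> 3 \<le> m (f i) (f j) \<longleftrightarrow> k = M i j \<and> 3 \<le> M i j" for k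
      using coxeter_edge[OF S, of k] F[OF f ij, of k] unfolding eq by blast
    then show "m (f i) (f j) = M i j" using m_distinct[OF S ne] M[OF ij] by metis
  next
    assume lab: "\<forall>i j. 1 \<le> i \<longrightarrow> i < j \<longrightarrow> j \<le> n \<longrightarrow> m (f i) (f j) = M i j"
    show "snd (coxeter_graph S m) = ?F f"
    proof (intro equalityI subsetI)
      fix e assume "e \<in> snd (coxeter_graph S m)"
      then obtain s t where st: "s \<in> S" "t \<in> S" "3 \<le> m s t" "e = ({s, t}, m s t)"
        by (auto simp: coxeter_graph_def)
      have ne: "s \<noteq> t" using st(1,3) m_self[of s] by auto
      have "s \<in> f ` {1..n}" "t \<in> f ` {1..n}" using st bij_betw_imp_surj_on[OF f] by simp_all
      then obtain i j where ij: "s = f i" "t = f j" "1 \<le> i" "i \<le> n" "1 \<le> j" "j \<le> n" by auto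
      have "i \<noteq> j" using ne ij by auto
      then consider "i < j" | "j < i" by linarith
      then show "e \<in> ?F f"
      proof cases
        case 1
        then show ?thesis using F[OF f ij(3) 1 ij(6), of "m s t"] lab ij st by simp
      next
        case 2
        have "m (f j) (f i) = M j i" using lab 2 ij by simp
        then show ?thesis using F[OF f ij(5) 2 ij(4), of "m s t"] ij st m_sym[of s t] by (simp add: insert_commute)
      qed
    next
      fix e assume "e \<in> ?F f"
      then obtain i j where ij: "1 \<le> i" "i < j" "j \<le> n" "3 \<le> M i j" "e = ({f i, f j}, M i j)" by auto
      have S: "f i \<in> S" "f j \<in> S" using bij_betwE[OF f] ij by simp_all
      show "e \<in> snd (coxeter_graph S m)" using coxeter_edge[OF S] lab ij by simp
    qed
  qed
  have V: "fst (coxeter_graph S m) = S" by (simp add: coxeter_graph_def)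
  show ?thesis
    unfolding graph_isomorphic_def model_graph_def fst_conv snd_conv V
    by (intro ex_cong1 conj_cong refl key)
qed

lemma bij_betw_list:
  "(\<exists>f. bij_betw f {1..n} A \<and> P (map f [1..<Suc n])) \<longleftrightarrow> (\<exists>p. distinct p \<and> length p = n \<and> set p = A \<and> P p)"
proof (intro iffI; elim exE conjE)
  fix f assume f: "bij_betw f {1..n} A" and P: "P (map f [1..<Suc n])"
  have "set [1..<Suc n] = {1..n}" by auto
  then have "distinct (map f [1..<Suc n])" "set (map f [1..<Suc n]) = A" using f
    by (auto simp: distinct_map bij_betw_def simp del: upt_Suc)
  then show "\<exists>p. distinct p \<and> length p = n \<and> set p = A \<and> P p" using P
    by (intro exI[of _ "map f [1..<Suc n]"]) (simp del: upt_Suc)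
next
  fix p assume p: "distinct p" "length p = n" "set p = A" "P p"
  let ?f = "\<lambda>i. p ! (i - 1)"
  have "map ?f [1..<Suc n] = p"
    using p(2) by (intro nth_equalityI) (auto simp del: upt_Suc)
  moreover have "bij_betw ?f {1..n} A"
  proof (rule bij_betw_byWitness[where f' = "\<lambda>a. Suc (THE i. i < n \<and> p ! i = a)"])
    have the: "(THE i. i < n \<and> p ! i = p ! k) = k" if "k < n" for k
      using that p by (intro the_equality) (auto simp: nth_eq_iff_index_eq)
    show "\<forall>a\<in>{1..n}. Suc (THE i. i < n \<and> p ! i = p ! (a - 1)) = a"
      using the by auto
    show "\<forall>a\<in>A. p ! (Suc (THE i. i < n \<and> p ! i = a) - 1) = a"
      using the p by (auto simp: in_set_conv_nth)
    show "?f ` {1..n} \<subseteq> A" using p by auto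
    show "(\<lambda>a. Suc (THE i. i < n \<and> p ! i = a)) ` A \<subseteq> {1..n}"
      using the p by (auto simp: in_set_conv_nth)
  qed
  ultimately show "\<exists>f. bij_betw f {1..n} A \<and> P (map f [1..<Suc n])" using p by metis
qed

lemma path_iso_iff:
  assumes l: "\<And>i. 3 \<le> l i"
  shows "graph_isomorphic (model_graph n (path_matrix l)) (coxeter_graph S m) \<longleftrightarrow> path_type S n l"
proof -
  have "(\<forall>i j. 1 \<le> i \<longrightarrow> i < j \<longrightarrow> j \<le> n \<longrightarrow> m (f i) (f j) = path_matrix l i j) \<longleftrightarrow>
      pathlike (map f [1..<Suc n]) l" for f
  proof (intro iffI allI impI)
    assume h: "\<forall>i j. 1 \<le> i \<longrightarrow> i < j \<longrightarrow> j \<le> n \<longrightarrow> m (f i) (f j) = path_matrix l i j"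
    show "pathlike (map f [1..<Suc n]) l"
      unfolding pathlike_def
    proof (intro allI impI)
      fix i j assume "i < j" "j < length (map f [1..<Suc n])"
      then show "m (map f [1..<Suc n] ! i) (map f [1..<Suc n] ! j) = (if j = Suc i then l i else 2)"
        using h[rule_format, of "Suc i" "Suc j"] by (simp add: path_matrix_def del: upt_Suc)
    qed
  next
    fix i j assume h: "pathlike (map f [1..<Suc n]) l" and ij: "1 \<le> i" "i < j" "j \<le> n"
    then show "m (f i) (f j) = path_matrix l i j"
      unfolding pathlike_def using h[unfolded pathlike_def, rule_format, of "i - 1" "j - 1"]
      by (auto simp: path_matrix_def simp del: upt_Suc)
  qed
  moreover have "path_matrix l i j = 2 \<or> 3 \<le> path_matrix l i j" for i j
    using l by (simp add: path_matrix_def)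
  ultimately show ?thesis
    using iso_model_iff[of n "path_matrix l"] bij_betw_list[of n S "\<lambda>p. pathlike p l"]
    unfolding path_type_def by simp
qed

text \<open>The extra vertex is listed last, so that one enumeration describes both the path and the
  extra vertex.\<close>

lemma spider_iso_iff:
  assumes n: "1 \<le> n"
  shows "graph_isomorphic (model_graph n (spider_matrix n b)) (coxeter_graph S m) \<longleftrightarrow> spider_type S n b"
proof -
  let ?Q = "\<lambda>q. pathlike (butlast q) (\<lambda>_. 3) \<and> (\<forall>i<n - 1. m (last q) (butlast q ! i) = (if i = b then 3 else 2))"
  have nth: "map f [1..<Suc n] ! i = f (Suc i)" if "i < n" for f :: "nat \<Rightarrow> 'a" and i
    using that by (simp del: upt_Suc)
  have last: "last (map f [1..<Suc n]) = f n" "butlast (map f [1..<Suc n]) = map f [1..<n]" for f :: "nat \<Rightarrow> 'a"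
    using n by simp_all
  have 1: "(\<forall>i j. 1 \<le> i \<longrightarrow> i < j \<longrightarrow> j \<le> n \<longrightarrow> m (f i) (f j) = spider_matrix n b i j) \<longleftrightarrow>
      ?Q (map f [1..<Suc n])" if f: "bij_betw f {1..n} S" for f
  proof -
    have S: "f i \<in> S" if "1 \<le> i" "i \<le> n" for i using f that by (auto simp: bij_betw_def)
    show ?thesis
      unfolding last
    proof (intro iffI conjI allI impI)
      assume h: "\<forall>i j. 1 \<le> i \<longrightarrow> i < j \<longrightarrow> j \<le> n \<longrightarrow> m (f i) (f j) = spider_matrix n b i j"
      show "pathlike (map f [1..<n]) (\<lambda>_. 3)"
        unfolding pathlike_def
      proof (intro allI impI)
        fix i j assume "i < j" "j < length (map f [1..<n])"
        then show "m (map f [1..<n] ! i) (map f [1..<n] ! j) = (if j = Suc i then 3 else 2)"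
          using h[rule_format, of "Suc i" "Suc j"] by (auto simp: spider_matrix_def)
      qed
      fix i assume i: "i < n - 1"
      then have "m (f (Suc i)) (f n) = (if i = b then 3 else 2)"
        using h[rule_format, of "Suc i" n] by (simp add: spider_matrix_def)
      then show "m (f n) (map f [1..<n] ! i) = (if i = b then 3 else 2)"
        using i m_sym[OF S[of n] S[of "Suc i"]] n by simp
    next
      fix i j assume h: "pathlike (map f [1..<n]) (\<lambda>_. 3) \<and>
        (\<forall>i<n - 1. m (f n) (map f [1..<n] ! i) = (if i = b then 3 else 2))"
        and ij: "1 \<le> i" "i < j" "j \<le> n"
      show "m (f i) (f j) = spider_matrix n b i j"
      proof (cases "j = n")
        case True
        obtain k where k: "i = Suc k" using ij by (cases i) auto
        then have "m (f n) (map f [1..<n] ! k) = (if k = b then 3 else 2)" using h ij True by simp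
        then have "m (f n) (f i) = (if i = Suc b then 3 else 2)" using k ij True by simp
        then show ?thesis using True m_sym[OF S[of n] S[of i]] ij by (simp add: spider_matrix_def)
      next
        case False
        obtain k l where kl: "i = Suc k" "j = Suc l" using ij by (cases i; cases j) auto
        have "k < l" "l < length (map f [1..<n])" using ij False kl by simp_all
        then have "m (map f [1..<n] ! k) (map f [1..<n] ! l) = (if l = Suc k then 3 else 2)"
          using h unfolding pathlike_def by blast
        then show ?thesis using ij False kl by (simp add: spider_matrix_def)
      qed
    qed
  qed
  have 2: "spider_type S n b \<longleftrightarrow> (\<exists>q. distinct q \<and> length q = n \<and> set q = S \<and> ?Q q)"
  proof
    assume "spider_type S n b"
    then obtain p x where p: "distinct p" "Suc (length p) = n" "x \<notin> set p" "S = insert x (set p)"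
      "pathlike p (\<lambda>_. 3)" "\<forall>i<length p. m x (p ! i) = (if i = b then 3 else 2)"
      unfolding spider_type_def by blast
    then show "\<exists>q. distinct q \<and> length q = n \<and> set q = S \<and> ?Q q"
      by (intro exI[of _ "p @ [x]"]) auto
  next
    assume "\<exists>q. distinct q \<and> length q = n \<and> set q = S \<and> ?Q q"
    then obtain q where q: "distinct q" "length q = n" "set q = S" "?Q q" by blast
    have "q \<noteq> []" using q(2) n by auto
    then have qq: "q = butlast q @ [last q]" by simp
    have "distinct (butlast q @ [last q])" "set (butlast q @ [last q]) = S" using q qq by simp_all
    then show "spider_type S n b"
      unfolding spider_type_def using q n by (intro exI[of _ "butlast q"] exI[of _ "last q"]) auto
  qed
  have M: "spider_matrix n b i j = 2 \<or> 3 \<le> spider_matrix n b i j" for i j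
    by (simp add: spider_matrix_def)
  show ?thesis
    unfolding 2 iso_model_iff[OF M] bij_betw_list[of n S ?Q, symmetric] using 1 by blast
qed

section \<open>Connected components and the two equivalences\<close>

definition adj_rel :: "('a \<times> 'a) set" where
  "adj_rel = {(s, t). s \<in> S \<and> t \<in> S \<and> s \<noteq> t \<and> linked s t}"

lemma sym_adj_rel: "sym adj_rel"
  unfolding sym_def adj_rel_def using linked_sym by blast

text \<open>If no edge left \<open>Y\<close>, membership in \<open>Y\<close> would be constant along
  every walk from \<open>s\<close>.\<close>

lemma connI:
  assumes K: "closed K" "s \<in> K" and reach: "\<And>t. t \<in> K \<Longrightarrow> (s, t) \<in> adj_rel\<^sup>*"
  shows "conn K"
  unfolding conn_def
proof (intro conjI allI impI)
  show KS: "K \<subseteq> S" using K by (simp add: closed_def)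
  show "K \<noteq> {}" using K by blast
  fix Y assume Y: "Y \<subseteq> K" "Y \<noteq> {}" "Y \<noteq> K"
  show "\<exists>v\<in>Y. \<exists>w\<in>K - Y. linked v w"
  proof (rule ccontr)
    assume no: "\<not> ?thesis"
    have "t \<in> K \<and> (t \<in> Y \<longleftrightarrow> s \<in> Y)" if "(s, t) \<in> adj_rel\<^sup>*" for t
      using that
    proof (induction rule: rtrancl_induct)
      case (step v w)
      have l: "v \<in> S" "w \<in> S" "linked v w" "linked w v"
        using step(2) linked_sym by (auto simp: adj_rel_def)
      then have "w \<in> K" using step(3) K(1) unfolding closed_def by blast
      then show ?case using no l step(3) by blast
    qed (use K in simp)
    then have "t \<in> Y \<longleftrightarrow> s \<in> Y" if "t \<in> K" for t using reach that by blast
    then show False using Y K by blast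
  qed
qed

lemma component:
  assumes "s \<in> S"
  shows "\<exists>K. s \<in> K \<and> closed K \<and> conn K"
proof -
  let ?K = "{t. (s, t) \<in> adj_rel\<^sup>*}"
  have S: "t \<in> S" if "(s, t) \<in> adj_rel\<^sup>*" for t
    using that assms by (induction rule: rtrancl_induct) (auto simp: adj_rel_def)
  have "w \<in> ?K" if v: "v \<in> ?K" and w: "w \<in> S" "linked v w" for v w
  proof (cases "v = w")
    case False
    have sv: "(s, v) \<in> adj_rel\<^sup>*" using v by simp
    have "(v, w) \<in> adj_rel" using S[OF sv] w False by (simp add: adj_rel_def)
    with sv have "(s, w) \<in> adj_rel\<^sup>*" by (rule rtrancl_into_rtrancl)
    then show ?thesis by simp
  qed (use v in simp)
  then have K: "closed ?K" unfolding closed_def using S by blast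
  have "conn ?K" by (rule connI[OF K, of s]) simp_all
  then show ?thesis using K by (intro exI[of _ ?K]) simp
qed

lemma connected_rel: "{(x, y). \<exists>l. ({x, y}, l) \<in> snd (coxeter_graph S m)} = adj_rel"
proof -
  have "(\<exists>l. ({x, y}, l) \<in> snd (coxeter_graph S m)) \<longleftrightarrow> (x, y) \<in> adj_rel" for x y
  proof
    assume "\<exists>l. ({x, y}, l) \<in> snd (coxeter_graph S m)"
    then have xy: "x \<in> S" "y \<in> S" by (auto simp: coxeter_graph_def doubleton_eq_iff)
    then have "3 \<le> m x y" using \<open>\<exists>l. _\<close> coxeter_edge by blast
    then show "(x, y) \<in> adj_rel" using xy m_self[of x] by (auto simp: adj_rel_def)
  next
    assume "(x, y) \<in> adj_rel"
    then show "\<exists>l. ({x, y}, l) \<in> snd (coxeter_graph S m)"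
      using coxeter_edge[of x y "m x y"] m_distinct[of x y] by (auto simp: adj_rel_def)
  qed
  then show ?thesis by auto
qed

lemma irreducible_iff:
  "irreducible_coxeter S m \<longleftrightarrow> S \<noteq> {} \<and> (\<forall>s\<in>S. \<forall>t\<in>S. (s, t) \<in> adj_rel\<^sup>*)"
  unfolding irreducible_coxeter_def connected_graph_def connected_rel
  by (simp add: coxeter_graph_def)

lemma closed_S: "closed S"
  by (simp add: closed_def)

lemma irreducible_conn: "irreducible_coxeter S m \<Longrightarrow> conn S"
  unfolding irreducible_iff using connI[OF closed_S] by blast

lemma irreducibleI:
  assumes "s \<in> S" "\<And>t. t \<in> S \<Longrightarrow> (s, t) \<in> adj_rel\<^sup>*"
  shows "irreducible_coxeter S m"
  unfolding irreducible_iff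
proof (intro conjI ballI)
  show "S \<noteq> {}" using assms(1) by blast
  fix t u assume "t \<in> S" "u \<in> S"
  then have "(s, t) \<in> adj_rel\<^sup>*" "(s, u) \<in> adj_rel\<^sup>*" using assms(2) by blast+
  moreover have "sym (adj_rel\<^sup>*)" using sym_adj_rel by (rule sym_rtrancl)
  ultimately show "(t, u) \<in> adj_rel\<^sup>*" by (meson rtrancl_trans symD)
qed

lemma pathlike_reach:
  assumes "distinct p" "set p \<subseteq> S" "pathlike p l" "\<And>i. l i \<noteq> 2" "i < length p"
  shows "(p ! 0, p ! i) \<in> adj_rel\<^sup>*"
  using assms(5)
proof (induction i)
  case (Suc i)
  have "p ! i \<in> S" "p ! Suc i \<in> S" using Suc.prems assms(2) nth_mem[of i p] nth_mem[of "Suc i" p] by auto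
  moreover have "p ! i \<noteq> p ! Suc i" using Suc.prems assms(1) by (simp add: nth_eq_iff_index_eq)
  moreover have "linked (p ! i) (p ! Suc i)" using Suc.prems assms(3,4) by (simp add: pathlike_def)
  ultimately have "(p ! i, p ! Suc i) \<in> adj_rel" by (simp add: adj_rel_def)
  then show ?case using Suc by (auto intro: rtrancl_into_rtrancl)
qed simp

lemma path_irreducible:
  assumes "path_type S n l" "\<And>i. l i \<noteq> 2" "1 \<le> n"
  shows "irreducible_coxeter S m"
proof -
  obtain p where p: "distinct p" "length p = n" "set p = S" "pathlike p l"
    using assms(1) unfolding path_type_def by blast
  have "p ! 0 \<in> S" using p(2,3) assms(3) nth_mem[of 0 p] by simp
  then show ?thesis
    by (rule irreducibleI) (use pathlike_reach[OF p(1) _ p(4) assms(2)] p(3) in \<open>force simp: in_set_conv_nth\<close>)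
qed

lemma spider_irreducible:
  assumes "spider_type S n j" "Suc j < n"
  shows "irreducible_coxeter S m"
proof -
  obtain p x where p: "distinct p" "Suc (length p) = n" "x \<notin> set p" "S = insert x (set p)"
    "pathlike p (\<lambda>_. 3)" "\<forall>i<length p. m x (p ! i) = (if i = j then 3 else 2)"
    using assms(1) unfolding spider_type_def by blast
  have reach: "(p ! 0, p ! i) \<in> adj_rel\<^sup>*" if "i < length p" for i
    by (rule pathlike_reach[OF p(1) _ p(5) _ that]) (use p(4) in auto)
  have j: "j < length p" using assms(2) p(2) by simp
  have S: "p ! j \<in> S" "p ! j \<noteq> x" "x \<in> S" using nth_mem[OF j] p(3,4) by auto
  have "linked (p ! j) x" using p(6) j m_sym[OF S(1,3)] by simp
  then have "(p ! j, x) \<in> adj_rel" using S by (simp add: adj_rel_def)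
  then have "(p ! 0, x) \<in> adj_rel\<^sup>*" using reach[OF j] by (rule rtrancl_into_rtrancl[rotated])
  moreover have "(p ! 0, t) \<in> adj_rel\<^sup>*" if "t \<in> set p" for t
    using that reach by (metis in_set_conv_nth)
  moreover have "p ! 0 \<in> S" using j p(4) nth_mem[of 0 p] by (cases p) auto
  ultimately show ?thesis by (intro irreducibleI[of "p ! 0"]) (use p(4) in auto)
qed

lemma listed_irreducible: "listed S \<Longrightarrow> irreducible_coxeter S m"
  unfolding listed_def
proof (elim disjE exE conjE)
  fix k assume "5 \<le> k" "path_type S 2 (\<lambda>_. enat k)"
  then show ?thesis by (intro path_irreducible) (auto simp: numeral_eq_enat)
qed (erule path_irreducible spider_irreducible; simp split: if_splits)+

lemma listed_FC_finite: "listed S \<Longrightarrow> FC_finite S m"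
  using FC_finite_bounded_letters listed_bounded closed_S by blast

lemma CFC_finite_listed:
  assumes "CFC_finite S m" "conn K" "closed K"
  shows "listed K"
proof -
  interpret cfc_finite_coxeter S m by unfold_locales (rule assms(1))
  show ?thesis using conn_closed_listed[OF assms(2,3)] .
qed

text \<open>Every letter lies in a component, and CFC-finiteness of the whole group forces each
  component to be listed.\<close>

lemma CFC_finite_FC_finite:
  assumes "CFC_finite S m"
  shows "FC_finite S m"
proof (rule FC_finite_bounded_letters)
  fix s assume "s \<in> S"
  then obtain K where "s \<in> K" "closed K" "conn K" using component by blast
  then show "bounded_letter s" using CFC_finite_listed[OF assms] listed_bounded by blast
qed

lemma listed_S_iff:
  "listed S \<longleftrightarrow>
    (\<exists>n\<ge>1. graph_isomorphic (A_graph n) (coxeter_graph S m)) \<or>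
    (\<exists>n\<ge>2. graph_isomorphic (B_graph n) (coxeter_graph S m)) \<or>
    (\<exists>n\<ge>4. graph_isomorphic (D_graph n) (coxeter_graph S m)) \<or>
    (\<exists>n\<ge>6. graph_isomorphic (E_graph n) (coxeter_graph S m)) \<or>
    (\<exists>n\<ge>4. graph_isomorphic (F_graph n) (coxeter_graph S m)) \<or>
    (\<exists>n\<ge>3. graph_isomorphic (H_graph n) (coxeter_graph S m)) \<or>
    (\<exists>k\<ge>5. graph_isomorphic (I2_graph k) (coxeter_graph S m))"
proof -
  have "graph_isomorphic (A_graph n) (coxeter_graph S m) \<longleftrightarrow> path_type S n (\<lambda>_. 3)"
    "graph_isomorphic (B_graph n) (coxeter_graph S m) \<longleftrightarrow> path_type S n (\<lambda>i. if i = 0 then 4 else 3)"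
    "graph_isomorphic (F_graph n) (coxeter_graph S m) \<longleftrightarrow> path_type S n (\<lambda>i. if i = 1 then 4 else 3)"
    "graph_isomorphic (H_graph n) (coxeter_graph S m) \<longleftrightarrow> path_type S n (\<lambda>i. if i = 0 then 5 else 3)" for n
    unfolding A_graph_model B_graph_model F_graph_model H_graph_model
    by (intro path_iso_iff; simp)+
  moreover have "4 \<le> n \<and> graph_isomorphic (D_graph n) (coxeter_graph S m) \<longleftrightarrow> 4 \<le> n \<and> spider_type S n 1" for n
    using D_graph_model[of n] spider_iso_iff[of n 1] by auto
  moreover have "6 \<le> n \<and> graph_isomorphic (E_graph n) (coxeter_graph S m) \<longleftrightarrow> 6 \<le> n \<and> spider_type S n 2" for n
    using E_graph_model[of n] spider_iso_iff[of n 2] by auto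
  moreover have "5 \<le> k \<and> graph_isomorphic (I2_graph k) (coxeter_graph S m) \<longleftrightarrow> 5 \<le> k \<and> path_type S 2 (\<lambda>_. enat k)" for k
    using I2_graph_model[of k] path_iso_iff[of "\<lambda>_. enat k" 2] by (auto simp: numeral_eq_enat)
  ultimately show ?thesis unfolding listed_def by simp
qed

end

theorem theorem5p1:
  fixes S :: "'a set" and m :: "'a \<Rightarrow> 'a \<Rightarrow> enat"
  assumes "coxeter_matrix S m"
  shows "(irreducible_coxeter S m \<and> CFC_finite S m \<longleftrightarrow>
           (\<exists>n\<ge>1. graph_isomorphic (A_graph n) (coxeter_graph S m)) \<or>
           (\<exists>n\<ge>2. graph_isomorphic (B_graph n) (coxeter_graph S m)) \<or>
           (\<exists>n\<ge>4. graph_isomorphic (D_graph n) (coxeter_graph S m)) \<or>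
           (\<exists>n\<ge>6. graph_isomorphic (E_graph n) (coxeter_graph S m)) \<or>
           (\<exists>n\<ge>4. graph_isomorphic (F_graph n) (coxeter_graph S m)) \<or>
           (\<exists>n\<ge>3. graph_isomorphic (H_graph n) (coxeter_graph S m)) \<or>
           (\<exists>k\<ge>5. graph_isomorphic (I2_graph k) (coxeter_graph S m)))
       \<and> (CFC_finite S m \<longleftrightarrow> FC_finite S m)"
proof -
  interpret coxeter S m by unfold_locales (rule assms)
  have "CFC_finite S m \<longleftrightarrow> FC_finite S m"
    using CFC_finite_FC_finite FC_finite_CFC_finite by blast
  \<comment> \<open>An irreducible \<open>S\<close> is its own component, which gives the forward
    direction; the converse passes through FC-finiteness.\<close>
  moreover have "irreducible_coxeter S m \<and> CFC_finite S m \<longleftrightarrow> listed S"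
    using CFC_finite_listed irreducible_conn closed_S listed_irreducible listed_FC_finite FC_finite_CFC_finite
    by blast
  ultimately show ?thesis unfolding listed_S_iff by blast
qed

end
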